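(* Let $0<\alpha<n$, let $1<p\le q<\infty$, and let $\sigma,w$ be weights on $\mathbb{R}^n$. Let $\varepsilon_q,\varepsilon_{p'}:(0,\infty)\to(0,\infty)$ be nonincreasing on $(0,1)$ and nondecreasing on $(1,\infty)$, with $$\int_0^\infty\frac{dt}{t\,\varepsilon_q(t)^{1/q}}<\infty,\qquad \int_0^\infty\frac{dt}{t\,\varepsilon_{p'}(t)^{1/p'}}<\infty .$$ Define $$[[\sigma,w]]_{\alpha,p,q}:=\sup_{Q\text{ a cube}}\left(|Q|^{\alpha/n}\langle\sigma\rangle_Q\right)^{q/p'}\langle w\rangle_Q\;\varrho_\sigma^{\alpha,p,q}(Q)\;\varepsilon_q\!\left(\varrho_\sigma^{\alpha,p,q}(Q)\right),$$ and correspondingly (exchanging $\sigma$ and $w$ and replacing $(p,q)$ by $(q',p')$) $$[[w,\sigma]]_{\alpha,q',p'}:=\sup_{Q\text{ a cube}}\left(|Q|^{\alpha/n}\langle w\rangle_Q\right)^{p'/q}\langle\sigma\rangle_Q\;\varrho_w^{\alpha,q',p'}(Q)\;\varepsilon_{p'}\!\left(\varrho_w^{\alpha,q',p'}(Q)\right).$$ Then there are a constant $C_{\alpha,n}$ depending only on $\alpha$ and $n$, and a constant $C$ depending only on $n,\alpha,p,q,\varepsilon_q,\varepsilon_{p'}$ (not on $\sigma,w$), such that the operator $I_\alpha^\sigma(f):=I_\alpha(\sigma f)$ satisfies $$\|I_\alpha^\sigma:L^p(\sigma)\to L^q(w)\|\le C\,C_{\alpha,n}\left([[\sigma,w]]_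{\alpha,p,q}^{1/q}+[[w,\sigma]]_{\alpha,q',p'}^{1/p'}\right).$$
   Context: A weight is a non-negative locally integrable function on $\mathbb{R}^n$ (identified with the absolutely continuous measure having it as density). For a weight $\sigma$, $\sigma(Q)=\int_Q\sigma\,dx$, $\langle\sigma\rangle_Q=\sigma(Q)/|Q|$, and $L^p(\sigma)$ is the $L^p$ space of the measure $\sigma\,dx$. $|Q|$ is Lebesgue measure; $p',q'$ are the conjugate exponents of $p,q$. The fractional integral and fractional maximal operators are $$I_\alpha f(x):=\int_{\mathbb{R}^n}\frac{f(y)}{|y-x|^{n-\alpha}}\,dy,\qquad M_\alpha f(x):=\sup_{Q\text{ a cube}}\frac{\mathbf 1_Q(x)}{|Q|^{1-\alpha/n}}\int_Q|f(y)|\,dy .$$ For a weight $\sigma$, exponents $p,q$ and a cube $Q$, $$\varrho_\sigma^{\alpha,p,q}(Q):=\frac{\int_Q \left(M_\alpha(\mathbf 1_Q\sigma)\right)^{q/p}dx}{\sigma(Q)^{q/p}},$$ so that $\varrho_w^{\alpha,q',p'}(Q)=\int_Q (M_\alpha(\mathbf 1_Q w))^{p'/q'}dx\,/\,w(Q)^{p'/q'}$. $\|T:X\to Y\|$ denotes operator norm. Conventions: the quantity inside each supremum is $0$ if $\sigma(Q)=0$ or $w(Q)=0$, and otherwise is $\infty$ if the corresponding $\varrho(Q)$ is infinite.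
   Formalization: Each of ε_q and ε_{p'} is additionally assumed bounded below by a positive constant on (0,∞), i.e. its one-sided limits at 1 are not 0; without this (e.g. ε(t)=t−1 just above 1) the stated inequality can fail. *)

theory Defs
  imports "HOL-Analysis.Analysis"
begin

definition conj_exp :: "real \<Rightarrow> real" where
  "conj_exp p = p / (p - 1)"

(* Power with a positive exponent on [0,\<infinity>]; only exponents a > 0 are used. *)
definition epowr :: "ennreal \<Rightarrow> real \<Rightarrow> ennreal" (infixr "epowr" 80) where
  "x epowr a = (if x = \<infinity> then \<infinity> else ennreal (enn2real x powr a))"

(* Axis-parallel cubes; only closed ones are listed, since the faces are null sets. *)
definition cubes :: "(real^'n) set set" where
  "cubes = {cbox a (\<chi> i. a $ i + l) | a l. 0 < l}"

definition weight :: "(real^'n \<Rightarrow> real) \<Rightarrow> bool" where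
  "weight \<sigma> \<longleftrightarrow> (\<forall>x. 0 \<le> \<sigma> x) \<and> (\<forall>K. compact K \<longrightarrow> set_integrable lebesgue K \<sigma>)"

definition weight_measure :: "(real^'n \<Rightarrow> real) \<Rightarrow> (real^'n) measure" where
  "weight_measure \<sigma> = density lebesgue (\<lambda>x. ennreal (\<sigma> x))"

definition average :: "(real^'n \<Rightarrow> real) \<Rightarrow> (real^'n) set \<Rightarrow> ennreal" where
  "average \<sigma> Q = emeasure (weight_measure \<sigma>) Q / emeasure lebesgue Q"

definition frac_max :: "real \<Rightarrow> (real^'n \<Rightarrow> real) \<Rightarrow> real^'n \<Rightarrow> ennreal" where
  "frac_max \<alpha> f x =
    (SUP Q\<in>cubes. indicator Q x / (emeasure lebesgue Q epowr (1 - \<alpha> / real CARD('n)))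
                   * (\<integral>\<^sup>+y\<in>Q. ennreal \<bar>f y\<bar> \<partial>lebesgue))"

(* The Bochner integral is 0 where the defining integral does not converge absolutely;
   frac_int_defined records convergence and is required of the operator in Lp_op_norm. *)
definition frac_int :: "real \<Rightarrow> (real^'n \<Rightarrow> complex) \<Rightarrow> real^'n \<Rightarrow> complex" where
  "frac_int \<alpha> f x =
    (LINT y|lebesgue. f y / of_real (norm (y - x) powr (real CARD('n) - \<alpha>)))"

definition frac_int_defined :: "real \<Rightarrow> (real^'n \<Rightarrow> complex) \<Rightarrow> real^'n \<Rightarrow> bool" where
  "frac_int_defined \<alpha> f x \<longleftrightarrow>
    integrable lebesgue (\<lambda>y. f y / of_real (norm (y - x) powr (real CARD('n) - \<alpha>)))"

definition Lp_space :: "'a measure \<Rightarrow> real \<Rightarrow> ('a \<Rightarrow> complex) set" where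
  "Lp_space M p = {f \<in> borel_measurable M. integrable M (\<lambda>x. norm (f x) powr p)}"

definition Lp_norm :: "'a measure \<Rightarrow> real \<Rightarrow> ('a \<Rightarrow> complex) \<Rightarrow> real" where
  "Lp_norm M p f = (LINT x|M. norm (f x) powr p) powr (1 / p)"

(* Norm of the operator T from L^p(M) to L^q(N), where D f x says that T f is defined at x.
   It is \<infinity> unless, for every f in L^p(M), T f is defined N-almost everywhere
   and lies in L^q(N), with a uniform bound. *)
definition Lp_op_norm ::
  "'a measure \<Rightarrow> real \<Rightarrow> 'b measure \<Rightarrow> real \<Rightarrow> (('a \<Rightarrow> complex) \<Rightarrow> 'b \<Rightarrow> bool)
    \<Rightarrow> (('a \<Rightarrow> complex) \<Rightarrow> 'b \<Rightarrow> complex) \<Rightarrow> ennreal" where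
  "Lp_op_norm M p N q D T =
    Inf {ennreal C | C. 0 \<le> C \<and>
      (\<forall>f\<in>Lp_space M p. (AE x in N. D f x) \<and> T f \<in> Lp_space N q
                        \<and> Lp_norm N q (T f) \<le> C * Lp_norm M p f)}"

definition frac_int_op_norm ::
  "real \<Rightarrow> real \<Rightarrow> real \<Rightarrow> (real^'n \<Rightarrow> real) \<Rightarrow> (real^'n \<Rightarrow> real) \<Rightarrow> ennreal" where
  "frac_int_op_norm \<alpha> p q \<sigma> w =
    Lp_op_norm (weight_measure \<sigma>) p (weight_measure w) q
      (\<lambda>f. frac_int_defined \<alpha> (\<lambda>y. of_real (\<sigma> y) * f y))
      (\<lambda>f. frac_int \<alpha> (\<lambda>y. of_real (\<sigma> y) * f y))"

definition rho :: "real \<Rightarrow> real \<Rightarrow> real \<Rightarrow> (real^'n \<Rightarrow> real) \<Rightarrow> (real^'n) set \<Rightarrow> ennreal" where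
  "rho \<alpha> p q \<sigma> Q =
    (\<integral>\<^sup>+x\<in>Q. (frac_max \<alpha> (\<lambda>y. indicator Q y * \<sigma> y) x epowr (q / p)) \<partial>lebesgue)
      / (emeasure (weight_measure \<sigma>) Q epowr (q / p))"

definition entropy_bump ::
  "real \<Rightarrow> real \<Rightarrow> real \<Rightarrow> (real \<Rightarrow> real) \<Rightarrow> (real^'n \<Rightarrow> real) \<Rightarrow> (real^'n \<Rightarrow> real) \<Rightarrow> ennreal" where
  "entropy_bump \<alpha> p q \<epsilon> \<sigma> w =
    (SUP Q\<in>cubes.
      if emeasure (weight_measure \<sigma>) Q = 0 \<or> emeasure (weight_measure w) Q = 0 then 0
      else if rho \<alpha> p q \<sigma> Q = \<infinity> then \<infinity>
      else ((emeasure lebesgue Q epowr (\<alpha> / real CARD('n))) * average \<sigma> Q) epowr (q / conj_exp p)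
             * average w Q * rho \<alpha> p q \<sigma> Q * ennreal (\<epsilon> (enn2real (rho \<alpha> p q \<sigma> Q))))"

(* Only the values of \<epsilon> on (0,\<infinity>) are relevant. Integrability already forces \<epsilon> to be unbounded near
   0 and near \<infinity>, so, given positivity and monotonicity, the lower bound c only excludes that
   \<epsilon> has a one-sided limit 0 at 1. *)
definition bump_function :: "real \<Rightarrow> (real \<Rightarrow> real) \<Rightarrow> bool" where
  "bump_function r \<epsilon> \<longleftrightarrow>
    (\<forall>t>0. 0 < \<epsilon> t) \<and> antimono_on {0<..<1} \<epsilon> \<and> mono_on {1<..} \<epsilon> \<and>
    (\<exists>c>0. \<forall>t>0. c \<le> \<epsilon> t) \<and>
    set_integrable lborel {0<..} (\<lambda>t. 1 / (t * \<epsilon> t powr (1 / r)))"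

end

theory Submission
  imports Defs
begin

text \<open>
  By the one-third trick the Riesz kernel is dominated by the kernels
  \<open>\<Sum>\<^sub>Q |Q|\<^bsup>\<alpha>/n-1\<^esup> 1\<^sub>Q(x) 1\<^sub>Q(y)\<close> of finitely many shifted dyadic grids. By duality and monotone convergence it
  suffices to bound \<open>\<Sum>\<^sub>Q |Q|\<^bsup>\<alpha>/n-1\<^esup> \<integral>\<^sub>Q f\<sigma> \<integral>\<^sub>Q gw\<close> over finite sets of dyadic cubes, and the principal cubes of the
  Lebesgue averages of \<open>f\<sigma>\<close> reduce this to families with a Carleson packing condition.

  Such a family is divided according to which of the two principal cubes of \<open>Q\<close>, for the averages of \<open>f\<close>
  with respect to \<open>\<sigma>\<close> and of \<open>g\<close> with respect to \<open>w\<close>, contains the other; by symmetry let the one for \<open>f\<close> be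
  the larger. Put \<open>s\<^sub>Q = |Q|\<^bsup>\<alpha>/n-1\<^esup> \<sigma>(Q)\<close> and split further into the classes where \<open>\<rho>\<close> and
  \<open>s\<^bsup>q/p'\<^esup> \<langle>w\<rangle>\<close> are constant up to a factor 2. Within a class, the sum of \<open>s\<^sub>Q w(Q)\<close> over the cubes \<open>Q\<close> inside \<open>R\<close> is at most
  a multiple of \<open>s\<^sub>R w(R)\<close>, and the definition of \<open>\<rho>\<close> bounds the sum of \<open>s\<^sub>Q\<^bsup>q\<^esup> w(Q)\<close> over the cubes inside \<open>P\<close> by a
  multiple of \<open>\<sigma>(P)\<^bsup>q/p\<^esup>\<close>. With Hoelder's inequality and the Carleson embedding
  for principal cubes, each class contributes its share of the entropy constant; the shares are summable since they decay
  geometrically in \<open>s\<^bsup>q/p'\<^esup> \<langle>w\<rangle>\<close> and like \<open>\<epsilon>(\<rho>)\<^bsup>-1/q\<^esup>\<close> in \<open>\<rho>\<close>.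
\<close>

section \<open>Dyadic levels and elementary inequalities\<close>

text \<open>The obstacle: principal cubes are packed for Lebesgue measure, but nothing like an
  A_infinity condition gives packing for \<open>w\<close>. Freezing s_Q^(q/p') <w>_Q in a class is
  what converts Lebesgue packing into packing of s_Q w(Q); after that every family collapses to its
  maximal, hence disjoint, cubes and Hoelder's inequality loses nothing. The factor \<rho> is what
  it costs to bound the integral of M_\<alpha>(1_R \<sigma>)^(q/p) by \<sigma>(R)^(q/p). It cancels
  against the \<rho> in the entropy constant, so \<epsilon> pays only for summing over the levels of
  \<rho>.

  The hypothesis p <= q enters through the embeddings of l^1 into l^(q/p) and into l^(p'/q').

  The combinatorial half knows neither measures nor cubes, only finite laminar families and positive
  superadditive set functions. Lebesgue measure, \<sigma>, w, f\<sigma> and gw are thus on an equal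
  footing, and the dual half is a second instance with (q', p') and the weights exchanged.\<close>

definition lv :: "real \<Rightarrow> int" where
  "lv x = \<lfloor>log 2 x\<rfloor>"

lemma lv_lower: "0 < x \<Longrightarrow> 2 powr lv x \<le> x"
  using floor_log_eq_powr_iff[of x 2 "lv x"] by (simp add: lv_def)

lemma lv_upper: "0 < x \<Longrightarrow> x < 2 * 2 powr lv x"
  using floor_log_eq_powr_iff[of x 2 "lv x"] by (simp add: lv_def powr_add)

lemma lv_eq: "2 powr k \<le> x \<Longrightarrow> x < 2 * 2 powr k \<Longrightarrow> lv x = k" for k :: int
  using floor_log_eq_powr_iff[of x 2 k] powr_gt_zero[of 2 "real_of_int k"]
  unfolding lv_def by (simp add: powr_add)

lemma lv_mono: "0 < x \<Longrightarrow> x \<le> y \<Longrightarrow> lv x \<le> lv y"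
  by (simp add: lv_def floor_mono)

text \<open>Twice the one-sided geometric sum, hence a bound for the two-sided series of
  2^(-\<delta> |k|) with k = 0 counted twice.\<close>

definition geo :: "real \<Rightarrow> real" where
  "geo \<delta> = 2 / (1 - 2 powr (- \<delta>))"

lemma geo_pos: "0 < \<delta> \<Longrightarrow> 0 < geo \<delta>"
  by (simp add: geo_def powr_less_one)

lemma sum_geo_le:
  fixes \<delta> :: real and I :: "int set"
  assumes "0 < \<delta>" "finite I"
  shows "(\<Sum>k\<in>I. 2 powr (- \<delta> * \<bar>k\<bar>)) \<le> geo \<delta>"
proof -
  define x where "x = 2 powr (- \<delta>)"
  have x: "0 \<le> x" "x < 1" using assms by (simp_all add: x_def powr_less_one)
  have e: "2 powr (- \<delta> * \<bar>k\<bar>) = x ^ nat \<bar>k\<bar>" for k :: int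
  proof -
    have "x ^ nat \<bar>k\<bar> = x powr real (nat \<bar>k\<bar>)"
      by (rule powr_realpow[symmetric]) (simp add: x_def)
    then show ?thesis by (simp add: x_def powr_powr)
  qed
  have half: "(\<Sum>k\<in>J. x ^ nat \<bar>k\<bar>) \<le> 1 / (1 - x)"
    if "finite J" "inj_on (\<lambda>k. nat \<bar>k\<bar>) J" for J :: "int set"
  proof -
    have "(\<Sum>k\<in>J. x ^ nat \<bar>k\<bar>) = (\<Sum>n\<in>(\<lambda>k. nat \<bar>k\<bar>) ` J. x ^ n)"
      using that by (simp add: sum.reindex)
    also have "\<dots> \<le> (\<Sum>n. x ^ n)"
      using that x by (intro sum_le_suminf) (auto intro: summable_geometric)
    also have "\<dots> = 1 / (1 - x)" using x by (intro suminf_geometric) simp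
    finally show ?thesis .
  qed
  have "(\<Sum>k\<in>I. 2 powr (- \<delta> * \<bar>k\<bar>)) = (\<Sum>k\<in>{k\<in>I. 0 \<le> k} \<union> {k\<in>I. k < 0}. x ^ nat \<bar>k\<bar>)"
    using e by (intro sum.cong) auto
  also have "\<dots> = (\<Sum>k\<in>{k\<in>I. 0 \<le> k}. x ^ nat \<bar>k\<bar>) + (\<Sum>k\<in>{k\<in>I. k < 0}. x ^ nat \<bar>k\<bar>)"
    using assms by (intro sum.union_disjoint) auto
  also have "\<dots> \<le> 1 / (1 - x) + 1 / (1 - x)"
    using assms by (intro add_mono half) (auto simp: inj_on_def)
  finally show ?thesis by (simp add: geo_def x_def)
qed

lemma sum_powr_below_le:
  fixes I :: "int set" and \<delta> y :: real
  assumes "0 < \<delta>" "finite I" "0 < y" "\<And>k. k \<in> I \<Longrightarrow> 2 powr k \<le> y"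
  shows "(\<Sum>k\<in>I. 2 powr (k * \<delta>)) \<le> geo \<delta> * y powr \<delta>"
proof -
  define k0 where "k0 = lv y"
  have le: "k \<le> k0" if "k \<in> I" for k
  proof -
    have "2 powr real_of_int k < 2 powr (k0 + 1)"
      using assms(4)[OF that] lv_upper[OF assms(3)] by (simp add: k0_def powr_add)
    then show ?thesis by (simp add: powr_less_cancel_iff)
  qed
  have "(\<Sum>k\<in>I. 2 powr (k * \<delta>)) = (\<Sum>k\<in>I. 2 powr (k0 * \<delta>) * 2 powr (- \<delta> * \<bar>k - k0\<bar>))"
    using le by (intro sum.cong refl) (simp add: powr_add[symmetric] algebra_simps)
  also have "\<dots> = 2 powr (k0 * \<delta>) * (\<Sum>k\<in>(\<lambda>k. k - k0) ` I. 2 powr (- \<delta> * \<bar>k\<bar>))"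
    by (simp add: sum_distrib_left sum.reindex inj_on_def)
  also have "\<dots> \<le> 2 powr (k0 * \<delta>) * geo \<delta>"
    using assms sum_geo_le[of \<delta> "(\<lambda>k. k - k0) ` I"] by (intro mult_left_mono) auto
  also have "2 powr (k0 * \<delta>) = (2 powr k0) powr \<delta>" by (simp add: powr_powr)
  also have "\<dots> \<le> y powr \<delta>"
    using assms lv_lower[of y] by (intro powr_mono2) (auto simp: k0_def)
  finally show ?thesis using geo_pos[OF assms(1)] by (simp add: mult.commute mult_left_mono)
qed

text \<open>Embedding of l^1 into l^r: with S the sum, a^r = a a^(r-1) <= a S^(r-1). Through it the
  relation p <= q is exploited.\<close>

lemma sum_powr_le_powr_sum:
  assumes "1 \<le> r" "finite A" "\<And>x. x \<in> A \<Longrightarrow> 0 \<le> a x"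
  shows "(\<Sum>x\<in>A. a x powr r) \<le> (\<Sum>x\<in>A. a x) powr (r::real)"
proof -
  define S where "S = (\<Sum>x\<in>A. a x)"
  have S: "0 \<le> S" using assms by (simp add: S_def sum_nonneg)
  have "(\<Sum>x\<in>A. a x powr r) \<le> (\<Sum>x\<in>A. a x * S powr (r - 1))"
  proof (rule sum_mono)
    fix x assume x: "x \<in> A"
    have "a x \<le> S" unfolding S_def using assms x by (intro member_le_sum) auto
    then have "a x powr (r - 1) \<le> S powr (r - 1)" using assms x by (intro powr_mono2) auto
    moreover have "a x powr r = a x * a x powr (r - 1)"
      using assms(3)[OF x] powr_add[of "a x" 1 "r - 1"] by (cases "a x = 0") auto
    ultimately show "a x powr r \<le> a x * S powr (r - 1)"
      using assms(3)[OF x] by (simp add: mult_left_mono)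
  qed
  also have "\<dots> = S * S powr (r - 1)" by (simp add: S_def sum_distrib_right)
  also have "\<dots> = S powr r"
    using S powr_add[of S 1 "r - 1"] by (cases "S = 0") auto
  finally show ?thesis by (simp add: S_def)
qed

lemma Holder_sum:
  fixes p q :: real
  assumes "1 < p" "1 / p + 1 / q = 1" "finite A"
    and a: "\<And>x. x \<in> A \<Longrightarrow> 0 \<le> a x" and b: "\<And>x. x \<in> A \<Longrightarrow> 0 \<le> b x"
  shows "(\<Sum>x\<in>A. a x * b x) \<le> (\<Sum>x\<in>A. a x powr p) powr (1 / p) * (\<Sum>x\<in>A. b x powr q) powr (1 / q)"
proof -
  have "1 / p < 1" using assms(1) by simp
  then have "1 / q > 0" "1 / q < 1" using assms(1,2)
    by (linarith, metis less_add_same_cancel2 less_trans zero_less_divide_1_iff zero_less_one)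
  then have q: "0 < q" "1 < q" by (simp_all add: divide_less_eq split: if_splits)
  define X where "X = (\<Sum>x\<in>A. a x powr p)"
  define Y where "Y = (\<Sum>x\<in>A. b x powr q)"
  have X0: "0 \<le> X" and Y0: "0 \<le> Y" by (simp_all add: X_def Y_def sum_nonneg)
  show ?thesis
  proof (cases "X = 0 \<or> Y = 0")
    case True
    then have "a x * b x = 0" if "x \<in> A" for x
      using that assms(3) unfolding X_def Y_def by (auto simp: sum_nonneg_eq_0_iff)
    then have "(\<Sum>x\<in>A. a x * b x) = 0" by (intro sum.neutral) auto
    then show ?thesis by simp
  next
    case False
    define u where "u = X powr (1 / p)"
    define v where "v = Y powr (1 / q)"
    have uv: "u > 0" "v > 0" using False X0 Y0 by (auto simp: u_def v_def)
    have up: "u powr p = X" "v powr q = Y"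
      using False X0 Y0 assms q by (auto simp: u_def v_def powr_powr)
    have "(\<Sum>x\<in>A. (a x / u) * (b x / v)) \<le> (\<Sum>x\<in>A. (a x / u) powr p / p + (b x / v) powr q / q)"
      using assms q a b uv by (intro sum_mono Youngs_inequality) auto
    also have "\<dots> = (\<Sum>x\<in>A. a x powr p / X / p + b x powr q / Y / q)"
      using a b uv up by (intro sum.cong refl) (simp add: powr_divide)
    also have "\<dots> = X / X / p + Y / Y / q"
      by (simp only: sum.distrib sum_divide_distrib[symmetric] X_def[symmetric] Y_def[symmetric])
    also have "\<dots> = 1" using False assms by simp
    finally have "(\<Sum>x\<in>A. a x * b x) / (u * v) \<le> 1"
      by (simp add: sum_divide_distrib)
    then show ?thesis using uv by (simp add: field_simps u_def v_def X_def Y_def)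
  qed
qed

section \<open>Principal sets in finite laminar families\<close>

text \<open>Models a finite set of dyadic cubes. Finiteness provides maximal members; excluding the
  empty set makes two members above a common one meet, hence comparable.\<close>

locale laminar_family =
  fixes F :: "'a set set"
  assumes finite_F: "finite F"
    and empty_notin: "{} \<notin> F"
    and laminar: "P \<in> F \<Longrightarrow> Q \<in> F \<Longrightarrow> P \<subseteq> Q \<or> Q \<subseteq> P \<or> P \<inter> Q = {}"

text \<open>All that the combinatorial part uses of a measure. Positivity is built in so that
  averages can be formed and inverted freely; cubes of zero mass are discarded beforehand.\<close>

definition superadditive :: "'a set set \<Rightarrow> ('a set \<Rightarrow> real) \<Rightarrow> bool" where
  "superadditive F \<mu> \<longleftrightarrow> (\<forall>Q\<in>F. 0 < \<mu> Q) \<and>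
    (\<forall>R\<in>F. \<forall>D\<subseteq>F. disjoint D \<and> \<Union>D \<subseteq> R \<longrightarrow> sum \<mu> D \<le> \<mu> R)"

lemma superadditive_pos: "superadditive F \<mu> \<Longrightarrow> Q \<in> F \<Longrightarrow> 0 < \<mu> Q"
  by (simp add: superadditive_def)

lemma superadditiveD:
  "superadditive F \<mu> \<Longrightarrow> R \<in> F \<Longrightarrow> D \<subseteq> F \<Longrightarrow> disjoint D \<Longrightarrow> \<Union>D \<subseteq> R \<Longrightarrow> sum \<mu> D \<le> \<mu> R"
  by (simp add: superadditive_def)

lemma superadditive_subset: "superadditive F \<mu> \<Longrightarrow> D \<subseteq> F \<Longrightarrow> superadditive D \<mu>"
  unfolding superadditive_def by (meson order_trans subsetD)

definition maxs :: "'a set set \<Rightarrow> 'a set set" where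
  "maxs D = {Q\<in>D. \<forall>P\<in>D. \<not> Q \<subset> P}"

abbreviation below :: "'a set set \<Rightarrow> 'a set \<Rightarrow> 'a set set" where
  "below D R \<equiv> {Q\<in>D. Q \<subseteq> R}"

text \<open>Ensures that the members on one dyadic level of c are disjoint, so that superadditivity
  applies level by level. Volume has this property on a grid, and c has it on its own principal
  sets.\<close>

definition level_antichain :: "'a set set \<Rightarrow> ('a set \<Rightarrow> real) \<Rightarrow> bool" where
  "level_antichain D c \<longleftrightarrow> (\<forall>P\<in>D. \<forall>Q\<in>D. P \<subset> Q \<longrightarrow> lv (c P) \<noteq> lv (c Q))"

lemma level_antichain_subset: "level_antichain F c \<Longrightarrow> D \<subseteq> F \<Longrightarrow> level_antichain D c"
  unfolding level_antichain_def by blast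

text \<open>The level of a maximal function of c at Q, taken over the members that contain
  Q.\<close>

definition top_lv :: "'a set set \<Rightarrow> ('a set \<Rightarrow> real) \<Rightarrow> 'a set \<Rightarrow> int" where
  "top_lv F c Q = Max ((\<lambda>P. lv (c P)) ` {P\<in>F. Q \<subseteq> P})"

text \<open>The sets in the union form a chain, so it is the largest of them: the principal (stopping) set of \<open>Q\<close>.\<close>

definition stop :: "'a set set \<Rightarrow> ('a set \<Rightarrow> real) \<Rightarrow> 'a set \<Rightarrow> 'a set" where
  "stop F c Q = \<Union>{P\<in>F. Q \<subseteq> P \<and> lv (c P) = top_lv F c Q}"

text \<open>The recurring scheme: slice by an integer level, show decay away from
  \<open>base\<close>, and lose only a factor \<open>geo \<delta>\<close>.\<close>

lemma sum_levels_le: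
  fixes lev :: "'b \<Rightarrow> int" and \<delta> :: real and base :: int
  assumes "finite D" "0 < \<delta>" "0 \<le> X"
    and "\<And>k. (\<Sum>Q\<in>{Q\<in>D. lev Q = k}. h Q) \<le> X * 2 powr (- \<delta> * \<bar>k - base\<bar>)"
  shows "sum h D \<le> X * geo \<delta>"
proof -
  have "sum h D = (\<Sum>k\<in>lev ` D. \<Sum>Q\<in>{Q\<in>D. lev Q = k}. h Q)"
    using assms(1) by (rule sum.image_gen)
  also have "\<dots> \<le> (\<Sum>k\<in>lev ` D. X * 2 powr (- \<delta> * \<bar>k - base\<bar>))"
    by (intro sum_mono assms)
  also have "\<dots> = X * (\<Sum>k\<in>(\<lambda>k. k - base) ` lev ` D. 2 powr (- \<delta> * \<bar>k\<bar>))"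
    by (simp add: sum_distrib_left sum.reindex inj_on_def)
  also have "\<dots> \<le> X * geo \<delta>"
    using assms by (intro mult_left_mono sum_geo_le) auto
  finally show ?thesis .
qed

context laminar_family
begin

lemma subfamily:
  assumes "D \<subseteq> F"
  shows "laminar_family D"
proof
  show "finite D" using assms finite_F by (rule finite_subset)
  show "{} \<notin> D" using assms empty_notin by blast
  show "P \<subseteq> Q \<or> Q \<subseteq> P \<or> P \<inter> Q = {}" if "P \<in> D" "Q \<in> D" for P Q
    using laminar[of P Q] that assms by (meson subsetD)
qed

lemma antichain_disjoint:
  assumes "D \<subseteq> F" "\<And>P Q. P \<in> D \<Longrightarrow> Q \<in> D \<Longrightarrow> \<not> P \<subset> Q"
  shows "disjoint D"
proof (rule disjointI)
  fix a b assume ab: "a \<in> D" "b \<in> D" "a \<noteq> b"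
  then show "a \<inter> b = {}" using laminar[of a b] assms(1) assms(2)[of a b] assms(2)[of b a] by blast
qed

lemma maxs_disjoint: "D \<subseteq> F \<Longrightarrow> disjoint (maxs D)"
  by (rule antichain_disjoint) (auto simp: maxs_def)

lemma maxs_cover:
  assumes "D \<subseteq> F" "Q \<in> D"
  shows "\<exists>P\<in>maxs D. Q \<subseteq> P"
proof -
  have "finite D" using assms finite_F finite_subset by blast
  then obtain P where "P \<in> D" "Q \<subseteq> P" "\<And>R. R \<in> D \<Longrightarrow> P \<subseteq> R \<Longrightarrow> P = R"
    using finite_has_maximal2[of D Q] assms by metis
  then show ?thesis by (auto simp: maxs_def)
qed

lemma sum_le_sum_maxs:
  assumes "D \<subseteq> F" "\<And>Q. Q \<in> D \<Longrightarrow> 0 \<le> (h Q :: real)"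
  shows "sum h D \<le> (\<Sum>P\<in>maxs D. \<Sum>Q\<in>below D P. h Q)"
proof -
  have fin: "finite D" "finite (maxs D)"
    using finite_subset[OF assms(1) finite_F] by (simp_all add: maxs_def)
  have "sum h D = sum h (\<Union>P\<in>maxs D. below D P)"
    using maxs_cover[OF assms(1)] by (intro sum.cong) auto
  also have "\<dots> = (\<Sum>P\<in>maxs D. \<Sum>Q\<in>below D P. h Q)"
  proof (rule sum.UNION_disjoint)
    show "\<forall>P\<in>maxs D. \<forall>R\<in>maxs D. P \<noteq> R \<longrightarrow> below D P \<inter> below D R = {}"
    proof (intro ballI impI)
      fix P R assume "P \<in> maxs D" "R \<in> maxs D" "P \<noteq> R"
      then have "P \<inter> R = {}" using disjointD[OF maxs_disjoint[OF assms(1)]] by blast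
      then have "Q = {}" if "Q \<subseteq> P" "Q \<subseteq> R" for Q using that by blast
      then show "below D P \<inter> below D R = {}" using assms(1) empty_notin by auto
    qed
  qed (use fin in auto)
  finally show ?thesis by simp
qed

lemma level_disjoint:
  assumes "D \<subseteq> F" "level_antichain D c"
  shows "disjoint {Q\<in>D. lv (c Q) = k}"
proof (rule antichain_disjoint)
  show "{Q\<in>D. lv (c Q) = k} \<subseteq> F" using assms(1) by blast
  show "\<not> P \<subset> Q" if "P \<in> {Q\<in>D. lv (c Q) = k}" "Q \<in> {Q\<in>D. lv (c Q) = k}" for P Q
    using assms(2) that unfolding level_antichain_def by (metis (mono_tags, lifting) mem_Collect_eq)
qed

lemma ancestors_finite: "finite {P\<in>F. Q \<subseteq> P}"
  using finite_F by simp

lemma lv_le_top_lv: "P \<in> F \<Longrightarrow> Q \<subseteq> P \<Longrightarrow> lv (c P) \<le> top_lv F c Q"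
  unfolding top_lv_def using ancestors_finite by (intro Max_ge) auto

lemma stop_props:
  assumes "Q \<in> F"
  shows stop_in: "stop F c Q \<in> F" and stop_sup: "Q \<subseteq> stop F c Q"
    and lv_stop: "lv (c (stop F c Q)) = top_lv F c Q"
proof -
  define A where "A = {P\<in>F. Q \<subseteq> P \<and> lv (c P) = top_lv F c Q}"
  have "top_lv F c Q \<in> (\<lambda>P. lv (c P)) ` {P\<in>F. Q \<subseteq> P}"
    unfolding top_lv_def using ancestors_finite assms by (intro Max_in) auto
  then have ne: "A \<noteq> {}" by (auto simp: A_def)
  have fin: "finite A" using finite_F by (simp add: A_def)
  obtain M where M: "M \<in> A" "\<And>R. R \<in> A \<Longrightarrow> M \<subseteq> R \<Longrightarrow> M = R"
    using finite_has_maximal[OF fin ne] by metis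
  have "R \<subseteq> M" if "R \<in> A" for R
  proof -
    have "Q \<noteq> {}" using assms empty_notin by blast
    then have "R \<inter> M \<noteq> {}" using that M(1) by (auto simp: A_def)
    then show ?thesis using laminar[of R M] that M by (auto simp: A_def)
  qed
  then have "stop F c Q = M" using M(1) by (auto simp: stop_def A_def)
  then show "stop F c Q \<in> F" "Q \<subseteq> stop F c Q" "lv (c (stop F c Q)) = top_lv F c Q"
    using M(1) by (auto simp: A_def)
qed

lemma le_stop:
  assumes "Q \<in> F" "\<And>P. P \<in> F \<Longrightarrow> 0 < c P"
  shows "c Q \<le> 2 * c (stop F c Q)"
proof -
  have "c Q < 2 * 2 powr lv (c Q)" using assms lv_upper by blast
  also have "\<dots> \<le> 2 * 2 powr lv (c (stop F c Q))"
    using lv_le_top_lv[of Q Q c] assms(1) lv_stop[OF assms(1)] by simp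
  also have "\<dots> \<le> 2 * c (stop F c Q)"
    using lv_lower[of "c (stop F c Q)"] assms stop_in[OF assms(1)] by simp
  finally show ?thesis by simp
qed

text \<open>An ancestor has at most the top level, and one of exactly that level would be contained
  in the union defining \<open>stop\<close>.\<close>

lemma lv_less_stop:
  assumes "Q \<in> F" "R \<in> F" "stop F c Q \<subset> R"
  shows "lv (c R) < lv (c (stop F c Q))"
proof -
  have QR: "Q \<subseteq> R" using assms stop_sup[of Q c] by blast
  have "lv (c R) \<noteq> top_lv F c Q"
  proof
    assume "lv (c R) = top_lv F c Q"
    then have "R \<subseteq> stop F c Q" using assms QR by (auto simp: stop_def)
    then show False using assms(3) by blast
  qed
  then show ?thesis using lv_le_top_lv[OF assms(2) QR, of c] lv_stop[OF assms(1), of c] by simp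
qed

lemma level_antichain_stop: "level_antichain (stop F c ` F) c"
  unfolding level_antichain_def
proof (intro ballI impI)
  fix P Q assume "P \<in> stop F c ` F" "Q \<in> stop F c ` F" "P \<subset> Q"
  then show "lv (c P) \<noteq> lv (c Q)" using lv_less_stop[of _ Q c] stop_in by force
qed

text \<open>Passing from Q to R removes ancestors but keeps \<open>stop F c Q\<close>, so the top
  level survives. Consequently, if the principal set of g is the smaller one, it alone determines
  the principal set of f.\<close>

lemma stop_between:
  assumes "Q \<in> F" "R \<in> F" "Q \<subseteq> R" "R \<subseteq> stop F c Q"
  shows "stop F c R = stop F c Q"
proof -
  have "top_lv F c R \<le> top_lv F c Q"
    unfolding top_lv_def using ancestors_finite assms by (intro Max_mono) auto
  moreover have "top_lv F c Q \<le> top_lv F c R"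
    using lv_le_top_lv[OF stop_in[OF assms(1)] assms(4), of c] lv_stop[OF assms(1)] by simp
  ultimately have t: "top_lv F c R = top_lv F c Q" by simp
  show ?thesis
  proof
    show "stop F c R \<subseteq> stop F c Q" using t assms(3) by (auto simp: stop_def)
    show "stop F c Q \<subseteq> stop F c R"
      unfolding stop_def[of F c R]
      by (intro Union_upper CollectI conjI stop_in assms) (simp add: t lv_stop[OF assms(1)])
  qed
qed

text \<open>Principal sets inside R have levels of c = v / L no lower than that of R. Those on level
  k are disjoint and satisfy L <= 2^(-k) v, so together they have L at most 2^(-k) v(R) <= 2 * 2^(lv
  (c R) - k) * L(R); this is summed over k.\<close>

lemma stop_packing:
  assumes L: "superadditive F L" and v: "superadditive F v" and R: "R \<in> F"
  defines "J \<equiv> stop F (\<lambda>Q. v Q / L Q) ` F"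
  shows "(\<Sum>Q\<in>below J R. L Q) \<le> 2 * geo 1 * L R"
proof -
  define c where "c = (\<lambda>Q. v Q / L Q)"
  have JF: "J \<subseteq> F" using stop_in by (auto simp: J_def)
  have c: "0 < c Q" if "Q \<in> F" for Q
    using that L v by (simp add: c_def superadditive_pos)
  define D where "D = below J R"
  have DF: "D \<subseteq> F" using JF by (auto simp: D_def)
  have LR: "0 < L R" using L R superadditive_pos by blast
  have anti: "level_antichain D c"
    using level_antichain_stop[of c] level_antichain_subset[of J c D]
    by (auto simp: D_def J_def c_def)
  have "sum L D \<le> (2 * L R) * geo 1"
  proof (rule sum_levels_le[where lev = "\<lambda>Q. lv (c Q)" and base = "lv (c R)"])
    show "finite D" using DF finite_F finite_subset by blast
    fix k
    let ?Dk = "{Q\<in>D. lv (c Q) = k}"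
    show "sum L ?Dk \<le> 2 * L R * 2 powr (- 1 * real_of_int \<bar>k - lv (c R)\<bar>)"
    proof (cases "?Dk = {}")
      case False
      then obtain Q where Q: "Q \<in> J" "Q \<subseteq> R" "lv (c Q) = k" by (auto simp: D_def)
      have k: "lv (c R) \<le> k"
      proof (cases "Q = R")
        case False
        then obtain Q' where "Q' \<in> F" "Q = stop F c Q'" using Q(1) by (auto simp: J_def c_def)
        moreover have "Q \<subset> R" using False Q by blast
        ultimately show ?thesis using lv_less_stop[of Q' R c] Q R by simp
      qed (use Q in auto)
      have "sum L ?Dk \<le> (\<Sum>Q\<in>?Dk. v Q * 2 powr (- k))"
      proof (rule sum_mono)
        fix Q assume Q: "Q \<in> ?Dk"
        then have QF: "Q \<in> F" using DF by auto
        have "2 powr k \<le> v Q / L Q" using lv_lower[OF c[OF QF]] Q by (simp add: c_def)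
        then show "L Q \<le> v Q * 2 powr (- k)"
          using superadditive_pos[OF L QF] by (simp add: powr_minus field_simps)
      qed
      also have "\<dots> = sum v ?Dk * 2 powr (- k)" by (simp add: sum_distrib_right)
      also have "\<dots> \<le> v R * 2 powr (- k)"
      proof (intro mult_right_mono superadditiveD[OF v R])
        show "disjoint ?Dk" by (rule level_disjoint[OF DF anti])
      qed (use DF in \<open>auto simp: D_def\<close>)
      also have "v R \<le> 2 * 2 powr lv (c R) * L R"
        using lv_upper[OF c[OF R]] LR by (simp add: c_def field_simps)
      also have "2 * 2 powr lv (c R) * L R * 2 powr (- k) = 2 * L R * 2 powr (- 1 * real_of_int \<bar>k - lv (c R)\<bar>)"
        using k by (simp add: powr_diff powr_minus field_simps)
      finally show ?thesis by (simp add: mult_right_mono)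
    next
      case True
      then show ?thesis unfolding True using LR by simp
    qed
  qed (use LR in auto)
  then show ?thesis by (simp add: D_def mult_ac)
qed

text \<open>Replacing v / L on Q by its value on the principal set costs a factor 2. What remains,
  the sum of L^\<beta> g below a principal set, is geometric: members of comparable size are
  disjoint and L^\<beta> decays with the size since \<beta> > 0. Only the averages of v are stopped;
  g enters through superadditivity alone.\<close>

lemma sparse_domination:
  fixes \<beta> :: real
  assumes L: "superadditive F L" and v: "superadditive F v" and g: "superadditive F g"
    and \<beta>: "0 < \<beta>" and anti: "level_antichain F L"
  shows "(\<Sum>Q\<in>F. L Q powr (\<beta> - 1) * v Q * g Q)
    \<le> 2 * 2 powr \<beta> * geo \<beta> * (\<Sum>Q\<in>stop F (\<lambda>Q. v Q / L Q) ` F. L Q powr (\<beta> - 1) * v Q * g Q)"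
proof -
  define c where "c = (\<lambda>Q. v Q / L Q)"
  note pos = superadditive_pos[OF L] superadditive_pos[OF v] superadditive_pos[OF g]
  have c: "0 < c Q" if "Q \<in> F" for Q using that pos by (simp add: c_def)
  have powL: "L Q powr (\<beta> - 1) * v Q = L Q powr \<beta> * c Q" if "Q \<in> F" for Q
    using pos[OF that] by (simp add: c_def powr_diff)
  have sub: "(\<Sum>Q\<in>below F S. L Q powr \<beta> * g Q) \<le> 2 powr \<beta> * L S powr \<beta> * g S * geo \<beta>" if S: "S \<in> F" for S
  proof (rule sum_levels_le[where lev = "\<lambda>Q. lv (L Q)" and base = "lv (L S)"])
    fix k
    let ?D = "{Q\<in>below F S. lv (L Q) = k}"
    show "(\<Sum>Q\<in>?D. L Q powr \<beta> * g Q) \<le> 2 powr \<beta> * L S powr \<beta> * g S * 2 powr (- \<beta> * \<bar>k - lv (L S)\<bar>)"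
    proof (cases "?D = {}")
      case False
      then obtain Q where Q: "Q \<in> F" "Q \<subseteq> S" "lv (L Q) = k" by auto
      have "L Q \<le> L S" using superadditiveD[OF L S, of "{Q}"] Q by simp
      then have k: "k \<le> lv (L S)" using lv_mono[of "L Q" "L S"] Q pos by simp
      have "(\<Sum>Q\<in>?D. L Q powr \<beta> * g Q) \<le> (\<Sum>Q\<in>?D. (2 * 2 powr k) powr \<beta> * g Q)"
      proof (intro sum_mono mult_right_mono powr_mono2)
        fix P assume P: "P \<in> ?D"
        then show "0 \<le> L P" "0 \<le> g P" using pos[of P] by (simp_all add: less_imp_le)
        show "L P \<le> 2 * 2 powr k" using P lv_upper[of "L P"] pos[of P] by auto
      qed (use \<beta> in simp)
      also have "\<dots> = (2 * 2 powr k) powr \<beta> * sum g ?D" by (simp add: sum_distrib_left)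
      also have "\<dots> \<le> (2 * 2 powr k) powr \<beta> * g S"
        using level_disjoint[OF _ level_antichain_subset[OF anti], of "below F S"] S
        by (intro mult_left_mono superadditiveD[OF g]) auto
      also have "(2 * 2 powr k) powr \<beta> = 2 powr \<beta> * (2 powr lv (L S)) powr \<beta> * 2 powr (- \<beta> * \<bar>k - lv (L S)\<bar>)"
        using k by (simp add: powr_mult powr_powr powr_add[symmetric] algebra_simps)
      also have "\<dots> \<le> 2 powr \<beta> * L S powr \<beta> * 2 powr (- \<beta> * \<bar>k - lv (L S)\<bar>)"
        using lv_lower pos(1)[OF S] \<beta> by (intro mult_right_mono mult_left_mono powr_mono2) auto
      finally show ?thesis using pos(3)[OF S] by (simp add: mult_ac)
    next
      case True
      then show ?thesis unfolding True using pos(3)[OF S] by simp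
    qed
  qed (use finite_F \<beta> pos(3)[OF S] in auto)
  have "(\<Sum>Q\<in>F. L Q powr (\<beta> - 1) * v Q * g Q) \<le> (\<Sum>Q\<in>F. 2 * c (stop F c Q) * (L Q powr \<beta> * g Q))"
  proof (rule sum_mono)
    fix Q assume Q: "Q \<in> F"
    have "L Q powr \<beta> * g Q * c Q \<le> L Q powr \<beta> * g Q * (2 * c (stop F c Q))"
      using le_stop[OF Q c] pos[OF Q] by (intro mult_left_mono) auto
    then show "L Q powr (\<beta> - 1) * v Q * g Q \<le> 2 * c (stop F c Q) * (L Q powr \<beta> * g Q)"
      using powL[OF Q] by (simp add: mult_ac)
  qed
  also have "\<dots> = (\<Sum>S\<in>stop F c ` F. \<Sum>Q\<in>{Q\<in>F. stop F c Q = S}. 2 * c (stop F c Q) * (L Q powr \<beta> * g Q))"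
    using finite_F by (rule sum.image_gen)
  also have "\<dots> = (\<Sum>S\<in>stop F c ` F. 2 * c S * (\<Sum>Q\<in>{Q\<in>F. stop F c Q = S}. L Q powr \<beta> * g Q))"
    by (intro sum.cong refl) (simp add: sum_distrib_left)
  also have "\<dots> \<le> (\<Sum>S\<in>stop F c ` F. 2 * c S * (2 powr \<beta> * L S powr \<beta> * g S * geo \<beta>))"
  proof (intro sum_mono mult_left_mono)
    fix S assume "S \<in> stop F c ` F"
    then have S: "S \<in> F" using stop_in by auto
    have "(\<Sum>Q\<in>{Q\<in>F. stop F c Q = S}. L Q powr \<beta> * g Q) \<le> (\<Sum>Q\<in>below F S. L Q powr \<beta> * g Q)"
      using finite_F pos(3) stop_sup by (intro sum_mono2) (auto simp: less_imp_le)
    also note sub[OF S]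
    finally show "(\<Sum>Q\<in>{Q\<in>F. stop F c Q = S}. L Q powr \<beta> * g Q) \<le> 2 powr \<beta> * L S powr \<beta> * g S * geo \<beta>" .
    show "0 \<le> 2 * c S" using c[OF S] by simp
  qed
  also have "\<dots> = 2 * 2 powr \<beta> * geo \<beta> * (\<Sum>S\<in>stop F c ` F. L S powr (\<beta> - 1) * v S * g S)"
    unfolding sum_distrib_left using powL stop_in by (intro sum.cong refl) (auto simp: mult_ac)
  finally show ?thesis by (simp add: c_def)
qed

end

section \<open>The positive bilinear form of a laminar family\<close>

lemma conj_exp_facts:
  assumes "1 < p"
  shows conj_exp_gt_1: "1 < conj_exp p" and conj_exp_sum: "1 / p + 1 / conj_exp p = 1"
    and conj_exp_conj: "conj_exp (conj_exp p) = p" and div_conj_exp: "q / conj_exp p = q - q / p"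
  using assms by (auto simp: conj_exp_def field_simps)

lemma conj_exp_antimono: "1 < p \<Longrightarrow> p \<le> q \<Longrightarrow> conj_exp q \<le> conj_exp p"
  by (simp add: conj_exp_def field_simps)

context laminar_family
begin

lemma superadditive_mono:
  assumes "superadditive F \<mu>" "Q \<in> F" "R \<in> F" "Q \<subseteq> R"
  shows "\<mu> Q \<le> \<mu> R"
  using superadditiveD[OF assms(1,3), of "{Q}"] assms by simp

lemma sum_maxs_le:
  assumes "superadditive F \<mu>" "R \<in> F" "D \<subseteq> F" "\<Union>D \<subseteq> R"
  shows "sum \<mu> (maxs D) \<le> \<mu> R"
  using assms by (intro superadditiveD maxs_disjoint) (auto simp: maxs_def)

text \<open>Packing is assumed below single members only; splitting over maximal members extends it
  to arbitrary subfamilies.\<close>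

lemma packing_maxs:
  assumes L: "superadditive F L" and pack: "\<And>R. R \<in> F \<Longrightarrow> (\<Sum>Q\<in>below F R. L Q) \<le> \<Lambda> * L R"
    and D: "D \<subseteq> F"
  shows "sum L D \<le> \<Lambda> * sum L (maxs D)"
proof -
  note pos = superadditive_pos[OF L, THEN less_imp_le]
  have "sum L D \<le> (\<Sum>P\<in>maxs D. \<Sum>Q\<in>below D P. L Q)"
    using D pos by (intro sum_le_sum_maxs) auto
  also have "\<dots> \<le> (\<Sum>P\<in>maxs D. \<Lambda> * L P)"
  proof (rule sum_mono)
    fix P assume "P \<in> maxs D"
    then have P: "P \<in> F" using D by (auto simp: maxs_def)
    have "(\<Sum>Q\<in>below D P. L Q) \<le> (\<Sum>Q\<in>below F P. L Q)"
      using D finite_F pos by (intro sum_mono2) auto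
    also note pack[OF P]
    finally show "(\<Sum>Q\<in>below D P. L Q) \<le> \<Lambda> * L P" .
  qed
  finally show ?thesis by (simp add: sum_distrib_left)
qed

text \<open>If \<open>s\<^bsup>\<gamma>\<^esup> w / L\<close> is essentially constant, then the level sets of \<open>s\<close> inside \<open>R\<close> shrink geometrically: upwards because
  \<open>\<sigma>\<close> has weak type, downwards because \<open>w / L\<close> has.\<close>

lemma local_carleson:
  fixes \<beta> \<gamma> B \<Lambda> :: real
  assumes L: "superadditive F L" and \<sigma>: "superadditive F \<sigma>" and w: "superadditive F w"
    and pack: "\<And>R. R \<in> F \<Longrightarrow> (\<Sum>Q\<in>below F R. L Q) \<le> \<Lambda> * L R"
    and \<Lambda>: "0 \<le> \<Lambda>" and \<beta>: "0 < \<beta>" and \<gamma>: "0 < \<gamma>" and B: "0 < B"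
    and s_def: "\<And>Q. s Q = L Q powr (\<beta> - 1) * \<sigma> Q"
    and lower: "\<And>Q. Q \<in> F \<Longrightarrow> B / 2 \<le> s Q powr \<gamma> * (w Q / L Q)"
    and upper: "\<And>Q. Q \<in> F \<Longrightarrow> s Q powr \<gamma> * (w Q / L Q) \<le> B"
    and R: "R \<in> F"
  shows "(\<Sum>Q\<in>below F R. s Q * w Q) \<le> 4 * 2 powr \<gamma> * \<Lambda> * (s R * w R) * geo (min 1 \<gamma>)"
proof (rule sum_levels_le[where lev = "\<lambda>Q. lv (s Q / s R)" and base = 0])
  let ?X = "4 * 2 powr \<gamma> * \<Lambda> * (s R * w R)"
  note pos = superadditive_pos[OF L] superadditive_pos[OF \<sigma>] superadditive_pos[OF w]
  have s: "0 < s Q" if "Q \<in> F" for Q using pos[OF that] by (simp add: s_def)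
  note sR = s[OF R] and posR = pos[OF R]
  show "finite (below F R)" using finite_F by simp
  show "0 < min 1 \<gamma>" using \<gamma> by simp
  show nn: "0 \<le> ?X" using \<Lambda> sR posR by simp
  fix k :: int
  define D where "D = {Q\<in>below F R. lv (s Q / s R) = k}"
  have DF: "D \<subseteq> F" and DR: "\<Union>D \<subseteq> R" by (auto simp: D_def)
  have slo: "2 powr k * s R \<le> s Q" and shi: "s Q \<le> 2 * 2 powr k * s R" if "Q \<in> D" for Q
    using that lv_lower[of "s Q / s R"] lv_upper[of "s Q / s R"] s[of Q] sR
    by (auto simp: D_def field_simps)
  define t where "t = 2 powr k * s R"
  have t: "0 < t" using sR by (simp add: t_def)
  \<comment> \<open>On this slice s is comparable to t, and \<open>upper\<close> bounds w by B
    t^(-\<gamma>) L. The sum becomes a sum of L, to which packing applies.\<close>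
  have sw: "s Q * w Q \<le> 2 * t * B * t powr (- \<gamma>) * L Q" if Q: "Q \<in> D" for Q
  proof -
    have QF: "Q \<in> F" using Q DF by auto
    have "t powr \<gamma> \<le> s Q powr \<gamma>" using slo[OF Q] t \<gamma> by (intro powr_mono2) (auto simp: t_def)
    then have "t powr \<gamma> * (w Q / L Q) \<le> s Q powr \<gamma> * (w Q / L Q)"
      using pos[OF QF] by (intro mult_right_mono) auto
    also note upper[OF QF]
    finally have "w Q \<le> B * t powr (- \<gamma>) * L Q"
      using pos[OF QF] t by (simp add: powr_minus field_simps)
    then have "s Q * w Q \<le> (2 * t) * (B * t powr (- \<gamma>) * L Q)"
      using shi[OF Q] s[OF QF] pos[OF QF] B t by (intro mult_mono) (auto simp: t_def)
    then show ?thesis by (simp add: mult_ac)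
  qed
  have B_le: "B \<le> 2 * s R powr \<gamma> * (w R / L R)" using lower[OF R] by (simp add: mult_ac)
  have "(\<Sum>Q\<in>D. s Q * w Q) \<le> (\<Sum>Q\<in>D. 2 * t * B * t powr (- \<gamma>) * L Q)"
    by (intro sum_mono sw)
  also have "\<dots> = 2 * t * B * t powr (- \<gamma>) * sum L D" by (simp add: sum_distrib_left)
  also have "\<dots> \<le> 2 * t * B * t powr (- \<gamma>) * (\<Lambda> * sum L (maxs D))"
    using packing_maxs[OF L pack DF] t B by (intro mult_left_mono) auto
  also have "\<dots> \<le> ?X * 2 powr (- min 1 \<gamma> * \<bar>k\<bar>)"
  proof (cases "0 \<le> k")
    case True
    \<comment> \<open>Large s: from L s = L^\<beta> \<sigma> the maximal cubes of the slice satisfy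
      t * sum L <= L(R) s(R). This absorbs the factor t and leaves t^(-\<gamma>), that is, decay
      2^(-\<gamma> k).\<close>
    have Lw: "L Q * t \<le> L R powr \<beta> * \<sigma> Q" if "Q \<in> maxs D" for Q
    proof -
      have Q: "Q \<in> D" "Q \<in> F" "Q \<subseteq> R" using that by (auto simp: maxs_def D_def)
      have "L Q * t \<le> L Q * s Q" using slo[OF Q(1)] pos[OF Q(2)] by (simp add: t_def)
      also have "\<dots> = L Q powr \<beta> * \<sigma> Q" using pos[OF Q(2)] by (simp add: s_def powr_diff)
      also have "\<dots> \<le> L R powr \<beta> * \<sigma> Q"
        using pos[OF Q(2)] superadditive_mono[OF L Q(2) R Q(3)] \<beta>
        by (intro mult_right_mono powr_mono2) auto
      finally show ?thesis .
    qed
    have "sum L (maxs D) * t = (\<Sum>Q\<in>maxs D. L Q * t)" by (simp add: sum_distrib_right)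
    also have "\<dots> \<le> (\<Sum>Q\<in>maxs D. L R powr \<beta> * \<sigma> Q)" by (intro sum_mono Lw)
    also have "\<dots> = L R powr \<beta> * sum \<sigma> (maxs D)" by (simp add: sum_distrib_left)
    also have "\<dots> \<le> L R powr \<beta> * \<sigma> R"
      using sum_maxs_le[OF \<sigma> R DF DR] by (intro mult_left_mono) auto
    also have "\<dots> = L R * s R" using posR by (simp add: s_def powr_diff)
    finally have LD: "t * sum L (maxs D) \<le> L R * s R" by (simp add: mult.commute)
    have "2 * t * B * t powr (- \<gamma>) * (\<Lambda> * sum L (maxs D))
      = 2 * \<Lambda> * B * t powr (- \<gamma>) * (t * sum L (maxs D))" by simp
    also have "\<dots> \<le> 2 * \<Lambda> * B * t powr (- \<gamma>) * (L R * s R)"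
      using LD \<Lambda> B by (intro mult_left_mono) auto
    also have "\<dots> \<le> 2 * \<Lambda> * (2 * s R powr \<gamma> * (w R / L R)) * t powr (- \<gamma>) * (L R * s R)"
      using B_le \<Lambda> posR sR by (intro mult_right_mono mult_left_mono) auto
    also have "\<dots> = 4 * \<Lambda> * (s R * w R) * 2 powr (- \<gamma> * k)"
      using posR sR by (simp add: t_def powr_mult powr_minus powr_powr field_simps)
    also have "\<dots> \<le> ?X * 2 powr (- min 1 \<gamma> * \<bar>k\<bar>)"
    proof (rule mult_mono)
      show "4 * \<Lambda> * (s R * w R) \<le> ?X"
        using \<Lambda> sR posR \<gamma> ge_one_powr_ge_zero[of 2 \<gamma>] by (intro mult_right_mono) auto
      have "min 1 \<gamma> * k \<le> \<gamma> * k" using True by (intro mult_right_mono) auto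
      then show "2 powr (- \<gamma> * k) \<le> 2 powr (- min 1 \<gamma> * \<bar>k\<bar>)" using True by simp
    qed (use nn in auto)
    finally show ?thesis .
  next
    case False
    \<comment> \<open>Small s: now \<open>lower\<close> bounds B L by a multiple of t^\<gamma> w,
      which sums to w(R). The powers t^\<gamma> and t^(-\<gamma>) cancel and the remaining factor t
      decays like 2^k. The worse of the two rates is min 1 \<gamma>.\<close>
    have Lw: "B * L Q \<le> 2 * (2 * t) powr \<gamma> * w Q" if "Q \<in> maxs D" for Q
    proof -
      have Q: "Q \<in> D" "Q \<in> F" using that by (auto simp: maxs_def D_def)
      have "B / 2 \<le> s Q powr \<gamma> * (w Q / L Q)" by (rule lower[OF Q(2)])
      also have "\<dots> \<le> (2 * t) powr \<gamma> * (w Q / L Q)"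
        using shi[OF Q(1)] s[OF Q(2)] \<gamma> pos[OF Q(2)]
        by (intro mult_right_mono powr_mono2) (auto simp: t_def)
      finally show ?thesis using pos[OF Q(2)] by (simp add: field_simps)
    qed
    have "B * sum L (maxs D) = (\<Sum>Q\<in>maxs D. B * L Q)" by (simp add: sum_distrib_left)
    also have "\<dots> \<le> (\<Sum>Q\<in>maxs D. 2 * (2 * t) powr \<gamma> * w Q)" by (intro sum_mono Lw)
    also have "\<dots> = 2 * (2 * t) powr \<gamma> * sum w (maxs D)" by (simp add: sum_distrib_left)
    also have "\<dots> \<le> 2 * (2 * t) powr \<gamma> * w R"
      using sum_maxs_le[OF w R DF DR] by (intro mult_left_mono) auto
    finally have LD: "B * sum L (maxs D) \<le> 2 * (2 * t) powr \<gamma> * w R" .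
    have "2 * t * B * t powr (- \<gamma>) * (\<Lambda> * sum L (maxs D))
      = 2 * t * t powr (- \<gamma>) * \<Lambda> * (B * sum L (maxs D))" by simp
    also have "\<dots> \<le> 2 * t * t powr (- \<gamma>) * \<Lambda> * (2 * (2 * t) powr \<gamma> * w R)"
      using LD \<Lambda> t by (intro mult_left_mono) auto
    also have "\<dots> = ?X * 2 powr k"
      using t by (simp add: powr_mult powr_minus field_simps) (simp add: t_def)
    also have "\<dots> \<le> ?X * 2 powr (- min 1 \<gamma> * \<bar>k\<bar>)"
    proof (intro mult_left_mono nn)
      have "min 1 \<gamma> * \<bar>k\<bar> \<le> 1 * real_of_int \<bar>k\<bar>" by (intro mult_right_mono) auto
      then show "2 powr k \<le> 2 powr (- min 1 \<gamma> * \<bar>k\<bar>)" using False by simp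
    qed
    finally show ?thesis .
  qed
  finally show "(\<Sum>Q\<in>{Q\<in>below F R. lv (s Q / s R) = k}. s Q * w Q)
    \<le> ?X * 2 powr (- min 1 \<gamma> * \<bar>k - 0\<bar>)"
    by (simp add: D_def)
qed

text \<open>With r = q/p and \<gamma> = q/p' one has s^q w = (s^\<gamma> w / L) (s^r L), and the
  first factor is at most B. The hypothesis \<open>loc\<close> is available only at members of D,
  and P need not be one; hence the passage to the maximal members below P, whose \<sigma>^r are
  added by the l^1-l^r embedding.\<close>

lemma global_carleson:
  assumes L: "superadditive F L" and \<sigma>: "superadditive F \<sigma>" and w: "superadditive F w"
    and D: "D \<subseteq> F" and P: "P \<in> F" and r: "1 \<le> r" and q: "q = \<gamma> + r" and X: "0 \<le> X" and B: "0 \<le> B"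
    and s: "\<And>Q. Q \<in> F \<Longrightarrow> 0 < s Q"
    and loc: "\<And>R. R \<in> D \<Longrightarrow> (\<Sum>Q\<in>below F R. s Q powr r * L Q) \<le> X * \<sigma> R powr r"
    and upper: "\<And>Q. Q \<in> D \<Longrightarrow> s Q powr \<gamma> * (w Q / L Q) \<le> B"
  shows "(\<Sum>Q\<in>below D P. s Q powr q * w Q) \<le> B * X * \<sigma> P powr r"
proof -
  note pos = superadditive_pos[OF L] superadditive_pos[OF \<sigma>] superadditive_pos[OF w]
  define E where "E = below D P"
  have EF: "E \<subseteq> F" "\<Union>E \<subseteq> P" using D by (auto simp: E_def)
  have ME: "maxs E \<subseteq> D" by (auto simp: maxs_def E_def)
  have "finite (maxs E)" by (rule finite_subset[OF subset_trans[OF ME D] finite_F])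
  note ME = ME this
  have "(\<Sum>Q\<in>E. s Q powr q * w Q) \<le> (\<Sum>Q\<in>E. B * (s Q powr r * L Q))"
  proof (rule sum_mono)
    fix Q assume "Q \<in> E"
    then have Q: "Q \<in> D" "Q \<in> F" using D by (auto simp: E_def)
    have "s Q powr q * w Q = (s Q powr \<gamma> * (w Q / L Q)) * (s Q powr r * L Q)"
      using pos[OF Q(2)] by (simp add: q powr_add)
    also have "\<dots> \<le> B * (s Q powr r * L Q)"
      using upper[OF Q(1)] pos[OF Q(2)] by (intro mult_right_mono) auto
    finally show "s Q powr q * w Q \<le> B * (s Q powr r * L Q)" .
  qed
  also have "\<dots> = B * (\<Sum>Q\<in>E. s Q powr r * L Q)" by (simp add: sum_distrib_left)
  also have "(\<Sum>Q\<in>E. s Q powr r * L Q) \<le> (\<Sum>R\<in>maxs E. \<Sum>Q\<in>below E R. s Q powr r * L Q)"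
    using EF pos by (intro sum_le_sum_maxs) (auto simp: less_imp_le subset_iff)
  also have "\<dots> \<le> (\<Sum>R\<in>maxs E. X * \<sigma> R powr r)"
  proof (rule sum_mono)
    fix R assume "R \<in> maxs E"
    then have R: "R \<in> D" using ME by auto
    have "(\<Sum>Q\<in>below E R. s Q powr r * L Q) \<le> (\<Sum>Q\<in>below F R. s Q powr r * L Q)"
      using EF finite_F pos by (intro sum_mono2) (auto simp: less_imp_le)
    also note loc[OF R]
    finally show "(\<Sum>Q\<in>below E R. s Q powr r * L Q) \<le> X * \<sigma> R powr r" .
  qed
  also have "\<dots> = X * (\<Sum>R\<in>maxs E. \<sigma> R powr r)" by (simp add: sum_distrib_left)
  also have "(\<Sum>R\<in>maxs E. \<sigma> R powr r) \<le> (sum \<sigma> (maxs E)) powr r"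
    using ME D pos(2) r by (intro sum_powr_le_powr_sum) (auto simp: less_imp_le subset_iff)
  also have "\<dots> \<le> \<sigma> P powr r"
    using ME D pos(2) r sum_maxs_le[OF \<sigma> P EF]
    by (intro powr_mono2 sum_nonneg) (auto simp: less_imp_le subset_iff)
  finally show ?thesis using B X by (simp add: E_def mult_left_mono mult.assoc)
qed

text \<open>Three Hoelder steps. Among the cubes with g-principal set G, \<open>loc\<close> leaves
  the disjoint maximal ones, and exponents (q, q') give z(G)^(1/q) w(G)^(1/q'). Over all G with the
  same f-principal set P, exponents (q', q) bring in \<open>glob\<close>. Over all P, exponents (p,
  p') separate f from g.\<close>

lemma class_bound:
  fixes p q T C \<Phi> \<Gamma> :: real
  assumes pq: "1 < p" "p \<le> q"
    and \<sigma>: "superadditive F \<sigma>" and w: "superadditive F w" and D: "D \<subseteq> F"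
    and nested: "\<And>Q. Q \<in> D \<Longrightarrow> stop F cg Q \<subseteq> stop F cf Q"
    and cf: "\<And>Q. Q \<in> F \<Longrightarrow> 0 < cf Q" and cg: "\<And>Q. Q \<in> F \<Longrightarrow> 0 < cg Q" and s: "\<And>Q. Q \<in> F \<Longrightarrow> 0 < s Q"
    and C: "0 \<le> C" and T: "0 \<le> T"
    and loc: "\<And>R. R \<in> D \<Longrightarrow> (\<Sum>Q\<in>below D R. s Q * w Q) \<le> C * (s R * w R)"
    and glob: "\<And>P. P \<in> F \<Longrightarrow> (\<Sum>Q\<in>below D P. s Q powr q * w Q) \<le> T * \<sigma> P powr (q / p)"
    and emb_f: "(\<Sum>J\<in>stop F cf ` F. cf J powr p * \<sigma> J) \<le> \<Phi>"
    and emb_g: "(\<Sum>J\<in>stop F cg ` F. cg J powr conj_exp q * w J) \<le> \<Gamma>"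
  shows "(\<Sum>Q\<in>D. s Q * w Q * cf Q * cg Q)
    \<le> 4 * C * T powr (1 / q) * \<Phi> powr (1 / p) * \<Gamma> powr (1 / conj_exp q)"
proof -
  define q' where "q' = conj_exp q"
  define p' where "p' = conj_exp p"
  have q: "1 < q" using pq by simp
  have q': "1 < q'" "1 / q + 1 / q' = 1" "1 / q' + 1 / q = 1"
    using conj_exp_gt_1[OF q] conj_exp_sum[OF q] by (simp_all add: q'_def)
  have p': "1 < p'" "1 / p + 1 / p' = 1" "q' \<le> p'"
    using conj_exp_gt_1[OF pq(1)] conj_exp_sum[OF pq(1)] conj_exp_antimono[OF pq]
    by (simp_all add: q'_def p'_def)
  note pos = superadditive_pos[OF \<sigma>] superadditive_pos[OF w] cf cg s
  define \<G> where "\<G> = stop F cg ` F"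
  define \<tau> where "\<tau> = stop F cf"
  define Dc where "Dc = (\<lambda>G. {Q\<in>D. stop F cg Q = G})"
  define z where "z = (\<lambda>G. \<Sum>Q\<in>Dc G. s Q powr q * w Q)"
  let ?t = "\<lambda>Q. s Q * w Q * cf Q * cg Q"
  let ?u = "\<lambda>G. cf (\<tau> G) * (cg G * w G powr (1 / q') * z G powr (1 / q))"
  let ?v = "\<lambda>G. (cg G * w G powr (1 / q')) * z G powr (1 / q)"
  have finD: "finite D" using D finite_F by (rule finite_subset)
  have fing: "finite \<G>" using finite_F by (simp add: \<G>_def)
  have GF: "\<G> \<subseteq> F" using stop_in by (auto simp: \<G>_def)
  have DcF: "Dc G \<subseteq> F" "Dc G \<subseteq> D" "finite (Dc G)" for G using D finD by (auto simp: Dc_def)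
  have z0: "0 \<le> z G" for G
    using pos DcF(1)[of G] unfolding z_def by (intro sum_nonneg mult_nonneg_nonneg) (auto simp: less_imp_le subset_iff)
  have tauF: "\<tau> G \<in> F" "G \<subseteq> \<tau> G" if "G \<in> \<G>" for G
    unfolding \<tau>_def using that GF by (blast intro: stop_in, intro stop_sup) blast

  have inner: "(\<Sum>Q\<in>Dc G. s Q * w Q) \<le> C * (z G powr (1 / q) * w G powr (1 / q'))" if G: "G \<in> \<G>" for G
  proof -
    define M where "M = maxs (Dc G)"
    have MD: "M \<subseteq> Dc G" "M \<subseteq> F" "finite M"
      using DcF[of G] by (auto simp: M_def maxs_def intro: finite_subset[OF _ DcF(3)[of G]])
    have posM: "0 < w Q" "0 < s Q" if "Q \<in> M" for Q using that MD pos by auto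
    have "(\<Sum>Q\<in>Dc G. s Q * w Q) \<le> (\<Sum>P\<in>M. \<Sum>Q\<in>below (Dc G) P. s Q * w Q)"
      unfolding M_def using DcF pos by (intro sum_le_sum_maxs) (auto simp: less_imp_le subset_iff)
    also have "\<dots> \<le> (\<Sum>P\<in>M. C * (s P * w P))"
    proof (rule sum_mono)
      fix P assume P: "P \<in> M"
      have "(\<Sum>Q\<in>below (Dc G) P. s Q * w Q) \<le> (\<Sum>Q\<in>below D P. s Q * w Q)"
        using DcF finD D pos by (intro sum_mono2) (auto simp: less_imp_le subset_iff)
      also have "\<dots> \<le> C * (s P * w P)" using P MD(1) DcF(2)[of G] by (intro loc) blast
      finally show "(\<Sum>Q\<in>below (Dc G) P. s Q * w Q) \<le> C * (s P * w P)" .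
    qed
    also have "\<dots> = C * (\<Sum>P\<in>M. (s P * w P powr (1 / q)) * w P powr (1 / q'))"
      unfolding sum_distrib_left
    proof (intro sum.cong refl)
      fix P assume "P \<in> M"
      then show "C * (s P * w P) = C * (s P * w P powr (1 / q) * w P powr (1 / q'))"
        using posM[of P] q'(2) by (simp add: powr_add[symmetric])
    qed
    also have "\<dots> \<le> C * ((\<Sum>P\<in>M. (s P * w P powr (1 / q)) powr q) powr (1 / q)
        * (\<Sum>P\<in>M. (w P powr (1 / q')) powr q') powr (1 / q'))"
      using q q' C MD posM by (intro mult_left_mono Holder_sum) (auto simp: less_imp_le)
    also have "(\<Sum>P\<in>M. (s P * w P powr (1 / q)) powr q) = (\<Sum>P\<in>M. s P powr q * w P)"
      using posM q by (intro sum.cong refl) (simp add: powr_mult powr_powr less_imp_le)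
    also have "(\<Sum>P\<in>M. (w P powr (1 / q')) powr q') = sum w M"
      using posM q' by (intro sum.cong refl) (simp add: powr_powr less_imp_le)
    also have "C * ((\<Sum>P\<in>M. s P powr q * w P) powr (1 / q) * sum w M powr (1 / q'))
        \<le> C * (z G powr (1 / q) * w G powr (1 / q'))"
    proof (intro mult_left_mono mult_mono powr_mono2 C)
      show "(\<Sum>P\<in>M. s P powr q * w P) \<le> z G"
        unfolding z_def using MD DcF[of G] pos by (intro sum_mono2) (auto simp: less_imp_le subset_iff)
      have "\<Union>(Dc G) \<subseteq> G" using stop_sup D by (auto simp: Dc_def)
      then show "sum w M \<le> w G"
        unfolding M_def using G GF DcF by (intro sum_maxs_le[OF w]) auto
    qed (use q q' posM in \<open>auto intro!: sum_nonneg simp: less_imp_le\<close>)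
    finally show ?thesis .
  qed

  have "(\<Sum>Q\<in>D. s Q * w Q * cf Q * cg Q) = (\<Sum>G\<in>stop F cg ` D. sum ?t (Dc G))"
    unfolding Dc_def by (rule sum.image_gen[OF finD])
  also have "\<dots> \<le> (\<Sum>G\<in>\<G>. sum ?t (Dc G))"
    using fing D DcF pos unfolding \<G>_def
    by (intro sum_mono2 sum_nonneg mult_nonneg_nonneg) (auto simp: less_imp_le subset_iff)
  also have "\<dots> \<le> (\<Sum>G\<in>\<G>. 4 * C * ?u G)"
  proof (rule sum_mono)
    fix G assume G: "G \<in> \<G>"
    have "sum ?t (Dc G) \<le> (\<Sum>Q\<in>Dc G. 4 * (cf (\<tau> G) * cg G) * (s Q * w Q))"
    proof (rule sum_mono)
      fix Q assume Q: "Q \<in> Dc G"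
      then have QD: "Q \<in> D" "Q \<in> F" "stop F cg Q = G" using D by (auto simp: Dc_def)
      \<comment> \<open>The nesting hypothesis enters here: G lies between Q and the f-principal set
        of Q, so \<open>stop_between\<close> applies.\<close>
      have "\<tau> G = \<tau> Q"
        unfolding \<tau>_def using QD G GF nested[OF QD(1)] stop_sup[OF QD(2), of cg]
        by (intro stop_between) auto
      then have "cf Q \<le> 2 * cf (\<tau> G)" using le_stop[OF QD(2), of cf] cf by (simp add: \<tau>_def)
      moreover have "cg Q \<le> 2 * cg G" using le_stop[OF QD(2), of cg] cg QD by simp
      \<comment> \<open>A factor 2 for each of the two stopping constructions: the origin of the 4
        in the conclusion.\<close>
      ultimately have "cf Q * cg Q \<le> (2 * cf (\<tau> G)) * (2 * cg G)"
        using pos[OF QD(2)] pos[OF tauF(1)[OF G]] by (intro mult_mono) auto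
      then have "(s Q * w Q) * (cf Q * cg Q) \<le> (s Q * w Q) * ((2 * cf (\<tau> G)) * (2 * cg G))"
        using pos[OF QD(2)] by (intro mult_left_mono) auto
      then show "s Q * w Q * cf Q * cg Q \<le> 4 * (cf (\<tau> G) * cg G) * (s Q * w Q)"
        by (simp add: mult_ac)
    qed
    also have "\<dots> = 4 * (cf (\<tau> G) * cg G) * (\<Sum>Q\<in>Dc G. s Q * w Q)" by (simp add: sum_distrib_left)
    also have "\<dots> \<le> 4 * (cf (\<tau> G) * cg G) * (C * (z G powr (1 / q) * w G powr (1 / q')))"
      using inner[OF G] pos(3)[OF tauF(1)[OF G]] pos(4)[of G] G GF by (intro mult_left_mono) auto
    finally show "sum ?t (Dc G)
      \<le> 4 * C * ?u G"
      by (simp add: mult_ac)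
  qed
  also have "\<dots> = 4 * C * (\<Sum>G\<in>\<G>. ?u G)"
    by (simp add: sum_distrib_left)
  also have "\<dots> \<le> 4 * C * (T powr (1 / q) * (\<Phi> powr (1 / p) * \<Gamma> powr (1 / q')))"
  proof (rule mult_left_mono)
    define \<Gamma>P where "\<Gamma>P = (\<lambda>P. \<Sum>G\<in>{G\<in>\<G>. \<tau> G = P}. cg G powr q' * w G)"
    have \<Gamma>P0: "0 \<le> \<Gamma>P P" for P
      unfolding \<Gamma>P_def using GF pos by (intro sum_nonneg) (auto simp: less_imp_le subset_iff)
    have tF: "P \<in> F" if "P \<in> \<tau> ` \<G>" for P using that tauF by auto
    have "(\<Sum>G\<in>\<G>. ?u G)
      = (\<Sum>P\<in>\<tau> ` \<G>. \<Sum>G\<in>{G\<in>\<G>. \<tau> G = P}. ?u G)"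
      by (rule sum.image_gen[OF fing])
    also have "\<dots> = (\<Sum>P\<in>\<tau> ` \<G>. cf P * (\<Sum>G\<in>{G\<in>\<G>. \<tau> G = P}. ?v G))"
      by (intro sum.cong refl) (simp add: sum_distrib_left)
    also have "\<dots> \<le> (\<Sum>P\<in>\<tau> ` \<G>. cf P * (\<Gamma>P P powr (1 / q') * (T powr (1 / q) * \<sigma> P powr (1 / p))))"
    proof (intro sum_mono mult_left_mono)
      fix P assume P: "P \<in> \<tau> ` \<G>"
      have PF: "P \<in> F" by (rule tF[OF P])
      let ?A = "{G\<in>\<G>. \<tau> G = P}"
      have posA: "0 < w G" "0 < cg G" if "G \<in> ?A" for G using that GF pos by auto
      have "sum z ?A = (\<Sum>Q\<in>(\<Union>G\<in>?A. Dc G). s Q powr q * w Q)"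
        unfolding z_def using fing DcF by (intro sum.UNION_disjoint[symmetric]) (auto simp: Dc_def)
      also have "\<dots> \<le> (\<Sum>Q\<in>below D P. s Q powr q * w Q)"
      proof (rule sum_mono2)
        show "(\<Union>G\<in>?A. Dc G) \<subseteq> below D P"
        proof
          fix Q assume "Q \<in> (\<Union>G\<in>?A. Dc G)"
          then obtain G where G: "G \<in> \<G>" "\<tau> G = P" "Q \<in> D" "stop F cg Q = G" by (auto simp: Dc_def)
          then have "Q \<subseteq> G" using stop_sup[of Q cg] D by auto
          then show "Q \<in> below D P" using tauF(2)[OF G(1)] G by auto
        qed
      qed (use finD D pos in \<open>auto simp: less_imp_le subset_iff\<close>)
      also have "\<dots> \<le> T * \<sigma> P powr (q / p)" by (rule glob[OF PF])
      finally have zle: "sum z ?A \<le> T * \<sigma> P powr (q / p)" .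
      have "(\<Sum>G\<in>?A. ?v G)
        \<le> (\<Sum>G\<in>?A. (cg G * w G powr (1 / q')) powr q') powr (1 / q') * (\<Sum>G\<in>?A. (z G powr (1 / q)) powr q) powr (1 / q)"
        using q q' fing posA by (intro Holder_sum) (auto simp: less_imp_le)
      also have "(\<Sum>G\<in>?A. (cg G * w G powr (1 / q')) powr q') = \<Gamma>P P"
        unfolding \<Gamma>P_def using posA q' by (intro sum.cong refl) (auto simp: powr_mult powr_powr less_imp_le)
      also have "(\<Sum>G\<in>?A. (z G powr (1 / q)) powr q) = sum z ?A"
        using q z0 by (intro sum.cong refl) (simp add: powr_powr)
      also have "\<Gamma>P P powr (1 / q') * sum z ?A powr (1 / q) \<le> \<Gamma>P P powr (1 / q') * (T * \<sigma> P powr (q / p)) powr (1 / q)"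
        using q z0 zle by (intro mult_left_mono powr_mono2 sum_nonneg) auto
      also have "(T * \<sigma> P powr (q / p)) powr (1 / q) = T powr (1 / q) * \<sigma> P powr (1 / p)"
        using T q pq by (simp add: powr_mult powr_powr)
      finally show "(\<Sum>G\<in>?A. ?v G)
        \<le> \<Gamma>P P powr (1 / q') * (T powr (1 / q) * \<sigma> P powr (1 / p))" .
      show "0 \<le> cf P" using pos(3)[OF PF] by simp
    qed
    also have "\<dots> = T powr (1 / q) * (\<Sum>P\<in>\<tau> ` \<G>. (cf P * \<sigma> P powr (1 / p)) * \<Gamma>P P powr (1 / q'))"
      by (simp add: sum_distrib_left mult_ac)
    also have "\<dots> \<le> T powr (1 / q) * ((\<Sum>P\<in>\<tau> ` \<G>. (cf P * \<sigma> P powr (1 / p)) powr p) powr (1 / p)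
        * (\<Sum>P\<in>\<tau> ` \<G>. (\<Gamma>P P powr (1 / q')) powr p') powr (1 / p'))"
      using pq p' fing tF pos by (intro mult_left_mono Holder_sum) (auto simp: less_imp_le)
    also have "(\<Sum>P\<in>\<tau> ` \<G>. (cf P * \<sigma> P powr (1 / p)) powr p) = (\<Sum>P\<in>\<tau> ` \<G>. cf P powr p * \<sigma> P)"
    proof (intro sum.cong refl)
      fix P assume "P \<in> \<tau> ` \<G>"
      then show "(cf P * \<sigma> P powr (1 / p)) powr p = cf P powr p * \<sigma> P"
        using pos[OF tF] pq by (simp add: powr_mult powr_powr less_imp_le)
    qed
    also have "(\<Sum>P\<in>\<tau> ` \<G>. (\<Gamma>P P powr (1 / q')) powr p') = (\<Sum>P\<in>\<tau> ` \<G>. \<Gamma>P P powr (p' / q'))"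
      by (simp add: powr_powr)
    also have "T powr (1 / q) * ((\<Sum>P\<in>\<tau> ` \<G>. cf P powr p * \<sigma> P) powr (1 / p)
        * (\<Sum>P\<in>\<tau> ` \<G>. \<Gamma>P P powr (p' / q')) powr (1 / p'))
      \<le> T powr (1 / q) * (\<Phi> powr (1 / p) * \<Gamma> powr (1 / q'))"
    proof (intro mult_left_mono mult_mono)
      have "(\<Sum>P\<in>\<tau> ` \<G>. cf P powr p * \<sigma> P) \<le> (\<Sum>P\<in>stop F cf ` F. cf P powr p * \<sigma> P)"
        using finite_F GF stop_in pos unfolding \<tau>_def by (intro sum_mono2) (auto simp: less_imp_le)
      also note emb_f
      finally show "(\<Sum>P\<in>\<tau> ` \<G>. cf P powr p * \<sigma> P) powr (1 / p) \<le> \<Phi> powr (1 / p)"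
        using pq tF pos by (intro powr_mono2 sum_nonneg) (auto simp: less_imp_le)
      \<comment> \<open>Since p <= q, the exponent p'/q' is at least 1 and may be taken out of the
        sum. The groups of G over different P are disjoint, so the inner sum is the full embedding
        sum for g.\<close>
      have "(\<Sum>P\<in>\<tau> ` \<G>. \<Gamma>P P powr (p' / q')) \<le> (\<Sum>P\<in>\<tau> ` \<G>. \<Gamma>P P) powr (p' / q')"
        using p' q' fing \<Gamma>P0 by (intro sum_powr_le_powr_sum) auto
      also have "(\<Sum>P\<in>\<tau> ` \<G>. \<Gamma>P P) = (\<Sum>G\<in>\<G>. cg G powr q' * w G)"
        unfolding \<Gamma>P_def by (rule sum.image_gen[OF fing, symmetric])
      also have "\<dots> powr (p' / q') \<le> \<Gamma> powr (p' / q')"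
        using emb_g p' q' GF pos unfolding \<G>_def[symmetric] q'_def[symmetric]
        by (intro powr_mono2 sum_nonneg) (auto simp: less_imp_le subset_iff)
      finally have "(\<Sum>P\<in>\<tau> ` \<G>. \<Gamma>P P powr (p' / q')) powr (1 / p') \<le> (\<Gamma> powr (p' / q')) powr (1 / p')"
        using p' by (intro powr_mono2 sum_nonneg) auto
      then show "(\<Sum>P\<in>\<tau> ` \<G>. \<Gamma>P P powr (p' / q')) powr (1 / p') \<le> \<Gamma> powr (1 / q')"
        using p' by (simp add: powr_powr)
    qed auto
    finally show "(\<Sum>G\<in>\<G>. ?u G)
      \<le> T powr (1 / q) * (\<Phi> powr (1 / p) * \<Gamma> powr (1 / q'))" .
  qed (use C in simp)
  finally show ?thesis by (simp add: q'_def mult_ac)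
qed

end

text \<open>The factor 4 of \<open>class_bound\<close> times 4 * 2^\<gamma> * \<Lambda> * geo (min 1
  \<gamma>) of \<open>local_carleson\<close>; (4 \<Lambda>)^(1/q) from
  \<open>global_carleson\<close>; geo (1/q) sums over the levels of s^\<gamma> w / L, and N over
  those of \<rho>.\<close>

definition one_sided_const :: "real \<Rightarrow> real \<Rightarrow> real \<Rightarrow> real \<Rightarrow> real" where
  "one_sided_const q \<gamma> \<Lambda> N =
    16 * 2 powr \<gamma> * \<Lambda> * geo (min 1 \<gamma>) * (4 * \<Lambda>) powr (1 / q) * geo (1 / q) * N"

context laminar_family
begin

lemma one_sided_bound:
  fixes p q \<beta> \<Lambda> K N \<Phi> \<Gamma> :: real and e :: "int \<Rightarrow> real"
  assumes pq: "1 < p" "p \<le> q" and \<beta>: "0 < \<beta>"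
    and L: "superadditive F L" and \<sigma>: "superadditive F \<sigma>" and w: "superadditive F w"
    and \<Lambda>: "0 \<le> \<Lambda>" and pack: "\<And>R. R \<in> F \<Longrightarrow> (\<Sum>Q\<in>below F R. L Q) \<le> \<Lambda> * L R"
    and cf: "\<And>Q. Q \<in> F \<Longrightarrow> 0 < cf Q" and cg: "\<And>Q. Q \<in> F \<Longrightarrow> 0 < cg Q"
    and s_def: "\<And>Q. s Q = L Q powr (\<beta> - 1) * \<sigma> Q"
    and \<rho>: "\<And>Q. Q \<in> F \<Longrightarrow> 0 < \<rho> Q"
    and loc: "\<And>R. R \<in> F \<Longrightarrow> (\<Sum>Q\<in>below F R. s Q powr (q / p) * L Q) \<le> \<Lambda> * \<rho> R * \<sigma> R powr (q / p)"
    and K: "0 < K" and e: "\<And>a. 0 < e a"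
    and bump: "\<And>Q. Q \<in> F \<Longrightarrow> s Q powr (q / conj_exp p) * (w Q / L Q) * \<rho> Q * e (lv (\<rho> Q)) \<le> K"
    and N: "\<And>I. finite I \<Longrightarrow> (\<Sum>a\<in>I. e a powr (- (1 / q))) \<le> N"
    and emb_f: "(\<Sum>J\<in>stop F cf ` F. cf J powr p * \<sigma> J) \<le> \<Phi>"
    and emb_g: "(\<Sum>J\<in>stop F cg ` F. cg J powr conj_exp q * w J) \<le> \<Gamma>"
  shows "(\<Sum>Q\<in>{Q\<in>F. stop F cg Q \<subseteq> stop F cf Q}. s Q * w Q * cf Q * cg Q)
    \<le> one_sided_const q (q / conj_exp p) \<Lambda> N * K powr (1 / q) * \<Phi> powr (1 / p) * \<Gamma> powr (1 / conj_exp q)"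
proof -
  define \<gamma> where "\<gamma> = q / conj_exp p"
  define A where "A = {Q\<in>F. stop F cg Q \<subseteq> stop F cf Q}"
  have AF: "A \<subseteq> F" by (auto simp: A_def)
  have finA: "finite A" using finite_F by (simp add: A_def)
  have q: "1 < q" using pq by simp
  have \<gamma>: "0 < \<gamma>" "q = \<gamma> + q / p" "1 \<le> q / p"
    using conj_exp_gt_1[OF pq(1)] q pq by (simp_all add: \<gamma>_def, simp add: div_conj_exp)
  note pos = superadditive_pos[OF L] superadditive_pos[OF \<sigma>] superadditive_pos[OF w]
  have s: "0 < s Q" if "Q \<in> F" for Q using pos[OF that] by (simp add: s_def)
  define x where "x = (\<lambda>Q. s Q powr \<gamma> * (w Q / L Q))"
  \<comment> \<open>On level a of \<rho> the entropy bound says x <= Ka a. Measuring x relative to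
    this ceiling makes all class indices k nonpositive, so the decay starts at 0 for every
    a.\<close>
  define Ka where "Ka = (\<lambda>a. K / (2 powr a * e a))"
  define b where "b = (\<lambda>Q. lv (x Q / Ka (lv (\<rho> Q))))"
  define X where "X = 16 * 2 powr \<gamma> * \<Lambda> * geo (min 1 \<gamma>) * (4 * \<Lambda>) powr (1 / q) * K powr (1 / q)
     * \<Phi> powr (1 / p) * \<Gamma> powr (1 / conj_exp q)"
  have x: "0 < x Q" if "Q \<in> F" for Q using pos[OF that] s[OF that] by (simp add: x_def)
  have Ka: "0 < Ka a" for a using K e[of a] by (simp add: Ka_def)
  have geo0: "0 < geo (min 1 \<gamma>)" "0 < geo (1 / q)" using geo_pos \<gamma> q by simp_all
  have X0: "0 \<le> X" unfolding X_def using \<Lambda> geo0 by simp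
  let ?t = "\<lambda>Q. s Q * w Q * cf Q * cg Q"
  have t0: "0 \<le> ?t Q" if "Q \<in> F" for Q using that pos s cf cg by (simp add: less_imp_le)
  have cls: "sum ?t {Q\<in>{Q\<in>A. lv (\<rho> Q) = a}. b Q = k} \<le> X * e a powr (- (1 / q)) * 2 powr (- (1 / q) * \<bar>k - 0\<bar>)"
    for a k :: int
  proof -
    define D where "D = {Q\<in>{Q\<in>A. lv (\<rho> Q) = a}. b Q = k}"
    have DF: "D \<subseteq> F" using AF by (auto simp: D_def)
    show ?thesis
    proof (cases "D = {}")
      case True
      then show ?thesis unfolding D_def[symmetric] using X0 by simp
    next
      case False
      have xD: "2 powr k * Ka a \<le> x Q" "x Q \<le> 2 * 2 powr k * Ka a" "x Q \<le> Ka a" "\<rho> Q \<le> 2 * 2 powr a"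
        if "Q \<in> D" for Q
      proof -
        have Q: "Q \<in> F" "lv (\<rho> Q) = a" "lv (x Q / Ka a) = k" using that DF by (auto simp: D_def b_def)
        show "2 powr k * Ka a \<le> x Q" "x Q \<le> 2 * 2 powr k * Ka a"
          using lv_lower[of "x Q / Ka a"] lv_upper[of "x Q / Ka a"] x[OF Q(1)] Ka[of a] Q(3)
          by (auto simp: field_simps)
        show "\<rho> Q \<le> 2 * 2 powr a" using lv_upper[OF \<rho>[OF Q(1)]] Q(2) by simp
        have "2 powr a \<le> \<rho> Q" using lv_lower[OF \<rho>[OF Q(1)]] Q(2) by simp
        then have "x Q * 2 powr a * e a \<le> x Q * \<rho> Q * e a"
          using x[OF Q(1)] e[of a] by (intro mult_right_mono mult_left_mono) auto
        also have "\<dots> \<le> K" using bump[OF Q(1)] Q(2) by (simp add: x_def \<gamma>_def)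
        finally show "x Q \<le> Ka a" using e[of a] by (simp add: Ka_def field_simps)
      qed
      from False obtain Q0 where Q0: "Q0 \<in> D" by blast
      have k: "k \<le> 0"
      proof -
        have "2 powr k * Ka a \<le> 1 * Ka a" using xD[OF Q0] by linarith
        then have "2 powr k \<le> (2 powr 0 :: real)" using Ka[of a] by simp
        then show ?thesis by (subst (asm) powr_le_cancel_iff) auto
      qed
      define B where "B = 2 * 2 powr k * Ka a"
      have B: "0 < B" using Ka by (simp add: B_def)
      define Y where "Y = \<Lambda> * (2 * 2 powr a)"
      have Y: "0 \<le> Y" using \<Lambda> by (simp add: Y_def)
      \<comment> \<open>\<open>local_carleson\<close> must run inside the class, where s^\<gamma> w
        / L is bounded from both sides. \<open>global_carleson\<close> runs in F, because there P is
        an arbitrary member of F.\<close>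
      interpret D: laminar_family D by (rule subfamily[OF DF])
      note sub = superadditive_subset[OF _ DF]
      have "sum ?t D \<le> 4 * (4 * 2 powr \<gamma> * \<Lambda> * geo (min 1 \<gamma>)) * (B * Y) powr (1 / q)
          * \<Phi> powr (1 / p) * \<Gamma> powr (1 / conj_exp q)"
      proof (rule class_bound[OF pq \<sigma> w DF _ cf cg s _ _ _ _ emb_f emb_g])
        show "stop F cg Q \<subseteq> stop F cf Q" if "Q \<in> D" for Q using that by (auto simp: D_def A_def)
        show "0 \<le> 4 * 2 powr \<gamma> * \<Lambda> * geo (min 1 \<gamma>)" using \<Lambda> geo0 by simp
        show "0 \<le> B * Y" using B Y by simp
        fix R assume R: "R \<in> D"
        have "(\<Sum>Q\<in>below D R. s Q * w Q) \<le> 4 * 2 powr \<gamma> * \<Lambda> * (s R * w R) * geo (min 1 \<gamma>)"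
        proof (rule D.local_carleson[OF sub[OF L] sub[OF \<sigma>] sub[OF w] _ \<Lambda> \<beta> \<gamma>(1) B s_def _ _ R])
          fix P assume P: "P \<in> D"
          have "(\<Sum>Q\<in>below D P. L Q) \<le> (\<Sum>Q\<in>below F P. L Q)"
            using finite_F DF pos(1) by (intro sum_mono2) (auto simp: less_imp_le)
          also have "\<dots> \<le> \<Lambda> * L P" using P DF by (intro pack) auto
          finally show "(\<Sum>Q\<in>below D P. L Q) \<le> \<Lambda> * L P" .
          show "B / 2 \<le> s P powr \<gamma> * (w P / L P)" "s P powr \<gamma> * (w P / L P) \<le> B"
            using xD(1,2)[OF P] by (simp_all add: B_def x_def)
        qed
        then show "(\<Sum>Q\<in>below D R. s Q * w Q) \<le> 4 * 2 powr \<gamma> * \<Lambda> * geo (min 1 \<gamma>) * (s R * w R)"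
          by (simp add: mult_ac)
      next
        fix P assume P: "P \<in> F"
        show "(\<Sum>Q\<in>below D P. s Q powr q * w Q) \<le> B * Y * \<sigma> P powr (q / p)"
        proof (rule global_carleson[OF L \<sigma> w DF P \<gamma>(3,2) Y _ s])
          fix R assume R: "R \<in> D"
          have "(\<Sum>Q\<in>below F R. s Q powr (q / p) * L Q) \<le> \<Lambda> * \<rho> R * \<sigma> R powr (q / p)"
            using R DF by (intro loc) auto
          also have "\<dots> \<le> Y * \<sigma> R powr (q / p)"
            unfolding Y_def using xD(4)[OF R] \<Lambda> by (intro mult_right_mono mult_left_mono) auto
          finally show "(\<Sum>Q\<in>below F R. s Q powr (q / p) * L Q) \<le> Y * \<sigma> R powr (q / p)" .
          show "s R powr \<gamma> * (w R / L R) \<le> B" using xD(2)[OF R] by (simp add: B_def x_def)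
        qed (use B in auto)
      qed
      \<comment> \<open>The size 2^a of \<rho> cancels: it divides in \<open>Ka\<close> and
        multiplies in Y. Only 1 / e a is left to be summed over a.\<close>
      also have "B * Y = (4 * \<Lambda>) * K * inverse (e a) * 2 powr k"
        using e[of a] by (simp add: B_def Y_def Ka_def field_simps)
      also have "\<dots> powr (1 / q) = (4 * \<Lambda>) powr (1 / q) * K powr (1 / q) * e a powr (- (1 / q)) * 2 powr (- (1 / q) * \<bar>k - 0\<bar>)"
        using \<Lambda> K e[of a] k by (simp add: powr_mult powr_powr powr_minus inverse_powr)
      finally show ?thesis by (simp add: D_def X_def mult_ac)
    qed
  qed
  have "sum ?t A = (\<Sum>a\<in>(\<lambda>Q. lv (\<rho> Q)) ` A. sum ?t {Q\<in>A. lv (\<rho> Q) = a})"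
    by (rule sum.image_gen[OF finA])
  also have "\<dots> \<le> (\<Sum>a\<in>(\<lambda>Q. lv (\<rho> Q)) ` A. X * e a powr (- (1 / q)) * geo (1 / q))"
    using q finA X0 by (intro sum_mono sum_levels_le[where lev = b, OF _ _ _ cls]) auto
  also have "\<dots> = X * geo (1 / q) * (\<Sum>a\<in>(\<lambda>Q. lv (\<rho> Q)) ` A. e a powr (- (1 / q)))"
    by (simp add: sum_distrib_left mult_ac)
  also have "\<dots> \<le> X * geo (1 / q) * N"
    using finA X0 geo0 by (intro mult_left_mono N) auto
  finally show ?thesis by (simp add: A_def X_def one_sided_const_def \<gamma>_def mult_ac)
qed

text \<open>The local and embedding hypotheses are stated for all subfamilies because the families
  they are applied to, the principal sets of f / L and then the principal sets within these, arise
  only inside the proof.\<close>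

lemma form_bound:
  fixes p q \<beta> K\<^sub>1 K\<^sub>2 N\<^sub>1 N\<^sub>2 \<Phi> \<Gamma> :: real and e\<^sub>1 e\<^sub>2 :: "int \<Rightarrow> real"
  defines "\<Lambda> \<equiv> 2 * geo 1"
  assumes pq: "1 < p" "p \<le> q" and \<beta>: "0 < \<beta>"
    and L: "superadditive F L" and \<sigma>: "superadditive F \<sigma>" and w: "superadditive F w"
    and f: "superadditive F f" and g: "superadditive F g"
    and anti: "level_antichain F L"
    and \<rho>\<^sub>1: "\<And>Q. Q \<in> F \<Longrightarrow> 0 < \<rho>\<^sub>1 Q" and \<rho>\<^sub>2: "\<And>Q. Q \<in> F \<Longrightarrow> 0 < \<rho>\<^sub>2 Q"
    and loc\<^sub>1: "\<And>D R. D \<subseteq> F \<Longrightarrow> R \<in> D \<Longrightarrow> (\<And>P. P \<in> D \<Longrightarrow> (\<Sum>Q\<in>below D P. L Q) \<le> \<Lambda> * L P) \<Longrightarrow>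
      (\<Sum>Q\<in>below D R. (L Q powr (\<beta> - 1) * \<sigma> Q) powr (q / p) * L Q) \<le> \<Lambda> * \<rho>\<^sub>1 R * \<sigma> R powr (q / p)"
    and loc\<^sub>2: "\<And>D R. D \<subseteq> F \<Longrightarrow> R \<in> D \<Longrightarrow> (\<And>P. P \<in> D \<Longrightarrow> (\<Sum>Q\<in>below D P. L Q) \<le> \<Lambda> * L P) \<Longrightarrow>
      (\<Sum>Q\<in>below D R. (L Q powr (\<beta> - 1) * w Q) powr (conj_exp p / conj_exp q) * L Q)
        \<le> \<Lambda> * \<rho>\<^sub>2 R * w R powr (conj_exp p / conj_exp q)"
    and K: "0 < K\<^sub>1" "0 < K\<^sub>2" and e: "\<And>a. 0 < e\<^sub>1 a" "\<And>a. 0 < e\<^sub>2 a"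
    and bump\<^sub>1: "\<And>Q. Q \<in> F \<Longrightarrow>
      (L Q powr (\<beta> - 1) * \<sigma> Q) powr (q / conj_exp p) * (w Q / L Q) * \<rho>\<^sub>1 Q * e\<^sub>1 (lv (\<rho>\<^sub>1 Q)) \<le> K\<^sub>1"
    and bump\<^sub>2: "\<And>Q. Q \<in> F \<Longrightarrow>
      (L Q powr (\<beta> - 1) * w Q) powr (conj_exp p / q) * (\<sigma> Q / L Q) * \<rho>\<^sub>2 Q * e\<^sub>2 (lv (\<rho>\<^sub>2 Q)) \<le> K\<^sub>2"
    and N\<^sub>1: "\<And>I. finite I \<Longrightarrow> (\<Sum>a\<in>I. e\<^sub>1 a powr (- (1 / q))) \<le> N\<^sub>1"
    and N\<^sub>2: "\<And>I. finite I \<Longrightarrow> (\<Sum>a\<in>I. e\<^sub>2 a powr (- (1 / conj_exp p))) \<le> N\<^sub>2"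
    and emb_f: "\<And>D. D \<subseteq> F \<Longrightarrow> level_antichain D (\<lambda>Q. f Q / \<sigma> Q) \<Longrightarrow>
      (\<Sum>J\<in>D. (f J / \<sigma> J) powr p * \<sigma> J) \<le> \<Phi>"
    and emb_g: "\<And>D. D \<subseteq> F \<Longrightarrow> level_antichain D (\<lambda>Q. g Q / w Q) \<Longrightarrow>
      (\<Sum>J\<in>D. (g J / w J) powr conj_exp q * w J) \<le> \<Gamma>"
  shows "(\<Sum>Q\<in>F. L Q powr (\<beta> - 1) * f Q * g Q)
    \<le> 2 * 2 powr \<beta> * geo \<beta> *
       (one_sided_const q (q / conj_exp p) \<Lambda> N\<^sub>1 + one_sided_const (conj_exp p) (conj_exp p / q) \<Lambda> N\<^sub>2)
       * (K\<^sub>1 powr (1 / q) + K\<^sub>2 powr (1 / conj_exp p)) * \<Phi> powr (1 / p) * \<Gamma> powr (1 / conj_exp q)"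
proof -
  define S where "S = stop F (\<lambda>Q. f Q / L Q) ` F"
  have SF: "S \<subseteq> F" using stop_in by (auto simp: S_def)
  interpret S: laminar_family S by (rule subfamily[OF SF])
  note sub = superadditive_subset[OF _ SF]
  note pos = superadditive_pos[OF L] superadditive_pos[OF \<sigma>] superadditive_pos[OF w]
    superadditive_pos[OF f] superadditive_pos[OF g]
  have q: "1 < q" using pq by simp
  note dual = conj_exp_gt_1[OF q] conj_exp_antimono[OF pq] conj_exp_conj[OF pq(1)] conj_exp_conj[OF q]
  have p': "1 < conj_exp p" by (rule conj_exp_gt_1[OF pq(1)])
  have \<Lambda>: "0 \<le> \<Lambda>" using geo_pos[of 1] by (simp add: \<Lambda>_def)
  define cf where "cf = (\<lambda>Q. f Q / \<sigma> Q)"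
  define cg where "cg = (\<lambda>Q. g Q / w Q)"
  have cf: "0 < cf Q" and cg: "0 < cg Q" if "Q \<in> S" for Q
    using that SF pos by (auto simp: cf_def cg_def)
  have pack: "(\<Sum>Q\<in>below S R. L Q) \<le> \<Lambda> * L R" if "R \<in> S" for R
    unfolding S_def \<Lambda>_def using that SF by (intro stop_packing[OF L f]) auto
  have stop_sub: "stop S c ` S \<subseteq> F" for c using S.stop_in SF by auto
  have ef: "(\<Sum>J\<in>stop S cf ` S. cf J powr p * \<sigma> J) \<le> \<Phi>"
    unfolding cf_def by (rule emb_f[OF stop_sub S.level_antichain_stop])
  have eg: "(\<Sum>J\<in>stop S cg ` S. cg J powr conj_exp q * w J) \<le> \<Gamma>"
    unfolding cg_def by (rule emb_g[OF stop_sub S.level_antichain_stop])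
  define k\<^sub>1 where "k\<^sub>1 = K\<^sub>1 powr (1 / q)"
  define k\<^sub>2 where "k\<^sub>2 = K\<^sub>2 powr (1 / conj_exp p)"
  define c\<^sub>1 where "c\<^sub>1 = one_sided_const q (q / conj_exp p) \<Lambda> N\<^sub>1"
  define c\<^sub>2 where "c\<^sub>2 = one_sided_const (conj_exp p) (conj_exp p / q) \<Lambda> N\<^sub>2"
  define n where "n = \<Phi> powr (1 / p) * \<Gamma> powr (1 / conj_exp q)"
  let ?s = "\<lambda>Q. L Q powr (\<beta> - 1) * \<sigma> Q"
  let ?s' = "\<lambda>Q. L Q powr (\<beta> - 1) * w Q"
  let ?A = "{Q\<in>S. stop S cg Q \<subseteq> stop S cf Q}"
  let ?B = "{Q\<in>S. stop S cf Q \<subseteq> stop S cg Q}"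
  have one: "(\<Sum>Q\<in>?A. ?s Q * w Q * cf Q * cg Q)
    \<le> c\<^sub>1 * k\<^sub>1 * \<Phi> powr (1 / p) * \<Gamma> powr (1 / conj_exp q)"
    unfolding c\<^sub>1_def k\<^sub>1_def
    by (rule S.one_sided_bound[OF pq \<beta> sub[OF L] sub[OF \<sigma>] sub[OF w] \<Lambda> pack cf cg _ \<rho>\<^sub>1 loc\<^sub>1[OF SF _ pack] K(1) e(1) bump\<^sub>1 N\<^sub>1 ef eg])
      (use SF in auto)
  have "(\<Sum>Q\<in>?B. ?s' Q * \<sigma> Q * cg Q * cf Q)
    \<le> one_sided_const (conj_exp p) (conj_exp p / conj_exp (conj_exp q)) \<Lambda> N\<^sub>2 * k\<^sub>2
        * \<Gamma> powr (1 / conj_exp q) * \<Phi> powr (1 / conj_exp (conj_exp p))"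
    unfolding k\<^sub>2_def
    by (rule S.one_sided_bound[OF dual(1,2) \<beta> sub[OF L] sub[OF w] sub[OF \<sigma>] \<Lambda> pack cg cf _ \<rho>\<^sub>2 loc\<^sub>2[OF SF _ pack] K(2) e(2) _ N\<^sub>2 eg])
      (use SF bump\<^sub>2 ef dual in auto)
  then have two: "(\<Sum>Q\<in>?B. ?s' Q * \<sigma> Q * cg Q * cf Q)
    \<le> c\<^sub>2 * k\<^sub>2 * \<Gamma> powr (1 / conj_exp q) * \<Phi> powr (1 / p)"
    by (simp add: dual c\<^sub>2_def)
  let ?t = "\<lambda>Q. L Q powr (\<beta> - 1) * f Q * g Q"
  have t: "?s Q * w Q * cf Q * cg Q = ?t Q" "?s' Q * \<sigma> Q * cg Q * cf Q = ?t Q" if "Q \<in> S" for Q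
    using that SF pos[of Q] by (auto simp: cf_def cg_def)
  have "stop S cg Q \<subseteq> stop S cf Q \<or> stop S cf Q \<subseteq> stop S cg Q" if "Q \<in> S" for Q
  proof -
    have "Q \<noteq> {}" using that S.empty_notin by blast
    then have "stop S cg Q \<inter> stop S cf Q \<noteq> {}"
      using S.stop_sup[OF that, of cg] S.stop_sup[OF that, of cf] by blast
    then show ?thesis using S.laminar[OF S.stop_in[OF that] S.stop_in[OF that]] by blast
  qed
  then have "sum ?t S = sum ?t (?A \<union> ?B)"
    by (intro sum.cong) auto
  \<comment> \<open>The two cases overlap where both principal sets coincide; all terms are
    nonnegative, so double counting is harmless.\<close>
  also have "\<dots> \<le> sum ?t ?A + sum ?t ?B"
    using S.finite_F SF pos by (subst sum.union_inter[symmetric]) (auto intro!: sum_nonneg simp: less_imp_le subset_iff)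
  also have "sum ?t ?A = (\<Sum>Q\<in>?A. ?s Q * w Q * cf Q * cg Q)"
    by (rule sum.cong[OF refl], rule t(1)[symmetric]) simp
  also have "sum ?t ?B = (\<Sum>Q\<in>?B. ?s' Q * \<sigma> Q * cg Q * cf Q)"
    by (rule sum.cong[OF refl], rule t(2)[symmetric]) simp
  also have "(\<Sum>Q\<in>?A. ?s Q * w Q * cf Q * cg Q) + \<dots> \<le> c\<^sub>1 * k\<^sub>1 * n + c\<^sub>2 * k\<^sub>2 * n"
    using one two by (intro add_mono) (simp_all add: n_def mult_ac)
  also have "\<dots> \<le> (c\<^sub>1 + c\<^sub>2) * (k\<^sub>1 + k\<^sub>2) * n"
  proof -
    have "0 \<le> N\<^sub>1" "0 \<le> N\<^sub>2" using N\<^sub>1[of "{}"] N\<^sub>2[of "{}"] by simp_all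
    moreover have "0 < geo (1 / q)" "0 < geo (1 / conj_exp p)" "0 < geo (min 1 (q / conj_exp p))" "0 < geo (min 1 (conj_exp p / q))"
      using q p' by (auto intro!: geo_pos)
    ultimately have "0 \<le> c\<^sub>1" "0 \<le> c\<^sub>2"
      using \<Lambda> by (simp_all add: c\<^sub>1_def c\<^sub>2_def one_sided_const_def)
    moreover have "0 \<le> k\<^sub>1" "0 \<le> k\<^sub>2" "0 \<le> n" by (simp_all add: k\<^sub>1_def k\<^sub>2_def n_def)
    ultimately show ?thesis by (simp add: algebra_simps)
  qed
  finally have "sum ?t S \<le> (c\<^sub>1 + c\<^sub>2) * (k\<^sub>1 + k\<^sub>2) * n" .
  then have "2 * 2 powr \<beta> * geo \<beta> * sum ?t S \<le> 2 * 2 powr \<beta> * geo \<beta> * ((c\<^sub>1 + c\<^sub>2) * (k\<^sub>1 + k\<^sub>2) * n)"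
    using geo_pos[OF \<beta>] by (intro mult_left_mono) auto
  moreover have "sum ?t F \<le> 2 * 2 powr \<beta> * geo \<beta> * sum ?t S"
    unfolding S_def by (rule sparse_domination[OF L f g \<beta> anti])
  ultimately have "sum ?t F \<le> 2 * 2 powr \<beta> * geo \<beta> * ((c\<^sub>1 + c\<^sub>2) * (k\<^sub>1 + k\<^sub>2) * n)"
    by (rule order_trans[rotated])
  then show ?thesis by (simp add: c\<^sub>1_def c\<^sub>2_def k\<^sub>1_def k\<^sub>2_def n_def mult_ac)
qed

end

section \<open>Carleson embedding and packing integrals\<close>

lemma superadditive_measure:
  assumes "finite F" "F \<subseteq> sets M" "\<And>Q. Q \<in> F \<Longrightarrow> emeasure M Q \<noteq> \<infinity>" "\<And>Q. Q \<in> F \<Longrightarrow> 0 < measure M Q"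
  shows "superadditive F (measure M)"
  unfolding superadditive_def
proof (intro conjI ballI allI impI)
  fix R D assume R: "R \<in> F" and D: "D \<subseteq> F" "disjoint D \<and> \<Union>D \<subseteq> R"
  have fm: "Q \<in> fmeasurable M" if "Q \<in> F" for Q
    using assms(2) assms(3)[OF that] that by (auto simp: fmeasurable_def less_top)
  have finD: "finite D" using D(1) assms(1) by (rule finite_subset)
  have "sum (measure M) D = measure M (\<Union>D)"
    using D finD fm by (intro measure_Union'[symmetric]) auto
  also have "\<dots> \<le> measure M R"
    using D finD fm R assms(2) by (intro measure_mono_fmeasurable sets.finite_Union) auto
  finally show "sum (measure M) D \<le> measure M R" .
qed (use assms in auto)

text \<open>Truncation takes the place of a maximal theorem: as the average over J is at least 2^k,
  the part of f below 2^(k-1) carries at most half of the integral over J. At a fixed x the members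
  that still contribute form a chain, their levels are distinct, and 2^k < 2 f(x), so the pointwise
  sum is geometric.\<close>

lemma carleson_embedding:
  fixes f :: "'a \<Rightarrow> real" and p \<Phi> :: real
  assumes D: "laminar_family D" "level_antichain D (\<lambda>J. fh J / measure M J)" "D \<subseteq> sets M" and p: "1 < p"
    and f: "f \<in> borel_measurable M" "\<And>x. 0 \<le> f x"
    and M: "\<And>J. J \<in> D \<Longrightarrow> emeasure M J \<noteq> \<infinity>" "\<And>J. J \<in> D \<Longrightarrow> 0 < measure M J"
    and fh: "\<And>J. J \<in> D \<Longrightarrow> 0 < fh J" "\<And>J. J \<in> D \<Longrightarrow> ennreal (fh J) = (\<integral>\<^sup>+x\<in>J. ennreal (f x) \<partial>M)"
    and \<Phi>: "0 \<le> \<Phi>" "(\<integral>\<^sup>+x. ennreal (f x powr p) \<partial>M) \<le> ennreal \<Phi>"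
  shows "(\<Sum>J\<in>D. (fh J / measure M J) powr p * measure M J) \<le> 2 powr (2 * p - 1) * geo (p - 1) * \<Phi>"
proof -
  interpret laminar_family D by (rule D(1))
  define c where "c = (\<lambda>J. fh J / measure M J)"
  define k where "k = (\<lambda>J. lv (c J))"
  define a where "a = (\<lambda>J x. f x * indicator (J \<inter> {x. 2 powr (k J - 1) < f x}) x)"
  \<comment> \<open>\<open>?m\<close> is 2 (2 * 2^k)^(p-1). In \<open>?C\<close> its 2^p meets the
    2^(p-1) from (2 f x)^(p-1), which gives the exponent 2 p - 1.\<close>
  let ?m = "\<lambda>J. 2 powr p * 2 powr (k J * (p - 1))" and ?C = "2 powr (2 * p - 1) * geo (p - 1)"
  have meas: "J \<in> sets M" if "J \<in> D" for J using that D(3) by auto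
  have [measurable]: "f \<in> borel_measurable M" by (rule f(1))
  have am: "(\<lambda>x. ennreal (a J x)) \<in> borel_measurable M" if "J \<in> D" for J
  proof -
    have [measurable]: "J \<in> sets M" by (rule meas[OF that])
    have "a J = (\<lambda>x. f x * (indicator J x * (if 2 powr (k J - 1) < f x then 1 else 0)))"
      by (auto simp: a_def fun_eq_iff indicator_def)
    then show ?thesis by simp
  qed
  have a0: "0 \<le> a J x" for J x using f(2) by (simp add: a_def)
  have c: "0 < c J" if "J \<in> D" for J using fh(1) M(2) that by (simp add: c_def)
  have one: "ennreal (c J powr p * measure M J) \<le> ennreal (?m J) * (\<integral>\<^sup>+x. a J x \<partial>M)"
    if J: "J \<in> D" for J
  proof -
    have [measurable]: "J \<in> sets M" by (rule meas[OF J])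
    have lo: "2 powr k J * measure M J \<le> fh J" and hi: "c J \<le> 2 * 2 powr k J"
      using lv_lower[OF c[OF J]] lv_upper[OF c[OF J]] M(2)[OF J] by (auto simp: k_def c_def field_simps)
    have "ennreal (fh J) = (\<integral>\<^sup>+x\<in>J. ennreal (f x) \<partial>M)" by (rule fh(2)[OF J])
    also have "\<dots> \<le> (\<integral>\<^sup>+x. ennreal (a J x) + ennreal (2 powr (k J - 1)) * indicator J x \<partial>M)"
      using f(2) by (intro nn_integral_mono) (auto simp: a_def indicator_def intro!: ennreal_leI)
    also have "\<dots> = (\<integral>\<^sup>+x. a J x \<partial>M) + ennreal (2 powr (k J - 1)) * emeasure M J"
      using am[OF J] by (simp add: nn_integral_add nn_integral_cmult_indicator)
    also have "ennreal (2 powr (k J - 1)) * emeasure M J = ennreal (2 powr (k J - 1) * measure M J)"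
      using M(1)[OF J] by (simp add: emeasure_eq_ennreal_measure ennreal_mult)
    finally have *: "ennreal (fh J) \<le> (\<integral>\<^sup>+x. a J x \<partial>M) + ennreal (2 powr (k J - 1) * measure M J)" .
    have "ennreal (fh J) \<le> 2 * (\<integral>\<^sup>+x. a J x \<partial>M)"
    proof (cases "(\<integral>\<^sup>+x. a J x \<partial>M)" rule: ennreal_cases)
      case (real A)
      have "fh J \<le> A + 2 powr (k J - 1) * measure M J"
        using * real by (simp add: ennreal_plus[symmetric] del: ennreal_plus)
      then have "fh J \<le> 2 * A" using lo by (simp add: powr_diff)
      then have "ennreal (fh J) \<le> ennreal (2 * A)" by (rule ennreal_leI)
      then show ?thesis using real by (simp add: ennreal_mult)
    qed (simp add: ennreal_mult_top)
    moreover have "c J powr p * measure M J \<le> (2 * 2 powr k J) powr (p - 1) * fh J"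
    proof -
      have "c J powr p * measure M J = c J powr (p - 1) * fh J"
        using fh(1)[OF J] M(2)[OF J] by (simp add: powr_diff c_def)
      also have "\<dots> \<le> (2 * 2 powr k J) powr (p - 1) * fh J"
        using hi c[OF J] p fh(1)[OF J] by (intro mult_right_mono powr_mono2) auto
      finally show ?thesis .
    qed
    ultimately have *: "ennreal (fh J) \<le> 2 * (\<integral>\<^sup>+x. a J x \<partial>M)"
      "c J powr p * measure M J \<le> (2 * 2 powr k J) powr (p - 1) * fh J" .
    have "ennreal (c J powr p * measure M J) \<le> ennreal ((2 * 2 powr k J) powr (p - 1) * fh J)"
      by (rule ennreal_leI[OF *(2)])
    also have "\<dots> = ennreal ((2 * 2 powr k J) powr (p - 1)) * ennreal (fh J)"
      using fh(1)[OF J] by (intro ennreal_mult) auto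
    also have "\<dots> \<le> ennreal ((2 * 2 powr k J) powr (p - 1)) * (2 * (\<integral>\<^sup>+x. a J x \<partial>M))"
      by (intro mult_left_mono *(1)) simp
    also have "\<dots> = ennreal ((2 * 2 powr k J) powr (p - 1) * 2) * (\<integral>\<^sup>+x. a J x \<partial>M)"
      by (simp add: ennreal_mult mult.assoc)
    also have "(2 * 2 powr k J) powr (p - 1) * 2 = ?m J"
      by (simp add: powr_mult powr_powr powr_diff right_diff_distrib)
    finally show ?thesis .
  qed
  have pt: "(\<Sum>J\<in>D. ?m J * a J x) \<le> ?C * f x powr p" for x
  proof (cases "f x = 0")
    case True
    then show ?thesis by (simp add: a_def)
  next
    case False
    then have fx: "0 < f x" using f(2)[of x] by simp
    define E where "E = {J\<in>D. x \<in> J \<and> 2 powr (k J - 1) < f x}"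
    have inj: "inj_on k E"
    proof (rule inj_onI)
      fix P Q assume PQ: "P \<in> E" "Q \<in> E" "k P = k Q"
      then have "P \<subseteq> Q \<or> Q \<subseteq> P" using laminar[of P Q] by (auto simp: E_def)
      then show "P = Q"
        using D(2) PQ unfolding level_antichain_def E_def k_def c_def by (metis (mono_tags, lifting) mem_Collect_eq psubsetI)
    qed
    have "(\<Sum>J\<in>D. ?m J * a J x) = (\<Sum>J\<in>E. ?m J * f x)"
      using finite_F by (intro sum.mono_neutral_cong_right) (auto simp: E_def a_def)
    also have "\<dots> = 2 powr p * f x * (\<Sum>J\<in>E. 2 powr (k J * (p - 1)))"
      by (simp add: sum_distrib_left mult_ac)
    also have "(\<Sum>J\<in>E. 2 powr (k J * (p - 1))) = (\<Sum>i\<in>k ` E. 2 powr (i * (p - 1)))"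
      by (simp add: sum.reindex[OF inj])
    also have "\<dots> \<le> geo (p - 1) * (2 * f x) powr (p - 1)"
      using p finite_F fx by (intro sum_powr_below_le) (auto simp: E_def powr_diff)
    also have "2 powr p * f x * (geo (p - 1) * (2 * f x) powr (p - 1)) = ?C * f x powr p"
    proof -
      have "2 powr p * (2 * f x) powr (p - 1) * f x = 2 powr (p + (p - 1)) * f x powr p"
        using fx by (simp add: powr_mult powr_add[symmetric] powr_diff)
      moreover have "p + (p - 1) = 2 * p - 1" by simp
      moreover have "2 powr p * f x * (geo (p - 1) * (2 * f x) powr (p - 1)) = geo (p - 1) * (2 powr p * (2 * f x) powr (p - 1) * f x)"
        by (simp only: mult_ac)
      ultimately show ?thesis by (simp only: mult_ac)
    qed
    finally show ?thesis using fx by (simp add: mult_left_mono)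
  qed
  have "ennreal (\<Sum>J\<in>D. c J powr p * measure M J) = (\<Sum>J\<in>D. ennreal (c J powr p * measure M J))"
    by (simp add: sum_ennreal)
  also have "\<dots> \<le> (\<Sum>J\<in>D. ennreal (?m J) * (\<integral>\<^sup>+x. a J x \<partial>M))"
    by (intro sum_mono one)
  also have "\<dots> = (\<integral>\<^sup>+x. (\<Sum>J\<in>D. ennreal (?m J) * a J x) \<partial>M)"
    using am by (subst nn_integral_sum) (auto simp: nn_integral_cmult)
  also have "\<dots> = (\<integral>\<^sup>+x. ennreal (\<Sum>J\<in>D. ?m J * a J x) \<partial>M)"
    using a0 by (simp add: sum_ennreal[symmetric] ennreal_mult)
  also have "\<dots> \<le> (\<integral>\<^sup>+x. ennreal (?C) * ennreal (f x powr p) \<partial>M)"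
    using pt geo_pos[of "p - 1"] p by (intro nn_integral_mono) (simp add: ennreal_mult[symmetric] ennreal_leI)
  also have "\<dots> = ennreal (?C) * (\<integral>\<^sup>+x. ennreal (f x powr p) \<partial>M)"
    by (rule nn_integral_cmult) simp
  also have "\<dots> \<le> ennreal (?C) * ennreal \<Phi>"
    by (intro mult_left_mono \<Phi>) simp
  also have "\<dots> = ennreal (?C * \<Phi>)"
    using geo_pos[of "p - 1"] p \<Phi> by (simp add: ennreal_mult)
  finally have "(\<Sum>J\<in>D. c J powr p * measure M J) \<le> ?C * \<Phi>"
    using geo_pos[of "p - 1"] p \<Phi> by (subst (asm) ennreal_le_iff) auto
  then show ?thesis by (simp add: c_def)
qed

text \<open>A layer-cake argument: the smallest coefficient is split off and handled by the packing condition.\<close>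

lemma sum_le_packing_nn_integral_aux:
  assumes "finite D" "D \<subseteq> sets M" "0 \<le> \<Lambda>"
    and "\<And>Q. Q \<in> D \<Longrightarrow> emeasure M Q \<noteq> \<infinity>"
    and "\<And>E. E \<subseteq> D \<Longrightarrow> (\<Sum>Q\<in>E. measure M Q) \<le> \<Lambda> * measure M (\<Union>E)"
    and "h \<in> borel_measurable M" "\<And>Q. Q \<in> D \<Longrightarrow> 0 \<le> c Q"
    and "\<And>Q x. Q \<in> D \<Longrightarrow> x \<in> Q \<Longrightarrow> ennreal (c Q) \<le> h x"
  shows "ennreal (\<Sum>Q\<in>D. c Q * measure M Q) \<le> ennreal \<Lambda> * (\<integral>\<^sup>+x\<in>\<Union>D. h x \<partial>M)"
  using assms
proof (induction "card D" arbitrary: D c h)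
  case 0
  then show ?case by simp
next
  case (Suc n)
  note D = Suc.prems
  have ne: "D \<noteq> {}" using Suc.hyps(2) by auto
  obtain P where P: "P \<in> D" "\<And>Q. Q \<in> D \<Longrightarrow> c P \<le> c Q"
    using ex_min_if_finite[of "c ` D"] D(1) ne by (metis arg_min_if_finite(1) arg_min_least)
  define d where "d = c P"
  define E where "E = D - {P}"
  have d: "0 \<le> d" using D(7) P by (simp add: d_def)
  have U: "\<Union>D \<in> sets M" "\<Union>E \<in> sets M" using D(1,2) by (auto simp: E_def intro!: sets.finite_Union)
  have fin: "emeasure M (\<Union>D) \<noteq> \<infinity>"
  proof -
    have "emeasure M (\<Union>D) \<le> (\<Sum>Q\<in>D. emeasure M Q)"
      using D(1,2) emeasure_subadditive_finite[of D "\<lambda>Q. Q" M] by auto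
    also have "\<dots> < \<infinity>" using D(1,4) by (simp add: less_top)
    finally show ?thesis by simp
  qed
  have hd: "ennreal d \<le> h x" if "x \<in> \<Union>D" for x
    using that D(8) P(2) unfolding d_def by (meson UnionE ennreal_leI order_trans)
  have "ennreal (\<Sum>Q\<in>E. (c Q - d) * measure M Q) \<le> ennreal \<Lambda> * (\<integral>\<^sup>+x\<in>\<Union>E. (h x - ennreal d) \<partial>M)"
  proof (rule Suc.hyps(1))
    show "n = card E" using Suc.hyps(2) P D(1) by (simp add: E_def)
    show "(\<lambda>x. h x - ennreal d) \<in> borel_measurable M" using D(6) by simp
    show "sum (measure M) E' \<le> \<Lambda> * measure M (\<Union>E')" if "E' \<subseteq> E" for E'
      using that by (intro D(5)) (auto simp: E_def)
    fix Q x assume "Q \<in> E" "x \<in> Q"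
    then show "ennreal (c Q - d) \<le> h x - ennreal d"
      using D(8)[of Q x] d by (simp add: E_def ennreal_minus[symmetric] ennreal_minus_mono)
  qed (use D P in \<open>auto simp: E_def d_def\<close>)
  also have "\<dots> \<le> ennreal \<Lambda> * (\<integral>\<^sup>+x\<in>\<Union>D. (h x - ennreal d) \<partial>M)"
    by (intro mult_left_mono nn_integral_mono) (auto simp: E_def indicator_def)
  finally have 1: "ennreal (\<Sum>Q\<in>E. (c Q - d) * measure M Q) \<le> ennreal \<Lambda> * (\<integral>\<^sup>+x\<in>\<Union>D. (h x - ennreal d) \<partial>M)" .
  have "(\<Sum>Q\<in>D. c Q * measure M Q) = (\<Sum>Q\<in>D. (c Q - d) * measure M Q) + d * (\<Sum>Q\<in>D. measure M Q)"
    by (simp add: sum.distrib[symmetric] sum_distrib_left algebra_simps)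
  also have "(\<Sum>Q\<in>D. (c Q - d) * measure M Q) = (\<Sum>Q\<in>E. (c Q - d) * measure M Q)"
    using D(1) P(1) by (simp add: E_def sum.remove d_def)
  also have "d * (\<Sum>Q\<in>D. measure M Q) \<le> d * (\<Lambda> * measure M (\<Union>D))"
    using D(5)[of D] d by (intro mult_left_mono) auto
  finally have "ennreal (\<Sum>Q\<in>D. c Q * measure M Q)
    \<le> ennreal ((\<Sum>Q\<in>E. (c Q - d) * measure M Q) + d * (\<Lambda> * measure M (\<Union>D)))"
    by (intro ennreal_leI) simp
  also have "\<dots> = ennreal (\<Sum>Q\<in>E. (c Q - d) * measure M Q) + ennreal \<Lambda> * (ennreal d * emeasure M (\<Union>D))"
  proof -
    have "0 \<le> (\<Sum>Q\<in>E. (c Q - d) * measure M Q)" using P by (intro sum_nonneg) (auto simp: E_def d_def)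
    then show ?thesis
      using d D(3) fin by (simp add: emeasure_eq_ennreal_measure ennreal_mult mult_ac)
  qed
  also have "\<dots> \<le> ennreal \<Lambda> * (\<integral>\<^sup>+x\<in>\<Union>D. (h x - ennreal d) \<partial>M) + ennreal \<Lambda> * (ennreal d * emeasure M (\<Union>D))"
    by (intro add_mono 1 order_refl)
  also have "\<dots> = ennreal \<Lambda> * (\<integral>\<^sup>+x. (h x - ennreal d) * indicator (\<Union>D) x + ennreal d * indicator (\<Union>D) x \<partial>M)"
    using U D(6) by (subst nn_integral_add) (auto simp: nn_integral_cmult_indicator distrib_left)
  also have "(\<integral>\<^sup>+x. (h x - ennreal d) * indicator (\<Union>D) x + ennreal d * indicator (\<Union>D) x \<partial>M) = (\<integral>\<^sup>+x\<in>\<Union>D. h x \<partial>M)"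
    using hd by (intro nn_integral_cong) (auto simp: indicator_def diff_add_cancel_ennreal)
  finally show ?case .
qed

text \<open>No measurability of h is assumed, since h will be a power of \<open>frac_max\<close>.
  The finite supremum g is measurable, still dominates the coefficients, and lies below h on the
  union.\<close>

lemma sum_le_packing_nn_integral:
  assumes D: "finite D" "D \<subseteq> sets M" "0 \<le> \<Lambda>"
    and fin: "\<And>Q. Q \<in> D \<Longrightarrow> emeasure M Q \<noteq> \<infinity>"
    and pack: "\<And>E. E \<subseteq> D \<Longrightarrow> (\<Sum>Q\<in>E. measure M Q) \<le> \<Lambda> * measure M (\<Union>E)"
    and R: "\<Union>D \<subseteq> R" and c: "\<And>Q. Q \<in> D \<Longrightarrow> 0 \<le> c Q"
    and h: "\<And>Q x. Q \<in> D \<Longrightarrow> x \<in> Q \<Longrightarrow> ennreal (c Q) \<le> h x"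
  shows "ennreal (\<Sum>Q\<in>D. c Q * measure M Q) \<le> ennreal \<Lambda> * (\<integral>\<^sup>+x\<in>R. h x \<partial>M)"
proof -
  define g where "g = (\<lambda>x. SUP Q\<in>D. ennreal (c Q) * indicator Q x)"
  have "ennreal (\<Sum>Q\<in>D. c Q * measure M Q) \<le> ennreal \<Lambda> * (\<integral>\<^sup>+x\<in>\<Union>D. g x \<partial>M)"
  proof (rule sum_le_packing_nn_integral_aux[OF D fin pack _ c])
    show "g \<in> borel_measurable M"
      unfolding g_def using D by (intro borel_measurable_SUP) (auto intro: countable_finite)
    show "ennreal (c Q) \<le> g x" if "Q \<in> D" "x \<in> Q" for Q x
      unfolding g_def by (rule SUP_upper2[OF that(1)]) (use that(2) in simp)
  qed
  also have "\<dots> \<le> ennreal \<Lambda> * (\<integral>\<^sup>+x\<in>R. h x \<partial>M)"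
  proof (intro mult_left_mono nn_integral_mono)
    show "g x * indicator (\<Union>D) x \<le> h x * indicator R x" for x
    proof (cases "x \<in> \<Union>D")
      case True
      have "g x \<le> h x" unfolding g_def using h by (intro SUP_least) (auto simp: indicator_def)
      then show ?thesis using True R by (auto simp: indicator_def)
    qed simp
  qed simp
  finally show ?thesis .
qed

text \<open>Away from t = 1, \<open>e a\<close> is the value of \<epsilon> at the endpoint of the
  dyadic interval nearest to 1, a lower bound on the interval by monotonicity. On the next interval
  towards 1 it is an upper bound for \<epsilon>, so the integral over that interval is at least
  e(a)^(-1/r) / 2.\<close>

lemma bump_function_levels:
  assumes "bump_function r \<epsilon>" "0 < r"
  obtains e :: "int \<Rightarrow> real" and N where "\<And>a. 0 < e a" "\<And>t. 0 < t \<Longrightarrow> e (lv t) \<le> \<epsilon> t"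
    "\<And>I. finite I \<Longrightarrow> (\<Sum>a\<in>I. e a powr (- (1 / r))) \<le> N"
proof -
  from assms(1) obtain c where pos: "\<And>t. 0 < t \<Longrightarrow> 0 < \<epsilon> t" and anti: "antimono_on {0<..<1} \<epsilon>"
    and mono: "mono_on {1<..} \<epsilon>" and c: "0 < c" "\<And>t. 0 < t \<Longrightarrow> c \<le> \<epsilon> t"
    and int: "set_integrable lborel {0<..} (\<lambda>t. 1 / (t * \<epsilon> t powr (1 / r)))"
    unfolding bump_function_def by auto
  define \<phi> where "\<phi> = (\<lambda>t. 1 / (t * \<epsilon> t powr (1 / r)))"
  \<comment> \<open>For the levels -1 and 0 the endpoint nearest to 1 is 1 itself, where the
    monotonicity hypotheses on the open intervals say nothing; the lower bound c is used
    instead.\<close>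
  define e where "e = (\<lambda>a::int. if 1 \<le> a then \<epsilon> (2 powr a) else if a \<le> -2 then \<epsilon> (2 powr (a + 1)) else c)"
  have e0: "0 < e a" for a using pos c by (simp add: e_def)
  have le: "e (lv t) \<le> \<epsilon> t" if t: "0 < t" for t
  proof -
    define a where "a = lv t"
    have lo: "2 powr a \<le> t" and hi: "t \<le> 2 powr (a + 1)"
      using lv_lower[OF t] lv_upper[OF t] by (auto simp: a_def powr_add)
    consider "1 \<le> a" | "a \<le> -2" | "\<not> 1 \<le> a" "\<not> a \<le> -2" by blast
    then show ?thesis
    proof cases
      case 1
      then have "(1::real) < 2 powr a" by simp
      then have "\<epsilon> (2 powr a) \<le> \<epsilon> t" using lo by (intro mono_onD[OF mono]) auto
      then show ?thesis using 1 by (simp add: e_def a_def)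
    next
      case 2
      then have "2 powr (a + 1) < (1::real)" by (intro powr_less_one) auto
      then have "\<epsilon> (2 powr (a + 1)) \<le> \<epsilon> t" using hi t by (intro monotone_onD[OF anti, simplified]) auto
      then show ?thesis using 2 by (simp add: e_def a_def)
    next
      case 3
      then show ?thesis using c(2)[OF t] by (simp add: e_def a_def)
    qed
  qed
  let ?e = "\<lambda>a. e a powr (- (1 / r))"
  \<comment> \<open>Exponent of the neighbouring interval on the side of 1. It is at least 0 for a
    >= 1 and at most -1 for a <= -2, so the intervals \<open>V a\<close> are pairwise disjoint and
    one integral controls all of them.\<close>
  define b where "b = (\<lambda>a::int. if 1 \<le> a then a - 1 else a + 1)"
  define V where "V = (\<lambda>a. {2 powr b a <..< 2 * 2 powr b a :: real})"
  have \<phi>m: "(\<lambda>t. indicator {0<..} t *\<^sub>R \<phi> t) \<in> borel_measurable lborel"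
    using int unfolding set_integrable_def \<phi>_def by (rule borel_measurable_integrable)
  have \<phi>0: "0 \<le> \<phi> t" if "0 < t" for t using that by (simp add: \<phi>_def)
  let ?\<psi> = "\<lambda>t. ennreal (indicator {0<..} t *\<^sub>R \<phi> t)"
  define Z where "Z = (LINT t:{0<..}|lborel. \<phi> t)"
  have Z: "(\<integral>\<^sup>+t. ?\<psi> t \<partial>lborel) = ennreal Z"
    unfolding Z_def set_lebesgue_integral_def
    using int \<phi>0 unfolding set_integrable_def \<phi>_def[symmetric]
    by (intro nn_integral_eq_integral) (auto simp: indicator_def)
  have Z0: "0 \<le> Z"
    unfolding Z_def set_lebesgue_integral_def using \<phi>0 by (intro integral_nonneg_AE) (auto simp: indicator_def)
  have one: "ennreal (?e a / 2) \<le> (\<integral>\<^sup>+t. ?\<psi> t * indicator (V a) t \<partial>lborel)"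
    if a: "1 \<le> a \<or> a \<le> -2" for a
  proof -
    have "ennreal (?e a / 2) = ennreal (?e a / (2 * 2 powr b a)) * emeasure lborel (V a)"
      by (simp add: V_def ennreal_mult'[symmetric])
    also have "\<dots> = (\<integral>\<^sup>+t. ennreal (?e a / (2 * 2 powr b a)) * indicator (V a) t \<partial>lborel)"
      by (rule nn_integral_cmult_indicator[symmetric]) (simp add: V_def)
    also have "\<dots> \<le> (\<integral>\<^sup>+t. ?\<psi> t * indicator (V a) t \<partial>lborel)"
    proof (intro nn_integral_mono)
      fix t
      show "ennreal (?e a / (2 * 2 powr b a)) * indicator (V a) t
        \<le> ?\<psi> t * indicator (V a) t"
      proof (cases "t \<in> V a")
        case True
        then have t: "2 powr b a < t" "t < 2 * 2 powr b a" by (auto simp: V_def)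
        have t0: "0 < t" using t(1) powr_gt_zero[of "2::real" "b a"] by linarith
        have "\<epsilon> t \<le> e a"
        proof (cases "1 \<le> a")
          case True
          then have "(1::real) \<le> 2 powr b a" by (simp add: b_def ge_one_powr_ge_zero)
          moreover have "2 * 2 powr b a = (2::real) powr a" using True by (simp add: b_def powr_diff)
          ultimately have "\<epsilon> t \<le> \<epsilon> (2 powr a)" using t by (intro mono_onD[OF mono]) auto
          then show ?thesis using True by (simp add: e_def)
        next
          case False
          then have a2: "a \<le> -2" using a by simp
          have b: "b a = a + 1" using a2 by (simp add: b_def)
          have "2 * 2 powr b a = (2::real) powr (a + 2)" by (simp add: b powr_add)
          also have "\<dots> \<le> 2 powr 0" using a2 by (intro powr_mono) auto
          finally have "t < 1" using t by simp
          then have "\<epsilon> t \<le> \<epsilon> (2 powr (a + 1))" using t b by (intro monotone_onD[OF anti, simplified]) auto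
          then show ?thesis using a2 by (simp add: e_def)
        qed
        then have "\<epsilon> t powr (1 / r) \<le> e a powr (1 / r)" using pos[OF t0] assms(2) by (intro powr_mono2) auto
        then have "t * \<epsilon> t powr (1 / r) \<le> (2 * 2 powr b a) * e a powr (1 / r)"
          using t t0 by (intro mult_mono) auto
        then have "1 / ((2 * 2 powr b a) * e a powr (1 / r)) \<le> \<phi> t"
          unfolding \<phi>_def using t0 pos[OF t0] by (intro divide_left_mono mult_pos_pos) (use e0[of a] in auto)
        then have "?e a / (2 * 2 powr b a) \<le> \<phi> t"
          by (simp add: powr_minus field_simps)
        then show ?thesis using True t0 by (simp add: ennreal_leI)
      qed simp
    qed
    finally show ?thesis .
  qed
  have sum: "(\<Sum>a\<in>I. ?e a) \<le> 2 * Z" if I: "finite I" "\<And>a. a \<in> I \<Longrightarrow> 1 \<le> a \<or> a \<le> -2" for I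
  proof -
    have "ennreal (\<Sum>a\<in>I. ?e a / 2) = (\<Sum>a\<in>I. ennreal (?e a / 2))"
      by (simp add: sum_ennreal)
    also have "\<dots> \<le> (\<Sum>a\<in>I. \<integral>\<^sup>+t. ?\<psi> t * indicator (V a) t \<partial>lborel)"
      using I(2) by (intro sum_mono one)
    also have "\<dots> = (\<integral>\<^sup>+t. (\<Sum>a\<in>I. ?\<psi> t * indicator (V a) t) \<partial>lborel)"
      using \<phi>m by (intro nn_integral_sum[symmetric]) (simp add: V_def)
    also have "\<dots> \<le> (\<integral>\<^sup>+t. ?\<psi> t \<partial>lborel)"
    proof (intro nn_integral_mono)
      fix t
      define E where "E = {a\<in>I. t \<in> V a}"
      have lvt: "lv t = b a" if "a \<in> E" for a
        using that by (intro lv_eq) (auto simp: E_def V_def)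
      have "x = y" if "x \<in> E" "y \<in> E" for x y
      proof -
        have "b x = b y" using lvt that by metis
        moreover have "1 \<le> x \<or> x \<le> -2" "1 \<le> y \<or> y \<le> -2" using that I(2) by (auto simp: E_def)
        ultimately show ?thesis by (auto simp: b_def split: if_splits)
      qed
      then have cE: "card E \<le> 1" using I(1) by (simp add: card_le_Suc0_iff_eq E_def)
      have "(\<Sum>a\<in>I. ?\<psi> t * indicator (V a) t)
        = (\<Sum>a\<in>E. ?\<psi> t)"
        using I(1) by (intro sum.mono_neutral_cong_right) (auto simp: E_def)
      also have "\<dots> = of_nat (card E) * ?\<psi> t" by simp
      also have "\<dots> \<le> 1 * ?\<psi> t"
        using cE by (intro mult_right_mono) (auto simp: le_Suc_eq)
      finally show "(\<Sum>a\<in>I. ?\<psi> t * indicator (V a) t) \<le> ?\<psi> t"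
        by simp
    qed
    finally have "(\<Sum>a\<in>I. ?e a / 2) \<le> Z" using Z Z0 by simp
    then show ?thesis by (simp add: sum_divide_distrib[symmetric])
  qed
  have "(\<Sum>a\<in>I. ?e a) \<le> 2 * Z + 2 * c powr (- (1 / r))" if I: "finite I" for I
  proof -
    have "(\<Sum>a\<in>I. ?e a) \<le> (\<Sum>a\<in>{a\<in>I. 1 \<le> a \<or> a \<le> -2} \<union> {-1, 0}. ?e a)"
      using I by (intro sum_mono2) auto
    also have "\<dots> = (\<Sum>a\<in>{a\<in>I. 1 \<le> a \<or> a \<le> -2}. ?e a) + (\<Sum>a\<in>{-1, 0}. ?e a)"
      using I by (intro sum.union_disjoint) auto
    also have "\<dots> \<le> 2 * Z + 2 * c powr (- (1 / r))"
    proof (rule add_mono)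
      show "(\<Sum>a\<in>{a\<in>I. 1 \<le> a \<or> a \<le> -2}. ?e a) \<le> 2 * Z" using I by (intro sum) auto
      have "e (- 1) = c" "e 0 = c" by (simp_all add: e_def)
      then show "(\<Sum>a\<in>{-1, 0}. ?e a) \<le> 2 * c powr (- (1 / r))" by simp
    qed
    finally show ?thesis .
  qed
  then show ?thesis using that[OF e0 le] by blast
qed

section \<open>Adjacent dyadic grids\<close>

abbreviation vol :: "(real^'n::finite) set \<Rightarrow> real" where
  "vol \<equiv> measure lebesgue"

text \<open>Alternating the sign of the shift makes consecutive generations of the shifted grid nest.\<close>

definition grid_shift :: "bool \<Rightarrow> int \<Rightarrow> real" where
  "grid_shift b k = (if b then if even k then 1 / 3 else - (1 / 3) else 0)"

text \<open>k is the generation, with side length 2^(-k), so larger k is finer. t selects the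
  coordinates that are shifted; this yields 2^n grids in dimension n.\<close>

definition dyadic_index :: "('n::finite \<Rightarrow> bool) \<Rightarrow> int \<Rightarrow> real^'n \<Rightarrow> int^'n" where
  "dyadic_index t k x = (\<chi> i. \<lfloor>2 powr k * x $ i - grid_shift (t i) k\<rfloor>)"

definition dyadic :: "('n::finite \<Rightarrow> bool) \<Rightarrow> int \<Rightarrow> int^'n \<Rightarrow> (real^'n) set" where
  "dyadic t k m = {x. dyadic_index t k x = m}"

definition dyadic_corner :: "('n::finite \<Rightarrow> bool) \<Rightarrow> int \<Rightarrow> int^'n \<Rightarrow> real^'n" where
  "dyadic_corner t k m = (\<chi> i. (m $ i + grid_shift (t i) k) * 2 powr (- k))"

definition grid :: "('n::finite \<Rightarrow> bool) \<Rightarrow> (real^'n) set set" where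
  "grid t = range (\<lambda>(k, m). dyadic t k m)"

lemma countable_grid: "countable (grid t)"
  unfolding grid_def by (rule countable_image) simp

lemma gridE:
  assumes "Q \<in> grid t"
  obtains k m where "Q = dyadic t k m"
  using assms by (auto simp: grid_def)

lemma dyadic_in_grid: "dyadic t k m \<in> grid t"
  by (auto simp: grid_def)

text \<open>The shift of generation k minus twice the shift of generation k - 1 is an integer (0, 1
  or -1). Hence the coarser index is obtained from the finer one by adding that integer and halving,
  without further reference to the point.\<close>

lemma dyadic_index_coarser1:
  assumes "dyadic_index t k x = dyadic_index t k y"
  shows "dyadic_index t (k - 1) x = dyadic_index t (k - 1) y"
proof -
  have "dyadic_index t (k - 1) z $ i = (dyadic_index t k z $ i + (if t i then if even k then 1 else -1 else 0)) div 2"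
    for z i
  proof -
    define e :: int where "e = (if t i then if even k then 1 else -1 else 0)"
    have "2 powr (k - 1) * z $ i - grid_shift (t i) (k - 1)
      = (2 powr k * z $ i - grid_shift (t i) k + of_int e) / of_int 2"
      by (simp add: grid_shift_def e_def powr_diff field_simps)
    then have "\<lfloor>2 powr (k - 1) * z $ i - grid_shift (t i) (k - 1)\<rfloor>
      = \<lfloor>2 powr k * z $ i - grid_shift (t i) k + of_int e\<rfloor> div 2"
      by (metis floor_divide_real_eq_div zero_le_numeral)
    then show ?thesis by (simp add: dyadic_index_def e_def)
  qed
  then show ?thesis using assms by (simp add: vec_eq_iff)
qed

lemma dyadic_index_coarser:
  assumes "dyadic_index t k x = dyadic_index t k y" "j \<le> k"
  shows "dyadic_index t j x = dyadic_index t j y"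
  using assms(2) by (induction j rule: int_le_induct) (rule assms(1), rule dyadic_index_coarser1)

lemma mem_dyadic_iff:
  "x \<in> dyadic t k m \<longleftrightarrow> (\<forall>i. dyadic_corner t k m $ i \<le> x $ i \<and> x $ i < dyadic_corner t k m $ i + 2 powr (- k))"
proof -
  have "\<lfloor>2 powr k * x $ i - grid_shift (t i) k\<rfloor> = m $ i \<longleftrightarrow>
    dyadic_corner t k m $ i \<le> x $ i \<and> x $ i < dyadic_corner t k m $ i + 2 powr (- k)" for i
  proof -
    have "(2::real) powr k > 0" by simp
    then show ?thesis
      by (simp add: floor_eq_iff dyadic_corner_def powr_minus field_simps)
  qed
  then show ?thesis by (simp add: dyadic_def dyadic_index_def vec_eq_iff)
qed

lemma dyadic_nonempty: "dyadic t k m \<noteq> {}"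
proof -
  have "dyadic_corner t k m \<in> dyadic t k m" by (simp add: mem_dyadic_iff)
  then show ?thesis by blast
qed

definition closed_dyadic :: "('n::finite \<Rightarrow> bool) \<Rightarrow> int \<Rightarrow> int^'n \<Rightarrow> (real^'n) set" where
  "closed_dyadic t k m = cbox (dyadic_corner t k m) (\<chi> i. dyadic_corner t k m $ i + 2 powr (- k))"

lemma closed_dyadic_in_cubes: "closed_dyadic t k m \<in> cubes"
  unfolding closed_dyadic_def cubes_def by (rule CollectI, intro exI conjI) (rule refl, simp)

lemma dyadic_subset_closed: "dyadic t k m \<subseteq> closed_dyadic t k m"
  by (auto simp: closed_dyadic_def mem_dyadic_iff mem_box_cart less_imp_le)

lemma dyadic_measurable [measurable]: "dyadic t k m \<in> sets borel"
proof -
  have "dyadic t k m = (\<Inter>i. {x. x $ i \<ge> dyadic_corner t k m $ i} \<inter> {x. x $ i < dyadic_corner t k m $ i + 2 powr (- k)})"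
    by (auto simp: mem_dyadic_iff)
  also have "\<dots> \<in> sets borel"
    by (intro sets.finite_INT sets.Int borel_closed borel_open closed_halfspace_component_ge_cart open_halfspace_component_lt_cart) auto
  finally show ?thesis .
qed

text \<open>Grid cubes are half-open, so that each generation partitions the space, while
  \<open>cubes\<close> are closed. The faces form a null set, so entropy quantities may be evaluated
  at closures of grid cubes.\<close>

lemma AE_dyadic_closed: "AE x in lebesgue. x \<in> dyadic t k m \<longleftrightarrow> x \<in> closed_dyadic t k m"
proof -
  let ?a = "dyadic_corner t k m" and ?b = "\<chi> i. dyadic_corner t k m $ i + 2 powr (- k)"
  have "box ?a ?b \<subseteq> dyadic t k m" by (auto simp: mem_dyadic_iff mem_box_cart less_imp_le)
  then have "{x. \<not> (x \<in> dyadic t k m \<longleftrightarrow> x \<in> closed_dyadic t k m)} \<subseteq> cbox ?a ?b - box ?a ?b"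
    using dyadic_subset_closed[of t k m] by (auto simp: closed_dyadic_def)
  moreover have "cbox ?a ?b - box ?a ?b \<in> null_sets lebesgue"
    using negligible_frontier_interval[of ?a ?b] by (simp add: negligible_iff_null_sets)
  ultimately show ?thesis by (intro AE_I'[of "cbox ?a ?b - box ?a ?b"]) auto
qed

lemma measure_dyadic:
  fixes t :: "'n::finite \<Rightarrow> bool"
  shows "vol (dyadic t k m) = 2 powr (- k * CARD('n))"
    and "emeasure lebesgue (dyadic t k m) = ennreal (2 powr (- k * CARD('n)))"
    and "emeasure lebesgue (closed_dyadic t k m) = ennreal (2 powr (- k * CARD('n)))"
proof -
  have ne: "closed_dyadic t k m \<noteq> {}" using dyadic_nonempty[of t k m] dyadic_subset_closed[of t k m] by blast
  have "vol (closed_dyadic t k m) = (\<Prod>i\<in>(UNIV :: 'n set). 2 powr (- k))"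
    using ne unfolding closed_dyadic_def by (simp add: content_cbox_cart)
  also have "\<dots> = 2 powr (- k * CARD('n))" by (simp add: powr_power mult.commute)
  finally have "vol (closed_dyadic t k m) = 2 powr (- k * CARD('n))" .
  then show c: "emeasure lebesgue (closed_dyadic t k m) = ennreal (2 powr (- k * CARD('n)))"
    unfolding closed_dyadic_def by (subst emeasure_eq_ennreal_measure) (auto simp: emeasure_lborel_cbox_eq)
  have "emeasure lebesgue (dyadic t k m) = emeasure lebesgue (closed_dyadic t k m)"
    using AE_dyadic_closed by (intro emeasure_eq_AE) (auto simp: closed_dyadic_def)
  then show e: "emeasure lebesgue (dyadic t k m) = ennreal (2 powr (- k * CARD('n)))" using c by simp
  then show "vol (dyadic t k m) = 2 powr (- k * CARD('n))" by (simp add: measure_def)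
qed

lemma dyadic_subset_of_meet:
  assumes "j \<le> k" "dyadic t j m \<inter> dyadic t k m' \<noteq> {}"
  shows "dyadic t k m' \<subseteq> dyadic t j m"
proof
  from assms(2) obtain z where z: "dyadic_index t j z = m" "dyadic_index t k z = m'" by (auto simp: dyadic_def)
  fix x assume "x \<in> dyadic t k m'"
  then have "dyadic_index t k x = dyadic_index t k z" using z by (simp add: dyadic_def)
  then show "x \<in> dyadic t j m" using dyadic_index_coarser[OF _ assms(1), of t x z] z by (simp add: dyadic_def)
qed

lemma grid_laminar_family:
  assumes "finite F" "F \<subseteq> grid t"
  shows "laminar_family F"
proof
  show "{} \<notin> F"
    using assms(2) dyadic_nonempty by (metis gridE subsetD)
  fix P Q assume "P \<in> F" "Q \<in> F"
  then obtain j m k m' where PQ: "P = dyadic t j m" "Q = dyadic t k m'"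
    using assms(2) by (meson gridE subsetD)
  show "P \<subseteq> Q \<or> Q \<subseteq> P \<or> P \<inter> Q = {}"
    using dyadic_subset_of_meet[of j k t m m'] dyadic_subset_of_meet[of k j t m' m]
    by (cases "j \<le> k") (auto simp: PQ Int_commute)
qed (rule assms)

lemma grid_level_antichain:
  assumes "F \<subseteq> grid t"
  shows "level_antichain F (vol)"
  unfolding level_antichain_def
proof (intro ballI impI)
  fix P Q assume "P \<in> F" "Q \<in> F" and PQ: "P \<subset> Q"
  then obtain j m k m' where eq: "P = dyadic t j m" "Q = dyadic t k m'"
    using assms by (meson gridE subsetD)
  have "P \<inter> Q \<noteq> {}" using PQ dyadic_nonempty[of t j m] eq by blast
  then have "\<not> j \<le> k" using dyadic_subset_of_meet[of j k t m m'] PQ by (auto simp: eq)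
  moreover have "lv (vol (dyadic t i l)) = - i * CARD('a)" for i l
    unfolding measure_dyadic by (rule lv_eq) auto
  ultimately show "lv (vol P) \<noteq> lv (vol Q)" by (simp add: eq)
qed

text \<open>If an integer N separates u and v, both are within 1/3 of N; a common shift by 1/3 in
  either direction moves them into the same unit interval adjacent to N.\<close>

lemma floor_third:
  fixes u v :: real
  assumes "\<bar>u - v\<bar> < 1 / 3" "\<lfloor>u\<rfloor> \<noteq> \<lfloor>v\<rfloor>" "s = 1 / 3 \<or> s = - (1 / 3)"
  shows "\<lfloor>u - s\<rfloor> = \<lfloor>v - s\<rfloor>"
proof -
  have *: "\<lfloor>u - s\<rfloor> = \<lfloor>v - s\<rfloor>" if "\<bar>u - v\<bar> < 1 / 3" "\<lfloor>u\<rfloor> < \<lfloor>v\<rfloor>" for u v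
  proof -
    have "u < \<lfloor>v\<rfloor>" using that(2) by (simp add: floor_less_iff)
    moreover have "\<lfloor>v\<rfloor> \<le> v" by simp
    ultimately have b: "u < \<lfloor>v\<rfloor>" "\<lfloor>v\<rfloor> \<le> v" "v < u + 1 / 3" using that(1) by linarith+
    from assms(3) show ?thesis
    proof
      assume s: "s = 1 / 3"
      have "\<lfloor>u - s\<rfloor> = \<lfloor>v\<rfloor> - 1" by (rule floor_unique) (use b s in linarith)+
      moreover have "\<lfloor>v - s\<rfloor> = \<lfloor>v\<rfloor> - 1" by (rule floor_unique) (use b s in linarith)+
      ultimately show ?thesis by simp
    next
      assume s: "s = - (1 / 3)"
      have "\<lfloor>u - s\<rfloor> = \<lfloor>v\<rfloor>" by (rule floor_unique) (use b s in linarith)+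
      moreover have "\<lfloor>v - s\<rfloor> = \<lfloor>v\<rfloor>" by (rule floor_unique) (use b s in linarith)+
      ultimately show ?thesis by simp
    qed
  qed
  show ?thesis using *[of u v] *[of v u] assms by (cases "\<lfloor>u\<rfloor> < \<lfloor>v\<rfloor>") (auto simp: abs_minus_commute)
qed

text \<open>The grid is chosen coordinatewise: exactly those coordinates are shifted in which the
  unshifted cells of x and y differ.\<close>

lemma common_dyadic:
  fixes x y :: "real^'n::finite"
  assumes "x \<noteq> y"
  obtains t and k :: int where "dyadic_index t k x = dyadic_index t k y" "2 powr (- k) \<le> 6 * norm (y - x)"
proof -
  define d where "d = infnorm (y - x)"
  have d: "0 < d" using assms by (simp add: d_def infnorm_pos_lt)
  \<comment> \<open>The side 2^(-k) is the least power of 2 above 3 d: the rescaled distance is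
    below 1/3, and the side is at most 6 d, the origin of the constant 6.\<close>
  define k where "k = - (lv (3 * d) + 1)"
  have lo: "3 * d < 2 powr (- k)" and hi: "2 powr (- k) \<le> 6 * d"
    using lv_upper[of "3 * d"] lv_lower[of "3 * d"] d by (auto simp: k_def powr_add)
  define t where "t = (\<lambda>i. \<lfloor>2 powr k * x $ i\<rfloor> \<noteq> \<lfloor>2 powr k * y $ i\<rfloor>)"
  have "dyadic_index t k x $ i = dyadic_index t k y $ i" for i
  proof (cases "t i")
    case True
    have "\<bar>y $ i - x $ i\<bar> \<le> d" using component_le_infnorm_cart[of "y - x" i] by (simp add: d_def)
    then have "2 powr k * \<bar>y $ i - x $ i\<bar> \<le> 2 powr k * d" by simp
    also have "\<dots> < 1 / 3" using lo by (simp add: powr_minus field_simps)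
    also have "2 powr k * \<bar>y $ i - x $ i\<bar> = \<bar>2 powr k * x $ i - 2 powr k * y $ i\<bar>"
      by (simp add: abs_mult right_diff_distrib[symmetric] abs_minus_commute)
    finally show ?thesis
      using True floor_third[of "2 powr k * x $ i" "2 powr k * y $ i" "grid_shift (t i) k"]
      by (auto simp: dyadic_index_def t_def grid_shift_def)
  next
    case False
    then show ?thesis by (simp add: dyadic_index_def t_def grid_shift_def)
  qed
  then have "dyadic_index t k x = dyadic_index t k y" by (simp add: vec_eq_iff)
  moreover have "2 powr (- k) \<le> 6 * norm (y - x)" using hi infnorm_le_norm[of "y - x"] by (simp add: d_def)
  ultimately show ?thesis by (rule that)
qed

text \<open>One term of one grid already suffices, namely the common cube of side at most 6 |y - x|.
  Which grid that is depends on x and y, so all of them are summed.\<close>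

lemma riesz_kernel_le:
  fixes x y :: "real^'n::finite" and \<alpha> :: real
  assumes \<alpha>: "0 < \<alpha>" "\<alpha> < CARD('n)" and xy: "x \<noteq> y"
  shows "ennreal (1 / norm (y - x) powr (CARD('n) - \<alpha>)) \<le> ennreal (6 powr (CARD('n) - \<alpha>)) *
    (\<Sum>t\<in>(UNIV :: ('n \<Rightarrow> bool) set). \<integral>\<^sup>+Q. ennreal (vol Q powr (\<alpha> / CARD('n) - 1))
      * indicator Q x * indicator Q y \<partial>count_space (grid t))"
proof -
  obtain t and k :: int where tk: "dyadic_index t k x = dyadic_index t k y" "2 powr (- k) \<le> 6 * norm (y - x)"
    using common_dyadic[OF xy] .
  define Q where "Q = dyadic t k (dyadic_index t k x)"
  define n where "n = real CARD('n)"
  have Q: "Q \<in> grid t" "x \<in> Q" "y \<in> Q" using tk by (auto simp: Q_def dyadic_def grid_def)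
  have n: "0 < n" by (simp add: n_def)
  let ?F = "\<lambda>t Q. ennreal (vol Q powr (\<alpha> / CARD('n) - 1)) * indicator Q x * indicator Q y"
  have "2 powr (- k) / 6 \<le> norm (y - x)" using tk by simp
  then have "norm (y - x) powr (- (n - \<alpha>)) \<le> (2 powr (- k) / 6) powr (- (n - \<alpha>))"
    using \<alpha> by (intro powr_mono2') (auto simp: n_def)
  also have "\<dots> = 6 powr (n - \<alpha>) * 2 powr (k * (n - \<alpha>))"
  proof -
    have "2 powr (- k) / 6 = (6 * 2 powr k :: real) powr (- 1)" by (simp add: powr_minus field_simps)
    then have "(2 powr (- k) / 6) powr (- (n - \<alpha>)) = (6 * 2 powr k) powr (n - \<alpha>)"
      by (simp only: powr_powr) simp
    then show ?thesis by (simp add: powr_mult powr_powr)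
  qed
  also have "2 powr (k * (n - \<alpha>)) = vol Q powr (\<alpha> / n - 1)"
  proof -
    have "k * (n - \<alpha>) = (- k * n) * (\<alpha> / n - 1)" using n by (simp add: right_diff_distrib algebra_simps)
    then show ?thesis unfolding Q_def measure_dyadic powr_powr by (simp add: n_def)
  qed
  finally have "1 / norm (y - x) powr (n - \<alpha>) \<le> 6 powr (n - \<alpha>) * vol Q powr (\<alpha> / n - 1)"
    by (simp only: powr_minus_divide)
  then have "ennreal (1 / norm (y - x) powr (n - \<alpha>)) \<le> ennreal (6 powr (n - \<alpha>)) * ennreal (vol Q powr (\<alpha> / n - 1))"
    by (simp add: ennreal_mult[symmetric] ennreal_leI)
  also have "ennreal (vol Q powr (\<alpha> / n - 1)) = ?F t Q"
    using Q by (simp add: n_def)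
  also have "?F t Q = (\<integral>\<^sup>+P. ?F t P * indicator {Q} P \<partial>count_space (grid t))"
    using Q(1) by (subst nn_integral_indicator_singleton) auto
  also have "\<dots> \<le> (\<integral>\<^sup>+P. ?F t P \<partial>count_space (grid t))"
    by (intro nn_integral_mono) (auto simp: indicator_def)
  also have "\<dots> \<le> (\<Sum>t\<in>UNIV. \<integral>\<^sup>+P. ?F t P \<partial>count_space (grid t))"
    by (rule member_le_sum) auto
  finally show ?thesis by (simp add: n_def mult_left_mono)
qed

section \<open>Weights and the entropy functional on dyadic cubes\<close>

lemma epowr_ennreal: "0 \<le> x \<Longrightarrow> ennreal x epowr a = ennreal (x powr a)"
  by (simp add: epowr_def)

lemma epowr_top [simp]: "top epowr a = top"
  by (simp add: epowr_def)

lemma epowr_mono: "x \<le> y \<Longrightarrow> 0 \<le> a \<Longrightarrow> x epowr a \<le> y epowr a"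
  by (cases x rule: ennreal_cases; cases y rule: ennreal_cases)
    (auto simp: epowr_ennreal powr_mono2 ennreal_leI top_unique)

lemma epowr_epowr: "(x epowr a) epowr b = x epowr (a * b)"
  by (cases x rule: ennreal_cases) (auto simp: epowr_ennreal powr_powr)

lemma epowr_one: "x epowr 1 = x"
  by (cases x rule: ennreal_cases) (auto simp: epowr_ennreal)

lemma epowr_SUP_le:
  assumes "0 < a"
  shows "(SUP i\<in>I. f i) epowr a \<le> (SUP i\<in>I. f i epowr a)"
proof -
  have "(SUP i\<in>I. f i) \<le> (SUP i\<in>I. f i epowr a) epowr (1 / a)"
  proof (rule SUP_least)
    fix i assume "i \<in> I"
    then have "(f i epowr a) epowr (1 / a) \<le> (SUP i\<in>I. f i epowr a) epowr (1 / a)"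
      using assms by (intro epowr_mono SUP_upper) auto
    then show "f i \<le> (SUP i\<in>I. f i epowr a) epowr (1 / a)"
      using assms by (simp add: epowr_epowr epowr_one)
  qed
  then have "(SUP i\<in>I. f i) epowr a \<le> ((SUP i\<in>I. f i epowr a) epowr (1 / a)) epowr a"
    using assms by (intro epowr_mono) auto
  then show ?thesis using assms by (simp add: epowr_epowr epowr_one)
qed

lemma epowr_measurable [measurable]:
  assumes [measurable]: "f \<in> borel_measurable M"
  shows "(\<lambda>x. f x epowr a) \<in> borel_measurable M"
  unfolding epowr_def by measurable

section \<open>Weights as measures, and the entropy quantities at grid cubes\<close>

abbreviation mass :: "(real^'n::finite \<Rightarrow> real) \<Rightarrow> (real^'n) set \<Rightarrow> real" where
  "mass \<sigma> \<equiv> measure (weight_measure \<sigma>)"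

abbreviation wint :: "(real^'n::finite \<Rightarrow> real) \<Rightarrow> (real^'n \<Rightarrow> real) \<Rightarrow> (real^'n) set \<Rightarrow> real" where
  "wint \<sigma> f \<equiv> measure (density (weight_measure \<sigma>) (\<lambda>x. ennreal (f x)))"

abbreviation Lp_mass :: "real \<Rightarrow> (real^'n::finite \<Rightarrow> real) \<Rightarrow> (real^'n \<Rightarrow> real) \<Rightarrow> ennreal" where
  "Lp_mass p \<sigma> f \<equiv> \<integral>\<^sup>+x. ennreal (f x powr p) \<partial>weight_measure \<sigma>"

text \<open>This is s_Q, equivalently |Q|^(\<alpha>/n) times the \<sigma>-average over Q, the base
  of the power in the entropy constant.\<close>

abbreviation frac_mass where
  "frac_mass \<alpha> \<sigma> Q \<equiv> vol (Q :: (real^'n::finite) set) powr (\<alpha> / real CARD('n) - 1) * mass \<sigma> Q"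

abbreviation dyadic_form where
  "dyadic_form \<alpha> \<sigma> w F f g \<equiv>
    (\<Sum>Q\<in>F. vol (Q :: (real^'n::finite) set) powr (\<alpha> / real CARD('n) - 1) * wint \<sigma> f Q * wint w g Q)"

abbreviation local_max :: "real \<Rightarrow> (real^'n::finite \<Rightarrow> real) \<Rightarrow> (real^'n) set \<Rightarrow> real^'n \<Rightarrow> ennreal" where
  "local_max \<alpha> \<sigma> R \<equiv> frac_max \<alpha> (\<lambda>y. indicator (closure R) y * \<sigma> y)"

lemma weight_nonneg: "weight \<sigma> \<Longrightarrow> 0 \<le> \<sigma> x"
  by (simp add: weight_def)

text \<open>Global measurability is implicit in local integrability: \<sigma> is the pointwise limit
  of its restrictions to balls.\<close>

lemma weight_measurable:
  fixes \<sigma> :: "real^'n \<Rightarrow> real"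
  assumes "weight \<sigma>"
  shows "\<sigma> \<in> borel_measurable lebesgue"
proof (rule borel_measurable_LIMSEQ_real)
  show "(\<lambda>x. indicator (cball 0 (real i)) x *\<^sub>R \<sigma> x) \<in> borel_measurable lebesgue" for i
    using assms unfolding weight_def set_integrable_def by (intro borel_measurable_integrable) auto
  fix x :: "real^'n"
  obtain N where N: "norm x \<le> real N" using real_arch_simple by blast
  have "\<forall>\<^sub>F i in sequentially. indicator (cball 0 (real i)) x *\<^sub>R \<sigma> x = \<sigma> x"
    using eventually_ge_at_top[of N] by eventually_elim (use N in auto)
  then show "(\<lambda>i. indicator (cball 0 (real i)) x *\<^sub>R \<sigma> x) \<longlonglongrightarrow> \<sigma> x"
    by (rule tendsto_eventually)
qed

lemma sets_weight_measure [simp, measurable_cong]: "sets (weight_measure \<sigma>) = sets lebesgue"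
  by (simp add: weight_measure_def)

lemma space_weight_measure [simp]: "space (weight_measure \<sigma>) = UNIV"
  by (simp add: weight_measure_def)

lemma measurable_weight_measure: "measurable (weight_measure \<sigma>) N = measurable lebesgue N"
  by (rule measurable_cong_sets[OF sets_weight_measure refl])

lemma weight_measure_compact_finite:
  assumes "weight \<sigma>" "compact K"
  shows "emeasure (weight_measure \<sigma>) K < \<infinity>"
proof -
  have K: "K \<in> sets lebesgue" using assms(2) by (simp add: borel_compact)
  have [measurable]: "\<sigma> \<in> borel_measurable lebesgue" by (rule weight_measurable[OF assms(1)])
  have int: "integrable lebesgue (\<lambda>x. indicator K x *\<^sub>R \<sigma> x)"
    using assms by (simp add: weight_def set_integrable_def)
  have "emeasure (weight_measure \<sigma>) K = (\<integral>\<^sup>+x. ennreal (indicator K x *\<^sub>R \<sigma> x) \<partial>lebesgue)"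
    unfolding weight_measure_def using K
    by (subst emeasure_density) (auto intro!: nn_integral_cong simp: indicator_def)
  also have "\<dots> = ennreal (LINT x|lebesgue. indicator K x *\<^sub>R \<sigma> x)"
    using int weight_nonneg[OF assms(1)] by (intro nn_integral_eq_integral) auto
  finally show ?thesis by simp
qed

lemma closure_dyadic: "closure (dyadic t k m) = closed_dyadic t k m"
proof -
  let ?a = "dyadic_corner t k m" and ?b = "\<chi> i. dyadic_corner t k m $ i + 2 powr (- k)"
  have "box ?a ?b \<subseteq> dyadic t k m" by (auto simp: mem_dyadic_iff mem_box_cart less_imp_le)
  then have "closure (box ?a ?b) \<subseteq> closure (dyadic t k m)" by (rule closure_mono)
  moreover have "closure (box ?a ?b) = cbox ?a ?b"
    by (rule closure_box) (simp add: interval_ne_empty_cart)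
  ultimately have "closed_dyadic t k m \<subseteq> closure (dyadic t k m)"
    by (simp add: closed_dyadic_def)
  moreover have "closure (dyadic t k m) \<subseteq> closed_dyadic t k m"
    using dyadic_subset_closed by (rule closure_minimal) (simp only: closed_dyadic_def closed_cbox)
  ultimately show ?thesis by blast
qed

lemma grid_facts:
  assumes "Q \<in> grid t"
  shows grid_sets: "Q \<in> sets lebesgue"
    and closure_grid_cubes: "closure Q \<in> cubes"
    and AE_grid_closure: "AE x in lebesgue. x \<in> Q \<longleftrightarrow> x \<in> closure Q"
    and compact_closure_grid: "compact (closure Q)"
    and measure_grid_pos: "0 < vol Q"
    and emeasure_grid: "emeasure lebesgue Q = ennreal (vol Q)"
    and emeasure_closure_grid: "emeasure lebesgue (closure Q) = ennreal (vol Q)"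
proof -
  from assms obtain k m where Q: "Q = dyadic t k m" by (rule gridE)
  show "Q \<in> sets lebesgue" by (simp add: Q)
  show "closure Q \<in> cubes" by (simp add: Q closure_dyadic closed_dyadic_in_cubes)
  show "AE x in lebesgue. x \<in> Q \<longleftrightarrow> x \<in> closure Q" unfolding Q closure_dyadic by (rule AE_dyadic_closed)
  show "compact (closure Q)" unfolding Q closure_dyadic closed_dyadic_def by (rule compact_cbox)
  show "0 < vol Q" "emeasure lebesgue Q = ennreal (vol Q)"
    "emeasure lebesgue (closure Q) = ennreal (vol Q)"
    unfolding Q closure_dyadic measure_dyadic by simp_all
qed

lemma weight_measure_grid:
  assumes "weight \<sigma>" "Q \<in> grid t"
  shows emeasure_weight_closure: "emeasure (weight_measure \<sigma>) (closure Q) = emeasure (weight_measure \<sigma>) Q"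
    and emeasure_weight_grid: "emeasure (weight_measure \<sigma>) Q = ennreal (mass \<sigma> Q)"
proof -
  have [measurable]: "\<sigma> \<in> borel_measurable lebesgue" by (rule weight_measurable[OF assms(1)])
  show c: "emeasure (weight_measure \<sigma>) (closure Q) = emeasure (weight_measure \<sigma>) Q"
    unfolding weight_measure_def using AE_grid_closure[OF assms(2)] grid_sets[OF assms(2)]
    by (subst (1 2) emeasure_density) (auto intro!: nn_integral_cong_AE simp: indicator_def elim!: eventually_mono)
  have "emeasure (weight_measure \<sigma>) Q < \<infinity>"
    unfolding c[symmetric] by (rule weight_measure_compact_finite[OF assms(1) compact_closure_grid[OF assms(2)]])
  then show "emeasure (weight_measure \<sigma>) Q = ennreal (mass \<sigma> Q)"
    by (intro emeasure_eq_ennreal_measure) auto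
qed

text \<open>The closure of P is one of the cubes competing in the supremum, and on it the indicator
  of the closure of R is 1.\<close>

lemma frac_max_ge:
  fixes t :: "'n::finite \<Rightarrow> bool"
  assumes \<sigma>: "weight \<sigma>" and P: "P \<in> grid t" and x: "x \<in> P" and PR: "P \<subseteq> R"
  shows "ennreal (frac_mass \<alpha> \<sigma> P)
    \<le> local_max \<alpha> \<sigma> R x"
proof -
  have [measurable]: "\<sigma> \<in> borel_measurable lebesgue" by (rule weight_measurable[OF \<sigma>])
  have cP: "closure P \<in> cubes" "x \<in> closure P" using closure_grid_cubes[OF P] x closure_subset by auto
  have Pc: "P \<subseteq> closure P" "P \<subseteq> closure R" using PR closure_subset by blast+
  have L: "0 < vol P" by (rule measure_grid_pos[OF P])
  have "ennreal (frac_mass \<alpha> \<sigma> P)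
    = ennreal (vol P powr (\<alpha> / CARD('n) - 1)) * emeasure (weight_measure \<sigma>) P"
    by (simp add: ennreal_mult emeasure_weight_grid[OF \<sigma> P])
  also have "ennreal (vol P powr (\<alpha> / CARD('n) - 1))
    = indicator (closure P) x / (emeasure lebesgue (closure P) epowr (1 - \<alpha> / CARD('n)))"
  proof -
    have "1 / ennreal (vol P powr (1 - \<alpha> / CARD('n))) = ennreal (1 / vol P powr (1 - \<alpha> / CARD('n)))"
      using L divide_ennreal[of 1 "vol P powr (1 - \<alpha> / CARD('n))"] by simp
    also have "1 / vol P powr (1 - \<alpha> / CARD('n)) = vol P powr (\<alpha> / CARD('n) - 1)"
      using L by (simp add: powr_minus_divide[symmetric])
    finally show ?thesis using cP L by (simp add: emeasure_closure_grid[OF P] epowr_ennreal)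
  qed
  also have "emeasure (weight_measure \<sigma>) P \<le> (\<integral>\<^sup>+y\<in>closure P. ennreal \<bar>indicator (closure R) y * \<sigma> y\<bar> \<partial>lebesgue)"
    unfolding weight_measure_def using grid_sets[OF P] Pc weight_nonneg[OF \<sigma>]
    by (subst emeasure_density) (auto intro!: nn_integral_mono simp: indicator_def)
  finally show ?thesis
    unfolding frac_max_def by (intro SUP_upper2[OF cP(1)]) (simp add: mult_left_mono)
qed

text \<open>On R the maximal function is at least s_R > 0, and R has positive volume. Positivity
  matters because \<epsilon> is controlled only on positive arguments, and \<open>lv\<close>
  brackets only positive numbers.\<close>

lemma rho_pos:
  fixes t :: "'n::finite \<Rightarrow> bool"
  assumes \<sigma>: "weight \<sigma>" and R: "R \<in> grid t" and pos: "0 < mass \<sigma> R" and r: "0 \<le> q / p"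
    and fin: "rho \<alpha> p q \<sigma> (closure R) \<noteq> \<infinity>"
  shows "0 < enn2real (rho \<alpha> p q \<sigma> (closure R))"
    and "(\<integral>\<^sup>+x\<in>closure R. (local_max \<alpha> \<sigma> R x epowr (q / p)) \<partial>lebesgue)
      = ennreal (enn2real (rho \<alpha> p q \<sigma> (closure R)) * mass \<sigma> R powr (q / p))"
proof -
  define I where "I = (\<integral>\<^sup>+x\<in>closure R. (local_max \<alpha> \<sigma> R x epowr (q / p)) \<partial>lebesgue)"
  define v where "v = mass \<sigma> R powr (q / p)"
  define s where "s = frac_mass \<alpha> \<sigma> R"
  have v: "0 < v" using pos by (simp add: v_def)
  have s: "0 < s" using measure_grid_pos[OF R] pos by (simp add: s_def)
  have rho: "rho \<alpha> p q \<sigma> (closure R) = I / ennreal v"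
    by (simp add: rho_def I_def v_def emeasure_weight_closure[OF \<sigma> R] emeasure_weight_grid[OF \<sigma> R] epowr_ennreal)
  have "I = (I / ennreal v) * ennreal v" using v by (simp add: ennreal_divide_times ennreal_mult_divide_eq)
  then have I: "I = ennreal (enn2real (I / ennreal v) * v)"
    using fin v unfolding rho by (simp add: ennreal_mult less_top[symmetric])
  then show "(\<integral>\<^sup>+x\<in>closure R. (local_max \<alpha> \<sigma> R x epowr (q / p)) \<partial>lebesgue)
      = ennreal (enn2real (rho \<alpha> p q \<sigma> (closure R)) * mass \<sigma> R powr (q / p))"
    by (simp add: I_def[symmetric] v_def[symmetric] rho)
  have "0 < ennreal (s powr (q / p)) * emeasure lebesgue R"
    using s measure_grid_pos[OF R] by (simp add: emeasure_grid[OF R] ennreal_zero_less_mult_iff)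
  also have "\<dots> = (\<integral>\<^sup>+x. ennreal (s powr (q / p)) * indicator R x \<partial>lebesgue)"
    using grid_sets[OF R] by (rule nn_integral_cmult_indicator[symmetric])
  also have "\<dots> \<le> I"
    unfolding I_def
  proof (rule nn_integral_mono)
    fix x
    show "ennreal (s powr (q / p)) * indicator R x
      \<le> local_max \<alpha> \<sigma> R x epowr (q / p) * indicator (closure R) x"
    proof (cases "x \<in> R")
      case True
      then have "ennreal s epowr (q / p) \<le> local_max \<alpha> \<sigma> R x epowr (q / p)"
        using frac_max_ge[OF \<sigma> R True order_refl, of \<alpha>] r by (intro epowr_mono) (auto simp: s_def)
      then show ?thesis using True s closure_subset[of R] by (simp add: epowr_ennreal subset_iff)
    qed simp
  qed
  finally have "0 < I" .
  then show "0 < enn2real (rho \<alpha> p q \<sigma> (closure R))"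
    using I v unfolding rho by (metis ennreal_0 enn2real_nonneg less_eq_real_def mult_zero_left order_less_irrefl)
qed

text \<open>For Q below R, s_Q is a lower bound on Q for M_\<alpha>(1_R \<sigma>). Packing turns the
  sum into an integral of the power of this function over R, which is the numerator of
  \<rho>.\<close>

lemma local_rho_bound:
  fixes t :: "'n::finite \<Rightarrow> bool"
  assumes \<sigma>: "weight \<sigma>" and D: "finite D" "D \<subseteq> grid t" and R: "R \<in> D" and r: "0 \<le> q / p" and \<Lambda>: "0 \<le> \<Lambda>"
    and pack: "\<And>P. P \<in> D \<Longrightarrow> (\<Sum>Q\<in>below D P. vol Q) \<le> \<Lambda> * vol P"
    and pos: "0 < mass \<sigma> R"
    and fin: "rho \<alpha> p q \<sigma> (closure R) \<noteq> \<infinity>"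
  shows "(\<Sum>Q\<in>below D R. (frac_mass \<alpha> \<sigma> Q) powr (q / p)
      * vol Q)
    \<le> \<Lambda> * enn2real (rho \<alpha> p q \<sigma> (closure R)) * mass \<sigma> R powr (q / p)"
proof -
  interpret laminar_family D by (rule grid_laminar_family[OF D])
  define E where "E = below D R"
  have E: "finite E" "E \<subseteq> D" using D by (auto simp: E_def)
  have gr: "Q \<in> grid t" if "Q \<in> D" for Q using that D by auto
  have grL: "Q \<in> sets lebesgue" "emeasure lebesgue Q \<noteq> \<infinity>" "0 < vol Q" if "Q \<in> D" for Q
    using grid_sets[OF gr[OF that]] emeasure_grid[OF gr[OF that]] measure_grid_pos[OF gr[OF that]] by auto
  have Lf: "superadditive D (vol)"
    by (rule superadditive_measure[OF D(1)]) (use grL in auto)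
  have "ennreal (\<Sum>Q\<in>E. (frac_mass \<alpha> \<sigma> Q) powr (q / p) * vol Q)
    \<le> ennreal \<Lambda> * (\<integral>\<^sup>+x\<in>closure R. (local_max \<alpha> \<sigma> R x epowr (q / p)) \<partial>lebesgue)"
  proof (rule sum_le_packing_nn_integral[OF E(1) _ \<Lambda>])
    show "E \<subseteq> sets lebesgue" using E grL by blast
    show "emeasure lebesgue Q \<noteq> \<infinity>" if "Q \<in> E" for Q using that E grL by blast
    show "\<Union>E \<subseteq> closure R" using closure_subset[of R] by (auto simp: E_def)
    \<comment> \<open>The maximal cubes of A are disjoint, so the sum of their volumes is the volume
      of their union.\<close>
    show "sum (vol) A \<le> \<Lambda> * vol (\<Union>A)" if A: "A \<subseteq> E" for A
    proof -
      have AD: "A \<subseteq> D" using A E by blast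
      have finA: "finite A" using A E(1) by (rule finite_subset)
      have M: "finite (maxs A)" "maxs A \<subseteq> A" using finA by (auto simp: maxs_def)
      have fm: "Q \<in> fmeasurable lebesgue" if "Q \<in> A" for Q
        using grL[of Q] that AD by (auto simp: fmeasurable_def less_top)
      have "sum (vol) A \<le> \<Lambda> * sum (vol) (maxs A)"
        by (rule packing_maxs[OF Lf pack AD])
      also have "sum (vol) (maxs A) = vol (\<Union>(maxs A))"
        using M fm maxs_disjoint[OF AD] by (intro measure_Union'[symmetric]) auto
      also have "\<dots> \<le> vol (\<Union>A)"
        using M fm finA by (intro measure_mono_fmeasurable fmeasurable.finite_Union) (auto intro!: sets.finite_Union)
      finally show ?thesis using \<Lambda> by (simp add: mult_left_mono)
    qed
    fix Q x assume Q: "Q \<in> E" "x \<in> Q"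
    have "ennreal (frac_mass \<alpha> \<sigma> Q) epowr (q / p)
      \<le> local_max \<alpha> \<sigma> R x epowr (q / p)"
      using Q E gr r by (intro epowr_mono frac_max_ge[OF \<sigma>]) (auto simp: E_def)
    then show "ennreal ((frac_mass \<alpha> \<sigma> Q) powr (q / p))
      \<le> local_max \<alpha> \<sigma> R x epowr (q / p)"
      by (simp add: epowr_ennreal)
  qed simp
  also have "\<dots> = ennreal (\<Lambda> * enn2real (rho \<alpha> p q \<sigma> (closure R)) * mass \<sigma> R powr (q / p))"
    unfolding rho_pos(2)[OF \<sigma> gr[OF R] pos r fin] using \<Lambda> by (simp add: ennreal_mult[symmetric] mult.assoc)
  finally show ?thesis using \<Lambda> by (simp add: E_def)
qed

text \<open>Both claims are read off from the term of the supremum at the closure of Q. An infinite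
  \<rho> would make that term infinite by convention, so it is excluded by the finite bound
  K.\<close>

lemma entropy_bump_grid:
  fixes t :: "'n::finite \<Rightarrow> bool"
  assumes \<sigma>: "weight \<sigma>" and w: "weight w" and Q: "Q \<in> grid t" and r: "0 \<le> q / p"
    and pos: "0 < mass \<sigma> Q" "0 < mass w Q"
    and K: "entropy_bump \<alpha> p q \<epsilon> \<sigma> w \<le> ennreal K" "0 \<le> K"
  shows "rho \<alpha> p q \<sigma> (closure Q) \<noteq> \<infinity>"
    and "(frac_mass \<alpha> \<sigma> Q) powr (q / conj_exp p)
      * (mass w Q / vol Q) * enn2real (rho \<alpha> p q \<sigma> (closure Q))
      * \<epsilon> (enn2real (rho \<alpha> p q \<sigma> (closure Q))) \<le> K"
proof -
  let ?L = "vol Q" and ?s = "mass \<sigma> Q" and ?w = "mass w Q"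
  define \<rho> where "\<rho> = rho \<alpha> p q \<sigma> (closure Q)"
  have L: "0 < ?L" by (rule measure_grid_pos[OF Q])
  note em = emeasure_closure_grid[OF Q] emeasure_weight_closure[OF \<sigma> Q] emeasure_weight_closure[OF w Q]
    emeasure_weight_grid[OF \<sigma> Q] emeasure_weight_grid[OF w Q]
  have le: "(if \<rho> = \<infinity> then \<infinity>
      else ((emeasure lebesgue (closure Q) epowr (\<alpha> / real CARD('n))) * average \<sigma> (closure Q)) epowr (q / conj_exp p)
             * average w (closure Q) * \<rho> * ennreal (\<epsilon> (enn2real \<rho>))) \<le> ennreal K"
    using order_trans[OF SUP_upper[OF closure_grid_cubes[OF Q]] K(1)[unfolded entropy_bump_def]] pos
    by (auto simp: em \<rho>_def split: if_splits)
  show fin: "rho \<alpha> p q \<sigma> (closure Q) \<noteq> \<infinity>" using le by (auto simp: \<rho>_def top_unique)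
  have \<rho>: "\<rho> = ennreal (enn2real \<rho>)" using fin by (simp add: \<rho>_def less_top[symmetric])
  have av: "average \<sigma> (closure Q) = ennreal (?s / ?L)" "average w (closure Q) = ennreal (?w / ?L)"
    using L by (simp_all add: average_def em divide_ennreal)
  have "(emeasure lebesgue (closure Q) epowr (\<alpha> / real CARD('n))) * average \<sigma> (closure Q) = ennreal (?L powr (\<alpha> / CARD('n) - 1) * ?s)"
    using L by (simp add: av em epowr_ennreal ennreal_mult[symmetric] powr_diff)
  then have "ennreal ((?L powr (\<alpha> / CARD('n) - 1) * ?s) powr (q / conj_exp p)) * ennreal (?w / ?L) * ennreal (enn2real \<rho>) * ennreal (\<epsilon> (enn2real \<rho>)) \<le> ennreal K"
    using le fin \<rho> by (simp add: av epowr_ennreal \<rho>_def[symmetric])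
  then have "ennreal ((?L powr (\<alpha> / CARD('n) - 1) * ?s) powr (q / conj_exp p) * (?w / ?L) * enn2real \<rho> * \<epsilon> (enn2real \<rho>)) \<le> ennreal K"
    by (simp add: ennreal_mult'[symmetric])
  then show "(?L powr (\<alpha> / CARD('n) - 1) * ?s) powr (q / conj_exp p) * (?w / ?L) * enn2real (rho \<alpha> p q \<sigma> (closure Q))
      * \<epsilon> (enn2real (rho \<alpha> p q \<sigma> (closure Q))) \<le> K"
    using K(2) by (simp add: \<rho>_def)
qed

text \<open>Since f <= 1 + f^p, f is \<sigma>-integrable over Q and the real-valued
  \<open>measure\<close> loses nothing. The last claim lets cubes without mass be discarded together
  with those where the integral of f vanishes.\<close>

lemma weighted_hat:
  fixes f :: "real^'n::finite \<Rightarrow> real"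
  assumes \<sigma>: "weight \<sigma>" and Q: "Q \<in> grid t" and f: "f \<in> borel_measurable lebesgue" "\<And>x. 0 \<le> f x"
    and p: "1 \<le> p" and \<Phi>: "Lp_mass p \<sigma> f < \<infinity>"
  shows hat_eq: "ennreal (wint \<sigma> f Q) = (\<integral>\<^sup>+x\<in>Q. ennreal (f x) \<partial>weight_measure \<sigma>)"
    and hat_emeasure: "emeasure (density (weight_measure \<sigma>) f) Q = ennreal (wint \<sigma> f Q)"
    and hat_pos: "0 < wint \<sigma> f Q \<Longrightarrow> 0 < mass \<sigma> Q"
proof -
  have [measurable]: "f \<in> borel_measurable (weight_measure \<sigma>)"
    using f(1) by (simp add: measurable_weight_measure)
  have Qs [measurable]: "Q \<in> sets (weight_measure \<sigma>)" using grid_sets[OF Q] by simp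
  have e: "emeasure (density (weight_measure \<sigma>) f) Q = (\<integral>\<^sup>+x\<in>Q. ennreal (f x) \<partial>weight_measure \<sigma>)"
    by (rule emeasure_density) measurable
  also have "\<dots> \<le> (\<integral>\<^sup>+x. indicator Q x + ennreal (f x powr p) \<partial>weight_measure \<sigma>)"
  proof (rule nn_integral_mono)
    fix x
    have "f x \<le> 1 + f x powr p"
    proof (cases "f x \<le> 1")
      case False
      then have "f x powr 1 \<le> f x powr p" using p by (intro powr_mono) auto
      then show ?thesis using False by simp
    qed (simp add: add_increasing2)
    then have "ennreal (f x) \<le> 1 + ennreal (f x powr p)"
      by (metis ennreal_1 ennreal_leI ennreal_plus powr_ge_zero zero_le_one)
    then show "ennreal (f x) * indicator Q x \<le> indicator Q x + ennreal (f x powr p)"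
      by (auto simp: indicator_def)
  qed
  also have "\<dots> = emeasure (weight_measure \<sigma>) Q + Lp_mass p \<sigma> f"
    by (subst nn_integral_add) (use grid_sets[OF Q] in auto)
  also have "\<dots> < \<infinity>" using \<Phi> emeasure_weight_grid[OF \<sigma> Q] by (simp add: less_top[symmetric])
  finally have fin: "emeasure (density (weight_measure \<sigma>) f) Q < \<infinity>" .
  then show m: "emeasure (density (weight_measure \<sigma>) f) Q = ennreal (wint \<sigma> f Q)"
    by (intro emeasure_eq_ennreal_measure) auto
  show "ennreal (wint \<sigma> f Q) = (\<integral>\<^sup>+x\<in>Q. ennreal (f x) \<partial>weight_measure \<sigma>)"
    using e m by simp
  show "0 < mass \<sigma> Q" if "0 < wint \<sigma> f Q"
  proof (rule ccontr)
    assume "\<not> ?thesis"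
    then have "mass \<sigma> Q = 0" by (simp add: not_less measure_le_0_iff)
    then have "Q \<in> null_sets (weight_measure \<sigma>)" using emeasure_weight_grid[OF \<sigma> Q] Qs by (simp add: null_sets_def)
    then have "(\<integral>\<^sup>+x\<in>Q. ennreal (f x) \<partial>weight_measure \<sigma>) = 0"
      by (rule nn_integral_null_set)
    then show False using that e m by simp
  qed
qed

text \<open>The constant of \<open>form_bound\<close> with \<Lambda> = 2 * geo 1, times those of
  \<open>carleson_embedding\<close> for f and g to the powers 1/p and 1/q'.\<close>

definition form_const :: "real \<Rightarrow> real \<Rightarrow> real \<Rightarrow> real \<Rightarrow> real \<Rightarrow> real" where
  "form_const \<beta> p q N\<^sub>1 N\<^sub>2 = 2 * 2 powr \<beta> * geo \<beta> *
     (one_sided_const q (q / conj_exp p) (2 * geo 1) N\<^sub>1 + one_sided_const (conj_exp p) (conj_exp p / q) (2 * geo 1) N\<^sub>2)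
     * (2 powr (2 * p - 1) * geo (p - 1)) powr (1 / p)
     * (2 powr (2 * conj_exp q - 1) * geo (conj_exp q - 1)) powr (1 / conj_exp q)"

lemma form_const_nonneg:
  assumes "0 < \<beta>" "1 < p" "p \<le> q" "0 \<le> N\<^sub>1" "0 \<le> N\<^sub>2"
  shows "0 \<le> form_const \<beta> p q N\<^sub>1 N\<^sub>2"
proof -
  have "1 < q" using assms by simp
  note c = conj_exp_gt_1[OF assms(2)] conj_exp_gt_1[OF this]
  have "0 < geo \<beta>" "0 < geo 1" "0 < geo (1 / q)" "0 < geo (1 / conj_exp p)"
    "0 < geo (min 1 (q / conj_exp p))" "0 < geo (min 1 (conj_exp p / q))"
    using assms c by (auto intro!: geo_pos)
  then show ?thesis using assms by (simp add: form_const_def one_sided_const_def)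
qed

lemma weighted_form_bound:
  fixes f g :: "real^'n::finite \<Rightarrow> real" and \<alpha> p q K\<^sub>1 K\<^sub>2 N\<^sub>1 N\<^sub>2 \<Phi> \<Gamma> :: real and e\<^sub>1 e\<^sub>2 :: "int \<Rightarrow> real"
  assumes \<alpha>: "0 < \<alpha>" and pq: "1 < p" "p \<le> q" and \<sigma>: "weight \<sigma>" and w: "weight w"
    and e: "\<And>a. 0 < e\<^sub>1 a" "\<And>a. 0 < e\<^sub>2 a"
    and e_le: "\<And>s. 0 < s \<Longrightarrow> e\<^sub>1 (lv s) \<le> \<epsilon>\<^sub>1 s" "\<And>s. 0 < s \<Longrightarrow> e\<^sub>2 (lv s) \<le> \<epsilon>\<^sub>2 s"
    and N\<^sub>1: "\<And>I. finite I \<Longrightarrow> (\<Sum>a\<in>I. e\<^sub>1 a powr (- (1 / q))) \<le> N\<^sub>1"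
    and N\<^sub>2: "\<And>I. finite I \<Longrightarrow> (\<Sum>a\<in>I. e\<^sub>2 a powr (- (1 / conj_exp p))) \<le> N\<^sub>2"
    and K\<^sub>1: "entropy_bump \<alpha> p q \<epsilon>\<^sub>1 \<sigma> w \<le> ennreal K\<^sub>1" "0 \<le> K\<^sub>1"
    and K\<^sub>2: "entropy_bump \<alpha> (conj_exp q) (conj_exp p) \<epsilon>\<^sub>2 w \<sigma> \<le> ennreal K\<^sub>2" "0 \<le> K\<^sub>2"
    and F: "finite F" "F \<subseteq> grid t"
    and f: "f \<in> borel_measurable lebesgue" "\<And>x. 0 \<le> f x"
    and g: "g \<in> borel_measurable lebesgue" "\<And>x. 0 \<le> g x"
    and \<Phi>: "Lp_mass p \<sigma> f \<le> ennreal \<Phi>" "0 \<le> \<Phi>"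
    and \<Gamma>: "Lp_mass (conj_exp q) w g \<le> ennreal \<Gamma>" "0 \<le> \<Gamma>"
  shows "dyadic_form \<alpha> \<sigma> w F f g
    \<le> form_const (\<alpha> / CARD('n)) p q N\<^sub>1 N\<^sub>2 * (K\<^sub>1 powr (1 / q) + K\<^sub>2 powr (1 / conj_exp p))
      * \<Phi> powr (1 / p) * \<Gamma> powr (1 / conj_exp q)"
proof -
  define \<beta> where "\<beta> = \<alpha> / CARD('n)"
  define L where "L = (\<lambda>Q :: (real^'n) set. vol Q)"
  define S where "S = mass \<sigma>"
  define W where "W = mass w"
  define fh where "fh = wint \<sigma> f"
  define gh where "gh = wint w g"
  let ?r = "\<lambda>Q. enn2real (rho \<alpha> p q \<sigma> (closure Q))"
  let ?r' = "\<lambda>Q. enn2real (rho \<alpha> (conj_exp q) (conj_exp p) w (closure Q))"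
  let ?s = "\<lambda>Q. L Q powr (\<beta> - 1) * S Q"
  let ?s' = "\<lambda>Q. L Q powr (\<beta> - 1) * W Q"
  let ?x = "\<lambda>Q. ?s Q powr (q / conj_exp p) * (W Q / L Q) * ?r Q"
  let ?x' = "\<lambda>Q. ?s' Q powr (conj_exp p / q) * (S Q / L Q) * ?r' Q"
  \<comment> \<open>The discarded terms are 0. On F' all five set functions are positive, as
    \<open>superadditive\<close> demands.\<close>
  define F' where "F' = {Q\<in>F. 0 < fh Q \<and> 0 < gh Q}"
  have \<beta>: "0 < \<beta>" using \<alpha> by (simp add: \<beta>_def)
  have q: "1 < q" using pq by simp
  note c = conj_exp_gt_1[OF pq(1)] conj_exp_gt_1[OF q] conj_exp_antimono[OF pq] conj_exp_conj[OF pq(1)] conj_exp_conj[OF q]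
  have fin: "Lp_mass p \<sigma> f < \<infinity>"
    "Lp_mass (conj_exp q) w g < \<infinity>"
    using \<Phi>(1) \<Gamma>(1) le_less_trans ennreal_less_top by (metis infinity_ennreal_def)+
  have F': "finite F'" "F' \<subseteq> grid t" using F by (auto simp: F'_def)
  have gr: "Q \<in> grid t" if "Q \<in> F'" for Q using that F' by auto
  have fF: "ennreal (fh Q) = (\<integral>\<^sup>+x\<in>Q. ennreal (f x) \<partial>weight_measure \<sigma>)"
    "emeasure (density (weight_measure \<sigma>) f) Q \<noteq> \<infinity>" "0 < fh Q" "0 < S Q" if "Q \<in> F'" for Q
    using weighted_hat[OF \<sigma> gr[OF that] f _ fin(1)] that pq(1) by (auto simp: fh_def F'_def S_def)
  have gF: "ennreal (gh Q) = (\<integral>\<^sup>+x\<in>Q. ennreal (g x) \<partial>weight_measure w)"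
    "emeasure (density (weight_measure w) g) Q \<noteq> \<infinity>" "0 < gh Q" "0 < W Q" if "Q \<in> F'" for Q
    using weighted_hat[OF w gr[OF that] g _ fin(2)] that c(2) by (auto simp: gh_def F'_def W_def)
  have bumps: "rho \<alpha> p q \<sigma> (closure Q) \<noteq> \<infinity>"
      "?x Q
        * \<epsilon>\<^sub>1 (?r Q) \<le> K\<^sub>1"
      "0 < ?r Q"
      "rho \<alpha> (conj_exp q) (conj_exp p) w (closure Q) \<noteq> \<infinity>"
      "?x' Q
        * \<epsilon>\<^sub>2 (?r' Q) \<le> K\<^sub>2"
      "0 < ?r' Q"
    if Q: "Q \<in> F'" for Q
  proof -
    have r: "0 \<le> q / p" "0 \<le> conj_exp p / conj_exp q" using pq c by auto
    note pos = fF(4)[OF Q, unfolded S_def] gF(4)[OF Q, unfolded W_def]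
    show 1: "rho \<alpha> p q \<sigma> (closure Q) \<noteq> \<infinity>"
      by (rule entropy_bump_grid(1)[OF \<sigma> w gr[OF Q] r(1) pos K\<^sub>1])
    show 2: "rho \<alpha> (conj_exp q) (conj_exp p) w (closure Q) \<noteq> \<infinity>"
      by (rule entropy_bump_grid(1)[OF w \<sigma> gr[OF Q] r(2) pos(2,1) K\<^sub>2])
    show "?x Q
        * \<epsilon>\<^sub>1 (?r Q) \<le> K\<^sub>1"
      using entropy_bump_grid(2)[OF \<sigma> w gr[OF Q] r(1) pos K\<^sub>1] by (simp add: L_def S_def W_def \<beta>_def)
    show "?x' Q
        * \<epsilon>\<^sub>2 (?r' Q) \<le> K\<^sub>2"
      using entropy_bump_grid(2)[OF w \<sigma> gr[OF Q] r(2) pos(2,1) K\<^sub>2] by (simp add: L_def S_def W_def \<beta>_def c)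
    show "0 < ?r Q" by (rule rho_pos(1)[OF \<sigma> gr[OF Q] pos(1) r(1) 1])
    show "0 < ?r' Q"
      by (rule rho_pos(1)[OF w gr[OF Q] pos(2) r(2) 2])
  qed
  let ?B = "form_const \<beta> p q N\<^sub>1 N\<^sub>2 * (K\<^sub>1 powr (1 / q) + K\<^sub>2 powr (1 / conj_exp p)) * \<Phi> powr (1 / p) * \<Gamma> powr (1 / conj_exp q)"
  have rhs: "0 \<le> ?B"
    using form_const_nonneg[OF \<beta> pq] N\<^sub>1[of "{}"] N\<^sub>2[of "{}"] by simp
  have "(\<Sum>Q\<in>F. L Q powr (\<beta> - 1) * fh Q * gh Q) = (\<Sum>Q\<in>F'. L Q powr (\<beta> - 1) * fh Q * gh Q)"
    using F(1) by (intro sum.mono_neutral_right) (auto simp: F'_def fh_def gh_def less_le)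
  also have "\<dots> \<le> ?B"
  proof (cases "F' = {}")
    case False
    then obtain Q0 where Q0: "Q0 \<in> F'" by blast
    interpret laminar_family F' by (rule grid_laminar_family[OF F'])
    have Lpos: "0 < L Q" if "Q \<in> F'" for Q using measure_grid_pos[OF gr[OF that]] by (simp add: L_def)
    have QF: "Q \<in> sets lebesgue" "emeasure lebesgue Q \<noteq> \<infinity>" "emeasure (weight_measure \<sigma>) Q \<noteq> \<infinity>"
      "emeasure (weight_measure w) Q \<noteq> \<infinity>" if "Q \<in> F'" for Q
      using grid_sets[OF gr[OF that]] emeasure_grid[OF gr[OF that]] emeasure_weight_grid[OF \<sigma> gr[OF that]]
        emeasure_weight_grid[OF w gr[OF that]] by auto
    have s: "superadditive F' L" "superadditive F' S" "superadditive F' W" "superadditive F' fh" "superadditive F' gh"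
      unfolding L_def S_def W_def fh_def gh_def
      by (rule superadditive_measure[OF F'(1)];
        use QF Lpos fF gF in \<open>auto simp: L_def S_def W_def fh_def gh_def\<close>)+
    have e1: "0 < \<epsilon>\<^sub>1 x" "0 < \<epsilon>\<^sub>2 x" if "0 < x" for x
      using e(1)[of "lv x"] e(2)[of "lv x"] e_le[OF that] by linarith+
    \<comment> \<open>Positivity comes from the entropy inequality at a single cube, which is why an
      empty F' is treated separately.\<close>
    have K: "0 < K\<^sub>1" "0 < K\<^sub>2"
    proof -
      show "0 < K\<^sub>1" by (rule less_le_trans[OF _ bumps(2)[OF Q0]])
        (use fF(4)[OF Q0] gF(4)[OF Q0] Lpos[OF Q0] bumps(3)[OF Q0] e1(1)[OF bumps(3)[OF Q0]] in simp)
      show "0 < K\<^sub>2" by (rule less_le_trans[OF _ bumps(5)[OF Q0]])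
        (use fF(4)[OF Q0] gF(4)[OF Q0] Lpos[OF Q0] bumps(6)[OF Q0] e1(2)[OF bumps(6)[OF Q0]] in simp)
    qed
    define \<Phi>' where "\<Phi>' = 2 powr (2 * p - 1) * geo (p - 1) * \<Phi>"
    define \<Gamma>' where "\<Gamma>' = 2 powr (2 * conj_exp q - 1) * geo (conj_exp q - 1) * \<Gamma>"
    have "(\<Sum>Q\<in>F'. L Q powr (\<beta> - 1) * fh Q * gh Q) \<le> 2 * 2 powr \<beta> * geo \<beta> *
       (one_sided_const q (q / conj_exp p) (2 * geo 1) N\<^sub>1 + one_sided_const (conj_exp p) (conj_exp p / q) (2 * geo 1) N\<^sub>2)
       * (K\<^sub>1 powr (1 / q) + K\<^sub>2 powr (1 / conj_exp p)) * \<Phi>' powr (1 / p) * \<Gamma>' powr (1 / conj_exp q)"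
    proof (rule form_bound[OF pq \<beta> s _ bumps(3) bumps(6) _ _ K e _ _ N\<^sub>1 N\<^sub>2])
      show "level_antichain F' L" unfolding L_def by (rule grid_level_antichain[OF F'(2)])
    next
      fix D R assume D: "D \<subseteq> F'" "R \<in> D" and pk: "\<And>P. P \<in> D \<Longrightarrow> (\<Sum>Q\<in>below D P. L Q) \<le> 2 * geo 1 * L P"
      have D': "finite D" "D \<subseteq> grid t" "R \<in> F'" using D F' finite_subset by auto
      have r: "0 \<le> q / p" "0 \<le> conj_exp p / conj_exp q" "0 \<le> 2 * geo 1" using pq c geo_pos[of 1] by auto
      show "(\<Sum>Q\<in>below D R. ?s Q powr (q / p) * L Q)
        \<le> 2 * geo 1 * ?r R * S R powr (q / p)"
        unfolding L_def S_def \<beta>_def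
        by (rule local_rho_bound[OF \<sigma> D'(1,2) D(2) r(1,3) pk[unfolded L_def] fF(4)[OF D'(3), unfolded S_def] bumps(1)[OF D'(3)]])
      show "(\<Sum>Q\<in>below D R. ?s' Q powr (conj_exp p / conj_exp q) * L Q)
        \<le> 2 * geo 1 * ?r' R * W R powr (conj_exp p / conj_exp q)"
        unfolding L_def W_def \<beta>_def
        by (rule local_rho_bound[OF w D'(1,2) D(2) r(2,3) pk[unfolded L_def] gF(4)[OF D'(3), unfolded W_def] bumps(4)[OF D'(3)]])
    next
      fix Q assume Q: "Q \<in> F'"
      have "?x Q * e\<^sub>1 (lv (?r Q))
        \<le> ?x Q * \<epsilon>\<^sub>1 (?r Q)"
        using Lpos[OF Q] gF(4)[OF Q] bumps(3)[OF Q] e_le(1)[OF bumps(3)[OF Q]] by (intro mult_left_mono) auto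
      also note bumps(2)[OF Q]
      finally show "?x Q * e\<^sub>1 (lv (?r Q)) \<le> K\<^sub>1" .
    next
      fix Q assume Q: "Q \<in> F'"
      have "?x' Q * e\<^sub>2 (lv (?r' Q))
        \<le> ?x' Q * \<epsilon>\<^sub>2 (?r' Q)"
        using Lpos[OF Q] fF(4)[OF Q] bumps(6)[OF Q] e_le(2)[OF bumps(6)[OF Q]] by (intro mult_left_mono) auto
      also note bumps(5)[OF Q]
      finally show "?x' Q * e\<^sub>2 (lv (?r' Q)) \<le> K\<^sub>2" .
    next
      fix D assume D: "D \<subseteq> F'" and a: "level_antichain D (\<lambda>Q. fh Q / S Q)"
      have DQ: "Q \<in> F'" if "Q \<in> D" for Q using that D by auto
      show "(\<Sum>J\<in>D. (fh J / S J) powr p * S J) \<le> \<Phi>'"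
        unfolding S_def \<Phi>'_def
      proof (rule carleson_embedding[OF subfamily[OF D] a[unfolded S_def] _ pq(1) _ f(2) _ _ fF(3,1) \<Phi>(2,1)])
        show "f \<in> borel_measurable (weight_measure \<sigma>)"
          using f(1) by (simp add: measurable_weight_measure)
        show "D \<subseteq> sets (weight_measure \<sigma>)" using DQ gr grid_sets by auto
      qed (use DQ fF(4) QF(3) in \<open>auto simp: S_def\<close>)
    next
      fix D assume D: "D \<subseteq> F'" and a: "level_antichain D (\<lambda>Q. gh Q / W Q)"
      have DQ: "Q \<in> F'" if "Q \<in> D" for Q using that D by auto
      show "(\<Sum>J\<in>D. (gh J / W J) powr conj_exp q * W J) \<le> \<Gamma>'"
        unfolding W_def \<Gamma>'_def
      proof (rule carleson_embedding[OF subfamily[OF D] a[unfolded W_def] _ c(2) _ g(2) _ _ gF(3,1) \<Gamma>(2,1)])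
        show "g \<in> borel_measurable (weight_measure w)"
          using g(1) by (simp add: measurable_weight_measure)
        show "D \<subseteq> sets (weight_measure w)" using DQ gr grid_sets by auto
      qed (use DQ gF(4) QF(4) in \<open>auto simp: W_def\<close>)
    qed
    also have "\<Phi>' powr (1 / p) = (2 powr (2 * p - 1) * geo (p - 1)) powr (1 / p) * \<Phi> powr (1 / p)"
      unfolding \<Phi>'_def using geo_pos[of "p - 1"] pq \<Phi>(2) by (simp add: powr_mult)
    also have "\<Gamma>' powr (1 / conj_exp q)
      = (2 powr (2 * conj_exp q - 1) * geo (conj_exp q - 1)) powr (1 / conj_exp q) * \<Gamma> powr (1 / conj_exp q)"
      unfolding \<Gamma>'_def using geo_pos[of "conj_exp q - 1"] c \<Gamma>(2) by (simp add: powr_mult)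
    finally show ?thesis by (simp only: form_const_def mult_ac)
  qed (use rhs in simp)
  finally show ?thesis by (simp add: L_def \<beta>_def fh_def gh_def)
qed

text \<open>Duality by one test function: g = S^(q-1) turns the form bound into I <= A I^(1/q') for
  I the integral of S^q. Dividing requires I to be finite, which holds since S is bounded and
  supported on finitely many cubes of finite mass.\<close>

lemma dyadic_operator_bound:
  fixes f :: "real^'n::finite \<Rightarrow> real" and \<alpha> p q C \<Phi> :: real
  assumes q: "1 < q" and w: "weight w" and F: "finite F" "F \<subseteq> grid t"
    and c: "\<And>Q. Q \<in> F \<Longrightarrow> 0 \<le> c Q" and A: "0 \<le> A"
    and form: "\<And>g \<Gamma>. g \<in> borel_measurable lebesgue \<Longrightarrow> (\<And>x. 0 \<le> g x) \<Longrightarrow> 0 \<le> \<Gamma> \<Longrightarrow>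
      Lp_mass (conj_exp q) w g \<le> ennreal \<Gamma> \<Longrightarrow>
      (\<Sum>Q\<in>F. c Q * wint w g Q) \<le> A * \<Gamma> powr (1 / conj_exp q)"
  shows "(\<integral>\<^sup>+x. ennreal ((\<Sum>Q\<in>F. c Q * indicator Q x) powr q) \<partial>weight_measure w) \<le> ennreal (A powr q)"
proof -
  define S where "S = (\<lambda>x. \<Sum>Q\<in>F. c Q * indicator Q x)"
  define B where "B = (\<Sum>Q\<in>F. c Q)"
  define g where "g = (\<lambda>x. S x powr (q - 1))"
  have B: "0 \<le> B" using c by (simp add: B_def sum_nonneg)
  have S0: "0 \<le> S x" for x unfolding S_def using c by (intro sum_nonneg) auto
  have gr: "Q \<in> grid t" if "Q \<in> F" for Q using that F by auto
  have Qs: "Q \<in> sets lebesgue" if "Q \<in> F" for Q using grid_sets[OF gr[OF that]] .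
  have Sm: "S \<in> borel_measurable lebesgue"
    unfolding S_def using Qs by (intro borel_measurable_sum borel_measurable_times borel_measurable_indicator) auto
  then have gm: "g \<in> borel_measurable lebesgue" unfolding g_def by measurable
  have [measurable]: "S \<in> borel_measurable (weight_measure w)" "g \<in> borel_measurable (weight_measure w)"
    using Sm gm by (simp_all add: measurable_weight_measure)
  have cq: "1 < conj_exp q" "(q - 1) * conj_exp q = q" "1 / q + 1 / conj_exp q = 1"
    using conj_exp_gt_1[OF q] conj_exp_sum[OF q] q by (auto simp: conj_exp_def)
  have "(\<integral>\<^sup>+x. ennreal (S x powr q) \<partial>weight_measure w)
      \<le> (\<integral>\<^sup>+x. (\<Sum>Q\<in>F. ennreal (B powr q) * indicator Q x) \<partial>weight_measure w)"
  proof (rule nn_integral_mono)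
    fix x
    show "ennreal (S x powr q) \<le> (\<Sum>Q\<in>F. ennreal (B powr q) * indicator Q x)"
    proof (cases "\<exists>Q\<in>F. x \<in> Q")
      case True
      then obtain P where P: "P \<in> F" "x \<in> P" by blast
      have "S x \<le> B" unfolding S_def B_def using c by (intro sum_mono) (auto simp: indicator_def)
      then have "ennreal (S x powr q) \<le> ennreal (B powr q) * indicator P x"
        using S0[of x] q P by (auto intro!: ennreal_leI powr_mono2)
      also have "\<dots> \<le> (\<Sum>Q\<in>F. ennreal (B powr q) * indicator Q x)"
        using F(1) P by (intro member_le_sum) auto
      finally show ?thesis .
    next
      case False
      then have "S x = 0" unfolding S_def by (intro sum.neutral) (auto simp: indicator_def)
      then show ?thesis by simp
    qed
  qed
  also have "\<dots> = (\<Sum>Q\<in>F. ennreal (B powr q) * emeasure (weight_measure w) Q)"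
    using Qs by (subst nn_integral_sum) (auto simp: nn_integral_cmult_indicator)
  also have "\<dots> < \<infinity>"
    using F(1) emeasure_weight_grid[OF w gr] by (simp add: ennreal_mult_less_top less_top[symmetric] ennreal_mult_eq_top_iff)
  finally obtain I where I: "0 \<le> I" "(\<integral>\<^sup>+x. ennreal (S x powr q) \<partial>weight_measure w) = ennreal I"
    by (auto simp: less_top[symmetric] elim: ennreal_cases)
  have gq: "g x powr conj_exp q = S x powr q" for x by (simp add: g_def powr_powr cq)
  have \<Gamma>: "Lp_mass (conj_exp q) w g \<le> ennreal I" by (simp add: gq I)
  have g0: "0 \<le> g x" for x by (simp add: g_def)
  have "ennreal I = (\<integral>\<^sup>+x. ennreal (S x powr q) \<partial>weight_measure w)" by (simp add: I)
  also have "\<dots> = (\<integral>\<^sup>+x. (\<Sum>Q\<in>F. ennreal (c Q) * (ennreal (g x) * indicator Q x)) \<partial>weight_measure w)"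
  proof (rule nn_integral_cong)
    fix x
    have "S x powr q = S x * g x"
      using S0[of x] powr_add[of "S x" 1 "q - 1"] by (cases "S x = 0") (auto simp: g_def)
    also have "\<dots> = (\<Sum>Q\<in>F. c Q * (g x * indicator Q x))"
      by (simp add: S_def sum_distrib_left mult_ac)
    also have "ennreal \<dots> = (\<Sum>Q\<in>F. ennreal (c Q * (g x * indicator Q x)))"
      using c g0 by (intro sum_ennreal[symmetric]) auto
    also have "\<dots> = (\<Sum>Q\<in>F. ennreal (c Q) * (ennreal (g x) * indicator Q x))"
      using c g0 by (intro sum.cong refl) (auto simp: ennreal_mult indicator_def)
    finally show "ennreal (S x powr q) = (\<Sum>Q\<in>F. ennreal (c Q) * (ennreal (g x) * indicator Q x))" .
  qed
  also have "\<dots> = (\<Sum>Q\<in>F. ennreal (c Q) * (\<integral>\<^sup>+x\<in>Q. ennreal (g x) \<partial>weight_measure w))"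
    using Qs by (subst nn_integral_sum) (auto simp: nn_integral_cmult)
  also have "\<dots> = (\<Sum>Q\<in>F. ennreal (c Q * wint w g Q))"
  proof (intro sum.cong refl)
    fix Q assume Q: "Q \<in> F"
    have "(\<integral>\<^sup>+x\<in>Q. ennreal (g x) \<partial>weight_measure w) = ennreal (wint w g Q)"
      using hat_eq[OF w gr[OF Q] gm g0 less_imp_le[OF cq(1)]] \<Gamma> by (simp add: le_less_trans)
    then show "ennreal (c Q) * (\<integral>\<^sup>+x\<in>Q. ennreal (g x) \<partial>weight_measure w) = ennreal (c Q * wint w g Q)"
      using c[OF Q] by (simp add: ennreal_mult)
  qed
  also have "\<dots> = ennreal (\<Sum>Q\<in>F. c Q * wint w g Q)"
    using c by (intro sum_ennreal) auto
  finally have "I = (\<Sum>Q\<in>F. c Q * wint w g Q)"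
    using I(1) c by (subst (asm) ennreal_inj) (auto intro!: sum_nonneg)
  also have "\<dots> \<le> A * I powr (1 / conj_exp q)" by (rule form[OF gm g0 I(1) \<Gamma>])
  finally have le: "I \<le> A * I powr (1 / conj_exp q)" .
  have "I \<le> A powr q"
  proof (cases "I = 0")
    case False
    then have I0: "0 < I" using I(1) by simp
    have "I powr (1 / q) * I powr (1 / conj_exp q) = I" using I0 cq(3) by (simp add: powr_add[symmetric])
    then have "I powr (1 / q) * I powr (1 / conj_exp q) \<le> A * I powr (1 / conj_exp q)" using le by simp
    then have "I powr (1 / q) \<le> A" by (rule mult_right_le_imp_le) (use I0 in simp)
    then have "(I powr (1 / q)) powr q \<le> A powr q" using q by (intro powr_mono2) auto
    then show ?thesis using q I0 by (simp add: powr_powr)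
  qed simp
  then have "(\<integral>\<^sup>+x. ennreal (S x powr q) \<partial>weight_measure w) \<le> ennreal (A powr q)"
    unfolding I(2) by (rule ennreal_leI)
  then show ?thesis by (simp add: S_def)
qed

section \<open>From dyadic operators to the fractional integral\<close>

lemma epowr_cmult:
  assumes "0 < c"
  shows "(ennreal c * x) epowr a = ennreal (c powr a) * x epowr a"
  using assms
  by (cases x rule: ennreal_cases) (auto simp: ennreal_mult[symmetric] epowr_ennreal powr_mult ennreal_mult_top)

lemma epowr_sum_le:
  fixes a :: "'b \<Rightarrow> ennreal"
  assumes "finite A" "A \<noteq> {}" "0 \<le> q"
  shows "(\<Sum>t\<in>A. a t) epowr q \<le> ennreal (card A powr q) * (\<Sum>t\<in>A. a t epowr q)"
proof -
  define m where "m = Max (a ` A)"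
  have "m \<in> a ` A" unfolding m_def using assms by (intro Max_in) auto
  then obtain t where t: "t \<in> A" "m = a t" by blast
  have "(\<Sum>t\<in>A. a t) \<le> (\<Sum>t\<in>A. m)"
    unfolding m_def using assms by (intro sum_mono Max_ge) auto
  also have "\<dots> = ennreal (card A) * m" by (simp add: ennreal_of_nat_eq_real_of_nat)
  finally have "(\<Sum>t\<in>A. a t) epowr q \<le> (ennreal (card A) * a t) epowr q"
    using assms t by (intro epowr_mono) auto
  also have "\<dots> = ennreal (card A powr q) * a t epowr q"
    using assms by (intro epowr_cmult) (simp add: card_gt_0_iff)
  also have "\<dots> \<le> ennreal (card A powr q) * (\<Sum>t\<in>A. a t epowr q)"
    using assms t by (intro mult_left_mono member_le_sum) auto
  finally show ?thesis .
qed

text \<open>Initial segments of an enumeration exhaust the grid, so sums over it become increasing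
  limits of the finite sums already treated; measurability in a parameter follows as well.\<close>

lemma nn_integral_count_space_eq_SUP:
  fixes a :: "'b \<Rightarrow> ennreal"
  assumes "countable A" "A \<noteq> {}"
  shows "(\<integral>\<^sup>+Q. a Q \<partial>count_space A) = (SUP n. \<Sum>Q\<in>from_nat_into A ` {..<n::nat}. a Q)"
proof -
  define F where "F = (\<lambda>n::nat. from_nat_into A ` {..<n})"
  have F: "finite (F n)" "F n \<subseteq> A" for n using from_nat_into[OF assms(2)] by (auto simp: F_def)
  have inc: "incseq (\<lambda>n Q. a Q * indicator (F n) Q)"
    by (intro incseq_SucI le_funI mult_left_mono) (auto simp: F_def indicator_def)
  have eq: "(\<integral>\<^sup>+Q. a Q * indicator (F n) Q \<partial>count_space A) = (\<Sum>Q\<in>F n. a Q)" for n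
  proof -
    have "(\<integral>\<^sup>+Q. a Q * indicator (F n) Q \<partial>count_space A) = (\<Sum>Q | Q \<in> A \<and> 0 < a Q * indicator (F n) Q. a Q * indicator (F n) Q)"
      using F(1)[of n] by (intro nn_integral_count_space) (auto intro: finite_subset[of _ "F n"] simp: indicator_def split: if_splits)
    also have "\<dots> = (\<Sum>Q\<in>F n. a Q)"
      using F[of n] by (intro sum.mono_neutral_cong_left) (auto simp: indicator_def zero_less_iff_neq_zero split: if_splits)
    finally show ?thesis .
  qed
  have "(\<integral>\<^sup>+Q. a Q \<partial>count_space A) = (\<integral>\<^sup>+Q. (SUP n. a Q * indicator (F n) Q) \<partial>count_space A)"
  proof (rule nn_integral_cong)
    fix Q assume "Q \<in> space (count_space A)"
    then obtain n where "from_nat_into A n = Q"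
      using assms from_nat_into_surj by fastforce
    then have "Q \<in> F (Suc n)" by (auto simp: F_def)
    then have "a Q \<le> (SUP n. a Q * indicator (F n) Q)" by (intro SUP_upper2[of "Suc n"]) auto
    moreover have "(SUP n. a Q * indicator (F n) Q) \<le> a Q" by (intro SUP_least) (auto simp: indicator_def)
    ultimately show "a Q = (SUP n. a Q * indicator (F n) Q)" by (rule antisym)
  qed
  also have "\<dots> = (SUP n. \<integral>\<^sup>+Q. a Q * indicator (F n) Q \<partial>count_space A)"
    using inc by (rule nn_integral_monotone_convergence_SUP) auto
  also have "\<dots> = (SUP n. \<Sum>Q\<in>F n. a Q)" by (simp only: eq)
  finally show ?thesis by (simp add: F_def)
qed

text \<open>An extended-valued I_\<alpha> for nonnegative h: it always makes sense, and its
  finiteness is what convergence of \<open>frac_int\<close> is deduced from.\<close>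

definition riesz_potential :: "real \<Rightarrow> (real^'n::finite \<Rightarrow> real) \<Rightarrow> real^'n \<Rightarrow> ennreal" where
  "riesz_potential \<alpha> h x = (\<integral>\<^sup>+y. ennreal (h y / norm (y - x) powr (real CARD('n) - \<alpha>)) \<partial>lebesgue)"

definition dyadic_potential :: "real \<Rightarrow> ('n::finite \<Rightarrow> bool) \<Rightarrow> (real^'n \<Rightarrow> real) \<Rightarrow> real^'n \<Rightarrow> ennreal" where
  "dyadic_potential \<alpha> t h x = (\<integral>\<^sup>+Q. ennreal (vol Q powr (\<alpha> / real CARD('n) - 1))
     * (\<integral>\<^sup>+y\<in>Q. ennreal (h y) \<partial>lebesgue) * indicator Q x \<partial>count_space (grid t))"

lemma riesz_potential_le:
  fixes \<alpha> :: real and h :: "real^'n::finite \<Rightarrow> real"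
  assumes \<alpha>: "0 < \<alpha>" "\<alpha> < CARD('n)" and h: "h \<in> borel_measurable lebesgue" "\<And>x. 0 \<le> h x"
  shows "riesz_potential \<alpha> h x \<le> ennreal (6 powr (real CARD('n) - \<alpha>)) * (\<Sum>t\<in>UNIV. dyadic_potential \<alpha> t h x)"
proof -
  have [measurable]: "h \<in> borel_measurable lebesgue" by (rule h(1))
  let ?k = "\<lambda>Q :: (real^'n) set. ennreal (vol Q powr (\<alpha> / real CARD('n) - 1))"
  let ?E = "\<lambda>t y. \<integral>\<^sup>+Q. ?k Q * indicator Q x * indicator Q y \<partial>count_space (grid t)"
  have Qm [measurable]: "(\<lambda>y. indicator Q y :: ennreal) \<in> borel_measurable lebesgue" if "Q \<in> grid t" for Q t
    using grid_sets[OF that] by simp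
  have tm: "(\<lambda>y. ennreal (h y) * ?E t y) \<in> borel_measurable lebesgue"
    for t :: "'n \<Rightarrow> bool"
  proof -
    have "(\<lambda>y. ?E t y) \<in> borel_measurable lebesgue"
    proof -
      have "grid t \<noteq> {}" using dyadic_in_grid by blast
      note SUPeq = nn_integral_count_space_eq_SUP[OF countable_grid this]
      have "(\<lambda>y. \<Sum>Q\<in>from_nat_into (grid t) ` {..<n}. ?k Q * indicator Q x * indicator Q y) \<in> borel_measurable lebesgue" for n
        using from_nat_into[OF \<open>grid t \<noteq> {}\<close>] by (intro borel_measurable_sum borel_measurable_times_ennreal) (auto intro!: Qm)
      then show ?thesis unfolding SUPeq by measurable
    qed
    then show ?thesis by measurable
  qed
  have "riesz_potential \<alpha> h x \<le> (\<integral>\<^sup>+y. ennreal (6 powr (real CARD('n) - \<alpha>)) *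
      (\<Sum>t\<in>UNIV. ennreal (h y) * ?E t y) \<partial>lebesgue)"
    unfolding riesz_potential_def
  proof (rule nn_integral_mono)
    fix y
    show "ennreal (h y / norm (y - x) powr (real CARD('n) - \<alpha>)) \<le> ennreal (6 powr (real CARD('n) - \<alpha>)) *
      (\<Sum>t\<in>UNIV. ennreal (h y) * ?E t y)"
    \<comment> \<open>On the diagonal the quotient is h y / 0 = 0, so the kernel bound is needed
      only for distinct points.\<close>
    proof (cases "x = y")
      case False
      have "ennreal (h y / norm (y - x) powr (real CARD('n) - \<alpha>)) = ennreal (h y) * ennreal (1 / norm (y - x) powr (real CARD('n) - \<alpha>))"
        using h(2) by (simp add: ennreal_mult[symmetric])
      also have "\<dots> \<le> ennreal (h y) * (ennreal (6 powr (real CARD('n) - \<alpha>)) *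
        (\<Sum>t\<in>UNIV. ?E t y))"
        by (intro mult_left_mono riesz_kernel_le \<alpha> False) simp
      finally show ?thesis by (simp add: sum_distrib_left mult_ac)
    qed simp
  qed
  also have "\<dots> = ennreal (6 powr (real CARD('n) - \<alpha>)) *
      (\<Sum>t\<in>UNIV. \<integral>\<^sup>+y. ennreal (h y) * ?E t y \<partial>lebesgue)"
    using tm by (subst nn_integral_cmult, simp) (subst nn_integral_sum, auto)
  also have "(\<lambda>t. \<integral>\<^sup>+y. ennreal (h y) * ?E t y \<partial>lebesgue)
    = (\<lambda>t. dyadic_potential \<alpha> t h x)"
  proof
    fix t :: "'n \<Rightarrow> bool"
    have "(\<integral>\<^sup>+y. ennreal (h y) * ?E t y \<partial>lebesgue)
      = (\<integral>\<^sup>+y. (\<integral>\<^sup>+Q. ennreal (h y) * (?k Q * indicator Q x * indicator Q y) \<partial>count_space (grid t)) \<partial>lebesgue)"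
      by (simp add: nn_integral_cmult)
    also have "\<dots> = (\<integral>\<^sup>+Q. (\<integral>\<^sup>+y. ennreal (h y) * (?k Q * indicator Q x * indicator Q y) \<partial>lebesgue) \<partial>count_space (grid t))"
      by (rule nn_integral_count_space_nn_integral[OF countable_grid]) (use Qm in measurable)
    also have "\<dots> = dyadic_potential \<alpha> t h x"
      unfolding dyadic_potential_def
    proof (rule nn_integral_cong)
      fix Q assume "Q \<in> space (count_space (grid t))"
      then have Q: "Q \<in> grid t" by simp
      have [measurable]: "Q \<in> sets lebesgue" by (rule grid_sets[OF Q])
      have "(\<integral>\<^sup>+y. ennreal (h y) * (?k Q * indicator Q x * indicator Q y) \<partial>lebesgue)
        = (\<integral>\<^sup>+y. (?k Q * indicator Q x) * (ennreal (h y) * indicator Q y) \<partial>lebesgue)"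
        by (simp add: mult_ac)
      also have "\<dots> = ?k Q * indicator Q x * (\<integral>\<^sup>+y\<in>Q. ennreal (h y) \<partial>lebesgue)"
        by (rule nn_integral_cmult) measurable
      finally show "(\<integral>\<^sup>+y. ennreal (h y) * (?k Q * indicator Q x * indicator Q y) \<partial>lebesgue)
        = ?k Q * (\<integral>\<^sup>+y\<in>Q. ennreal (h y) \<partial>lebesgue) * indicator Q x" by (simp add: mult_ac)
    qed
    finally show "(\<integral>\<^sup>+y. ennreal (h y) * ?E t y \<partial>lebesgue)
      = dyadic_potential \<alpha> t h x" .
  qed
  finally show ?thesis .
qed

lemma dyadic_potential_bound:
  fixes f :: "real^'n::finite \<Rightarrow> real" and \<alpha> p q A :: real
  assumes p: "1 < p" and q: "1 < q" and \<sigma>: "weight \<sigma>" and w: "weight w"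
    and f: "f \<in> borel_measurable lebesgue" "\<And>x. 0 \<le> f x"
    and \<Phi>: "Lp_mass p \<sigma> f < \<infinity>" and A: "0 \<le> A"
    and form: "\<And>F g \<Gamma>. finite F \<Longrightarrow> F \<subseteq> grid t \<Longrightarrow> g \<in> borel_measurable lebesgue \<Longrightarrow> (\<And>x. 0 \<le> g x) \<Longrightarrow> 0 \<le> \<Gamma> \<Longrightarrow>
      Lp_mass (conj_exp q) w g \<le> ennreal \<Gamma> \<Longrightarrow>
      dyadic_form \<alpha> \<sigma> w F f g \<le> A * \<Gamma> powr (1 / conj_exp q)"
  shows "dyadic_potential \<alpha> t (\<lambda>y. \<sigma> y * f y) \<in> borel_measurable lebesgue"
    and "(\<integral>\<^sup>+x. dyadic_potential \<alpha> t (\<lambda>y. \<sigma> y * f y) x epowr q \<partial>weight_measure w) \<le> ennreal (A powr q)"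
proof -
  define c where "c = (\<lambda>Q. vol Q powr (\<alpha> / real CARD('n) - 1) * wint \<sigma> f Q)"
  let ?P = "dyadic_potential \<alpha> t (\<lambda>y. \<sigma> y * f y)"
  define F where "F = (\<lambda>n::nat. from_nat_into (grid t) ` {..<n})"
  have ne: "grid t \<noteq> {}" using dyadic_in_grid by blast
  have F: "finite (F n)" "F n \<subseteq> grid t" for n using from_nat_into[OF ne] by (auto simp: F_def)
  have c0: "0 \<le> c Q" for Q by (simp add: c_def)
  have [measurable]: "f \<in> borel_measurable lebesgue" "\<sigma> \<in> borel_measurable lebesgue"
    using f(1) weight_measurable[OF \<sigma>] by auto
  have cf: "ennreal (vol Q powr (\<alpha> / real CARD('n) - 1)) * (\<integral>\<^sup>+y\<in>Q. ennreal (\<sigma> y * f y) \<partial>lebesgue) = ennreal (c Q)"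
    if Q: "Q \<in> grid t" for Q
  proof -
    have [measurable]: "Q \<in> sets lebesgue" by (rule grid_sets[OF Q])
    have "(\<integral>\<^sup>+y\<in>Q. ennreal (\<sigma> y * f y) \<partial>lebesgue) = (\<integral>\<^sup>+y. ennreal (\<sigma> y) * (ennreal (f y) * indicator Q y) \<partial>lebesgue)"
      using weight_nonneg[OF \<sigma>] f(2) by (simp add: ennreal_mult mult.assoc)
    also have "\<dots> = (\<integral>\<^sup>+y\<in>Q. ennreal (f y) \<partial>weight_measure \<sigma>)"
      unfolding weight_measure_def by (rule nn_integral_density[symmetric]) measurable
    also have "\<dots> = ennreal (wint \<sigma> f Q)"
      using hat_eq[OF \<sigma> Q f less_imp_le[OF p] \<Phi>] by simp
    finally show ?thesis by (simp add: c_def ennreal_mult)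
  qed
  define S where "S = (\<lambda>n x. \<Sum>Q\<in>F n. c Q * indicator Q x)"
  have S0: "0 \<le> S n x" for n x unfolding S_def using c0 by (intro sum_nonneg) auto
  have eq: "?P x = (SUP n. ennreal (S n x))" for x
  proof -
    have "?P x = (\<integral>\<^sup>+Q. ennreal (c Q * indicator Q x) \<partial>count_space (grid t))"
      unfolding dyadic_potential_def using cf c0 by (intro nn_integral_cong) (auto simp: indicator_def)
    also have "\<dots> = (SUP n. \<Sum>Q\<in>F n. ennreal (c Q * indicator Q x))"
      unfolding F_def by (rule nn_integral_count_space_eq_SUP[OF countable_grid ne])
    also have "(\<lambda>n. \<Sum>Q\<in>F n. ennreal (c Q * indicator Q x)) = (\<lambda>n. ennreal (S n x))"
      unfolding S_def using c0 by (intro ext sum_ennreal) auto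
    finally show ?thesis .
  qed
  have Sm [measurable]: "S n \<in> borel_measurable lebesgue" for n
    unfolding S_def using F(2)[of n] grid_sets
    by (intro borel_measurable_sum borel_measurable_times borel_measurable_indicator) auto
  then have Smw [measurable]: "S n \<in> borel_measurable (weight_measure w)" for n
    by (simp add: measurable_weight_measure)
  show "?P \<in> borel_measurable lebesgue"
    unfolding eq[abs_def] by measurable
  have "(\<integral>\<^sup>+x. ?P x epowr q \<partial>weight_measure w)
    \<le> (\<integral>\<^sup>+x. (SUP n. ennreal (S n x powr q)) \<partial>weight_measure w)"
  proof (rule nn_integral_mono)
    fix x
    have "?P x epowr q \<le> (SUP n. ennreal (S n x) epowr q)"
      unfolding eq using q by (intro epowr_SUP_le) auto
    then show "?P x epowr q \<le> (SUP n. ennreal (S n x powr q))"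
      using S0 by (simp add: epowr_ennreal)
  qed
  also have "\<dots> = (SUP n. \<integral>\<^sup>+x. ennreal (S n x powr q) \<partial>weight_measure w)"
  proof (rule nn_integral_monotone_convergence_SUP)
    show "incseq (\<lambda>n x. ennreal (S n x powr q))"
    proof (intro incseq_SucI le_funI ennreal_leI powr_mono2 S0)
      fix n x
      show "S n x \<le> S (Suc n) x"
        unfolding S_def using F(1) c0 by (intro sum_mono2) (auto simp: F_def)
    qed (use q in simp)
  qed measurable
  also have "\<dots> \<le> ennreal (A powr q)"
  proof (rule SUP_least)
    fix n
    show "(\<integral>\<^sup>+x. ennreal (S n x powr q) \<partial>weight_measure w) \<le> ennreal (A powr q)"
      unfolding S_def
      by (rule dyadic_operator_bound[OF q w F c0 A]) (unfold c_def, rule form[OF F], assumption+)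
  qed
  finally show "(\<integral>\<^sup>+x. ?P x epowr q \<partial>weight_measure w) \<le> ennreal (A powr q)" .
qed

text \<open>A measurable majorant is delivered, which avoids discussing measurability of the
  potential itself. One factor 2^n comes from the q-th power of a sum over 2^n grids, the other from
  adding 2^n integrals, where 2^n <= (2^n)^q.\<close>

lemma riesz_potential_bound:
  fixes f :: "real^'n::finite \<Rightarrow> real" and \<alpha> p q A :: real
  assumes \<alpha>: "0 < \<alpha>" "\<alpha> < CARD('n)" and p: "1 < p" and q: "1 < q" and \<sigma>: "weight \<sigma>" and w: "weight w"
    and f: "f \<in> borel_measurable lebesgue" "\<And>x. 0 \<le> f x"
    and \<Phi>: "Lp_mass p \<sigma> f < \<infinity>" and A: "0 \<le> A"
    and form: "\<And>t F g \<Gamma>. finite F \<Longrightarrow> F \<subseteq> grid t \<Longrightarrow> g \<in> borel_measurable lebesgue \<Longrightarrow> (\<And>x. 0 \<le> g x) \<Longrightarrow> 0 \<le> \<Gamma> \<Longrightarrow>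
      Lp_mass (conj_exp q) w g \<le> ennreal \<Gamma> \<Longrightarrow>
      dyadic_form \<alpha> \<sigma> w F f g \<le> A * \<Gamma> powr (1 / conj_exp q)"
  shows "\<exists>R\<in>borel_measurable lebesgue. (\<forall>x. riesz_potential \<alpha> (\<lambda>y. \<sigma> y * f y) x \<le> R x) \<and>
    (\<integral>\<^sup>+x. R x epowr q \<partial>weight_measure w) \<le> ennreal ((6 powr (real CARD('n) - \<alpha>) * (2 ^ CARD('n))\<^sup>2 * A) powr q)"
proof (rule bexI, intro conjI allI)
  define h where "h = (\<lambda>y. \<sigma> y * f y)"
  define M :: real where "M = 2 ^ CARD('n)"
  define d where "d = 6 powr (real CARD('n) - \<alpha>)"
  define T where "T = (\<lambda>t x. dyadic_potential \<alpha> t h x)"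
  have M: "1 \<le> M" "real (card (UNIV :: ('n \<Rightarrow> bool) set)) = M" by (simp_all add: M_def card_fun)
  have d: "0 < d" by (simp add: d_def)
  have hm: "h \<in> borel_measurable lebesgue" "\<And>x. 0 \<le> h x"
    using f weight_measurable[OF \<sigma>] weight_nonneg[OF \<sigma>] by (auto simp: h_def)
  have Tm: "T t \<in> borel_measurable lebesgue" "(\<integral>\<^sup>+x. T t x epowr q \<partial>weight_measure w) \<le> ennreal (A powr q)" for t
    unfolding T_def h_def
    by (rule dyadic_potential_bound[OF p q \<sigma> w f \<Phi> A], rule form; assumption)+
  then have Tmw [measurable]: "T t \<in> borel_measurable (weight_measure w)" for t
    by (simp add: measurable_weight_measure)
  define R where "R = (\<lambda>x. ennreal d * (\<Sum>t\<in>UNIV. T t x))"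
  show "R \<in> borel_measurable lebesgue" unfolding R_def using Tm(1) by measurable
  show "riesz_potential \<alpha> (\<lambda>y. \<sigma> y * f y) x \<le> R x" for x
    using riesz_potential_le[OF \<alpha> hm, of x] by (simp add: R_def T_def d_def h_def)
  have "(\<integral>\<^sup>+x. R x epowr q \<partial>weight_measure w)
    \<le> (\<integral>\<^sup>+x. ennreal (d powr q * M powr q) * (\<Sum>t\<in>UNIV. T t x epowr q) \<partial>weight_measure w)"
  proof (rule nn_integral_mono)
    fix x
    have "R x epowr q = ennreal (d powr q) * (\<Sum>t\<in>UNIV. T t x) epowr q"
      unfolding R_def by (rule epowr_cmult[OF d])
    also have "\<dots> \<le> ennreal (d powr q) * (ennreal (M powr q) * (\<Sum>t\<in>UNIV. T t x epowr q))"
      using epowr_sum_le[of UNIV q "\<lambda>t. T t x"] q M(2) by (intro mult_left_mono) auto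
    finally show "R x epowr q \<le> ennreal (d powr q * M powr q) * (\<Sum>t\<in>UNIV. T t x epowr q)"
      by (simp add: ennreal_mult mult.assoc)
  qed
  also have "\<dots> = ennreal (d powr q * M powr q) * (\<Sum>t\<in>UNIV. \<integral>\<^sup>+x. T t x epowr q \<partial>weight_measure w)"
    by (subst nn_integral_cmult, measurable) (subst nn_integral_sum, auto)
  also have "\<dots> \<le> ennreal (d powr q * M powr q) * (\<Sum>t\<in>(UNIV :: ('n \<Rightarrow> bool) set). ennreal (A powr q))"
    by (intro mult_left_mono sum_mono Tm(2)) simp
  also have "\<dots> = ennreal (d powr q * M powr q * (M * A powr q))"
    using M by (simp add: ennreal_mult ennreal_of_nat_eq_real_of_nat)
  also have "\<dots> \<le> ennreal ((d * M\<^sup>2 * A) powr q)"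
  proof (rule ennreal_leI)
    have "M powr 1 \<le> M powr q" using M(1) q by (intro powr_mono) auto
    then have "d powr q * M powr q * (M * A powr q) \<le> d powr q * M powr q * (M powr q * A powr q)"
      using M(1) by (intro mult_left_mono mult_right_mono) auto
    also have "\<dots> = (d * M\<^sup>2 * A) powr q"
      using d M(1) A by (simp add: powr_mult power2_eq_square)
    finally show "d powr q * M powr q * (M * A powr q) \<le> (d * M\<^sup>2 * A) powr q" .
  qed
  finally show "(\<integral>\<^sup>+x. R x epowr q \<partial>weight_measure w) \<le> ennreal ((6 powr (real CARD('n) - \<alpha>) * (2 ^ CARD('n))\<^sup>2 * A) powr q)"
    by (simp add: d_def M_def)
qed

text \<open>Measurability of a parameter integral needs a jointly measurable integrand. A Borel
  function equal to h almost everywhere provides one without changing the integral at any x.\<close>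

lemma frac_int_measurable:
  fixes h :: "real^'n::finite \<Rightarrow> complex"
  assumes h: "h \<in> borel_measurable lebesgue"
  shows "frac_int \<alpha> h \<in> borel_measurable lebesgue"
proof -
  have "(\<lambda>x. Re (h x)) \<in> borel_measurable lebesgue" using h by measurable
  from completion_ex_borel_measurable_real[OF this]
  obtain r where r [measurable]: "r \<in> borel_measurable lborel" and aer: "AE x in lborel. Re (h x) = r x" by blast
  have "(\<lambda>x. Im (h x)) \<in> borel_measurable lebesgue" using h by measurable
  from completion_ex_borel_measurable_real[OF this]
  obtain i where i [measurable]: "i \<in> borel_measurable lborel" and aei: "AE x in lborel. Im (h x) = i x" by blast
  define g where "g = (\<lambda>x. Complex (r x) (i x))"
  have g [measurable]: "g \<in> borel_measurable borel"
    using r i unfolding g_def Complex_eq by measurable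
  have gh: "AE x in lebesgue. h x = g x"
  proof (rule AE_completion)
    show "AE x in lborel. h x = g x" using aer aei by eventually_elim (simp add: g_def complex_eq_iff)
  qed
  define k where "k = (\<lambda>(x :: real^'n) (y :: real^'n). of_real (norm (y - x) powr (real CARD('n) - \<alpha>)) :: complex)"
  have km: "(\<lambda>y. g y / k x y) \<in> borel_measurable borel" for x
    unfolding k_def by measurable
  have eq: "frac_int \<alpha> h x = (LINT y|lborel. g y / k x y)" for x
  proof -
    have "frac_int \<alpha> h x = (LINT y|lebesgue. h y / k x y)" by (simp add: frac_int_def k_def)
    also have "\<dots> = (LINT y|lebesgue. g y / k x y)"
    proof (rule integral_cong_AE)
      show "(\<lambda>y. g y / k x y) \<in> borel_measurable lebesgue"
        using km[of x] by (intro measurable_completion) simp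
      have "(\<lambda>y. k x y) \<in> borel_measurable lebesgue"
        unfolding k_def by (intro measurable_completion) measurable
      then show "(\<lambda>y. h y / k x y) \<in> borel_measurable lebesgue" using h by measurable
      show "AE y in lebesgue. h y / k x y = g y / k x y" using gh by eventually_elim simp
    qed
    also have "\<dots> = (LINT y|lborel. g y / k x y)" using km[of x] by (intro integral_completion) simp
    finally show ?thesis .
  qed
  have "(\<lambda>x. LINT y|lborel. g y / k x y) \<in> borel_measurable borel"
  proof (rule lborel.borel_measurable_lebesgue_integral)
    show "(\<lambda>(x, y). g y / k x y) \<in> borel_measurable (borel \<Otimes>\<^sub>M lborel)"
      unfolding k_def by measurable
  qed
  then have "frac_int \<alpha> h \<in> borel_measurable borel" unfolding eq[abs_def, symmetric] .
  then show ?thesis by (intro measurable_completion) simp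
qed

text \<open>Everything is read off from the Riesz potential of \<sigma> |f|: its majorant R is
  finite w-almost everywhere, which gives absolute convergence there, and R dominates
  |I_\<alpha>(\<sigma> f)|.\<close>

lemma frac_int_op_norm_le:
  fixes \<sigma> w :: "real^'n::finite \<Rightarrow> real" and \<alpha> p q A :: real
  assumes \<alpha>: "0 < \<alpha>" "\<alpha> < CARD('n)" and p: "1 < p" and q: "1 < q" and \<sigma>: "weight \<sigma>" and w: "weight w" and A: "0 \<le> A"
    and form: "\<And>t F f g \<Phi> \<Gamma>. finite F \<Longrightarrow> F \<subseteq> grid t \<Longrightarrow>
      f \<in> borel_measurable lebesgue \<Longrightarrow> (\<And>x. 0 \<le> f x) \<Longrightarrow> 0 \<le> \<Phi> \<Longrightarrow>
      Lp_mass p \<sigma> f \<le> ennreal \<Phi> \<Longrightarrow>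
      g \<in> borel_measurable lebesgue \<Longrightarrow> (\<And>x. 0 \<le> g x) \<Longrightarrow> 0 \<le> \<Gamma> \<Longrightarrow>
      Lp_mass (conj_exp q) w g \<le> ennreal \<Gamma> \<Longrightarrow>
      dyadic_form \<alpha> \<sigma> w F f g \<le> A * \<Phi> powr (1 / p) * \<Gamma> powr (1 / conj_exp q)"
  shows "frac_int_op_norm \<alpha> p q \<sigma> w \<le> ennreal (6 powr (real CARD('n) - \<alpha>) * (2 ^ CARD('n))\<^sup>2 * A)"
  unfolding frac_int_op_norm_def Lp_op_norm_def
proof (rule Inf_lower, rule CollectI, intro exI conjI ballI)
  define c where "c = 6 powr (real CARD('n) - \<alpha>) * (2 ^ CARD('n))\<^sup>2"
  have c: "0 \<le> c" by (simp add: c_def)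
  show "ennreal (6 powr (real CARD('n) - \<alpha>) * (2 ^ CARD('n))\<^sup>2 * A) = ennreal (c * A)" by (simp add: c_def)
  show "0 \<le> c * A" using c A by simp
  fix f :: "real^'n \<Rightarrow> complex" assume "f \<in> Lp_space (weight_measure \<sigma>) p"
  then have fm: "f \<in> borel_measurable lebesgue" and fi: "integrable (weight_measure \<sigma>) (\<lambda>x. norm (f x) powr p)"
    by (simp_all add: Lp_space_def measurable_weight_measure)
  define \<Phi> where "\<Phi> = (LINT x|weight_measure \<sigma>. norm (f x) powr p)"
  have \<Phi>0: "0 \<le> \<Phi>" by (simp add: \<Phi>_def)
  have \<Phi>: "(\<integral>\<^sup>+x. ennreal (norm (f x) powr p) \<partial>weight_measure \<sigma>) = ennreal \<Phi>"
    unfolding \<Phi>_def using fi by (intro nn_integral_eq_integral) auto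
  define B where "B = A * \<Phi> powr (1 / p)"
  have B: "0 \<le> B" using A by (simp add: B_def)
  have nfm: "(\<lambda>x. norm (f x)) \<in> borel_measurable lebesgue" using fm by measurable
  have fin: "(\<integral>\<^sup>+x. ennreal (norm (f x) powr p) \<partial>weight_measure \<sigma>) < \<infinity>" by (simp add: \<Phi>)
  have form': "dyadic_form \<alpha> \<sigma> w F (\<lambda>x. norm (f x)) g \<le> B * \<Gamma> powr (1 / conj_exp q)"
    if *: "finite F" "F \<subseteq> grid t" "g \<in> borel_measurable lebesgue" "\<And>x. 0 \<le> g x" "0 \<le> \<Gamma>"
      "Lp_mass (conj_exp q) w g \<le> ennreal \<Gamma>" for t F g \<Gamma>
    unfolding B_def by (rule form[OF *(1,2) nfm norm_ge_zero \<Phi>0 eq_refl[OF \<Phi>] *(3-6)])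
  have ex: "\<exists>R\<in>borel_measurable lebesgue. (\<forall>x. riesz_potential \<alpha> (\<lambda>y. \<sigma> y * norm (f y)) x \<le> R x) \<and>
    (\<integral>\<^sup>+x. R x epowr q \<partial>weight_measure w) \<le> ennreal ((c * B) powr q)"
    unfolding c_def by (rule riesz_potential_bound[OF \<alpha> p q \<sigma> w nfm norm_ge_zero fin B form'])
  obtain R where Rm: "R \<in> borel_measurable lebesgue"
    and R: "\<And>x. riesz_potential \<alpha> (\<lambda>y. \<sigma> y * norm (f y)) x \<le> R x"
    and Rq: "(\<integral>\<^sup>+x. R x epowr q \<partial>weight_measure w) \<le> ennreal ((c * B) powr q)"
    using ex by blast
  define h where "h = (\<lambda>y. of_real (\<sigma> y) * f y)"
  have hm: "h \<in> borel_measurable lebesgue" unfolding h_def using fm weight_measurable[OF \<sigma>] by measurable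
  define T where "T = frac_int \<alpha> h"
  define k where "k = (\<lambda>(x :: real^'n) (y :: real^'n). h y / of_real (norm (y - x) powr (real CARD('n) - \<alpha>)))"
  have km: "k x \<in> borel_measurable lebesgue" for x
  proof -
    have "(\<lambda>y. of_real (norm (y - x) powr (real CARD('n) - \<alpha>)) :: complex) \<in> borel_measurable lebesgue"
      by (intro measurable_completion) measurable
    then show ?thesis unfolding k_def using hm by measurable
  qed
  have kint: "(\<integral>\<^sup>+y. ennreal (norm (k x y)) \<partial>lebesgue) = riesz_potential \<alpha> (\<lambda>y. \<sigma> y * norm (f y)) x" for x
    unfolding riesz_potential_def k_def h_def
    using weight_nonneg[OF \<sigma>] by (simp add: norm_mult norm_divide)
  have Rmw [measurable]: "R \<in> borel_measurable (weight_measure w)"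
    using Rm by (simp add: measurable_weight_measure)
  have "AE x in weight_measure w. R x epowr q \<noteq> \<infinity>"
    by (rule nn_integral_PInf_AE) (use Rq in \<open>auto simp: top_unique\<close>)
  then have "AE x in weight_measure w. frac_int_defined \<alpha> h x"
  proof eventually_elim
    case (elim x)
    then have "R x < \<infinity>" by (cases "R x = top") (auto simp: less_top)
    then have "(\<integral>\<^sup>+y. ennreal (norm (k x y)) \<partial>lebesgue) < \<infinity>" unfolding kint using R[of x] le_less_trans by blast
    then have "integrable lebesgue (k x)" using km by (intro integrableI_bounded) auto
    then show ?case by (simp add: frac_int_defined_def k_def)
  qed
  then show "AE x in weight_measure w. frac_int_defined \<alpha> (\<lambda>y. of_real (\<sigma> y) * f y) x" by (simp add: h_def)
  have TR: "ennreal (norm (T x)) \<le> R x" for x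
  proof (cases "integrable lebesgue (k x)")
    case True
    have "ennreal (norm (T x)) \<le> (\<integral>\<^sup>+y. ennreal (norm (k x y)) \<partial>lebesgue)"
      using integral_norm_bound_ennreal[OF True] by (simp add: T_def frac_int_def k_def)
    then show ?thesis unfolding kint using R[of x] by (rule order_trans)
  next
    case False
    \<comment> \<open>At points of divergence the integral has the default value 0, so the pointwise
      bound holds everywhere.\<close>
    then have "T x = 0" unfolding T_def frac_int_def k_def by (rule not_integrable_integral_eq)
    then show ?thesis by simp
  qed
  have Tm: "T \<in> borel_measurable lebesgue" unfolding T_def by (rule frac_int_measurable[OF hm])
  have Tmw [measurable]: "T \<in> borel_measurable (weight_measure w)"
    using Tm by (simp add: measurable_weight_measure)
  have "(\<integral>\<^sup>+x. ennreal (norm (T x) powr q) \<partial>weight_measure w) \<le> (\<integral>\<^sup>+x. R x epowr q \<partial>weight_measure w)"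
  proof (rule nn_integral_mono)
    fix x
    have "ennreal (norm (T x)) epowr q \<le> R x epowr q" using TR q by (intro epowr_mono) auto
    then show "ennreal (norm (T x) powr q) \<le> R x epowr q" by (simp add: epowr_ennreal)
  qed
  also note Rq
  finally have Tq: "(\<integral>\<^sup>+x. ennreal (norm (T x) powr q) \<partial>weight_measure w) \<le> ennreal ((c * B) powr q)" .
  have Ti: "integrable (weight_measure w) (\<lambda>x. norm (T x) powr q)"
    using Tq by (intro integrableI_bounded) (auto intro: le_less_trans)
  then show "frac_int \<alpha> (\<lambda>y. of_real (\<sigma> y) * f y) \<in> Lp_space (weight_measure w) q"
    using Tmw by (simp add: Lp_space_def T_def h_def)
  have "ennreal (LINT x|weight_measure w. norm (T x) powr q) = (\<integral>\<^sup>+x. ennreal (norm (T x) powr q) \<partial>weight_measure w)"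
    using Ti by (intro nn_integral_eq_integral[symmetric]) auto
  then have "ennreal (LINT x|weight_measure w. norm (T x) powr q) \<le> ennreal ((c * B) powr q)" using Tq by simp
  then have "(LINT x|weight_measure w. norm (T x) powr q) \<le> (c * B) powr q" by (subst (asm) ennreal_le_iff) auto
  then have "Lp_norm (weight_measure w) q T \<le> ((c * B) powr q) powr (1 / q)"
    unfolding Lp_norm_def using q by (intro powr_mono2) auto
  also have "\<dots> = c * B" using q c B by (simp add: powr_powr)
  finally show "Lp_norm (weight_measure w) q (frac_int \<alpha> (\<lambda>y. of_real (\<sigma> y) * f y)) \<le> c * A * Lp_norm (weight_measure \<sigma>) p f"
    by (simp add: T_def h_def B_def Lp_norm_def \<Phi>_def mult.assoc)
qed

theorem theorem1p5:
  fixes \<alpha> :: real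
  assumes "0 < \<alpha>" and "\<alpha> < real CARD('n::finite)"
  shows "\<exists>C\<^sub>0::real. 0 < C\<^sub>0 \<and>
    (\<forall>(p::real) (q::real) (\<epsilon>\<^sub>1::real \<Rightarrow> real) (\<epsilon>\<^sub>2::real \<Rightarrow> real).
       1 < p \<and> p \<le> q \<and> bump_function q \<epsilon>\<^sub>1 \<and> bump_function (conj_exp p) \<epsilon>\<^sub>2 \<longrightarrow>
       (\<exists>C::real. 0 < C \<and>
         (\<forall>(\<sigma>::real^'n \<Rightarrow> real) (w::real^'n \<Rightarrow> real). weight \<sigma> \<and> weight w \<longrightarrow>
            frac_int_op_norm \<alpha> p q \<sigma> w
              \<le> ennreal (C * C\<^sub>0) *
                 ((entropy_bump \<alpha> p q \<epsilon>\<^sub>1 \<sigma> w) epowr (1 / q)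
                  + (entropy_bump \<alpha> (conj_exp q) (conj_exp p) \<epsilon>\<^sub>2 w \<sigma>) epowr (1 / conj_exp p)))))"
proof (rule exI[of _ 1], intro conjI allI impI)
  \<comment> \<open>The witness 1 for the first constant suffices: \<alpha> and the dimension are
    fixed before C is chosen, so C can absorb the dependence on them.\<close>
  fix p q :: real and \<epsilon>\<^sub>1 \<epsilon>\<^sub>2 :: "real \<Rightarrow> real"
  assume H: "1 < p \<and> p \<le> q \<and> bump_function q \<epsilon>\<^sub>1 \<and> bump_function (conj_exp p) \<epsilon>\<^sub>2"
  then have pq: "1 < p" "p \<le> q" and q: "1 < q" by auto
  have p': "1 < conj_exp p" by (rule conj_exp_gt_1[OF pq(1)])
  obtain e\<^sub>1 N\<^sub>1 where e\<^sub>1: "\<And>a. 0 < e\<^sub>1 a" "\<And>t. 0 < t \<Longrightarrow> e\<^sub>1 (lv t) \<le> \<epsilon>\<^sub>1 t"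
    "\<And>I. finite I \<Longrightarrow> (\<Sum>a\<in>I. e\<^sub>1 a powr (- (1 / q))) \<le> N\<^sub>1"
    using bump_function_levels[of q \<epsilon>\<^sub>1] H q by auto
  obtain e\<^sub>2 N\<^sub>2 where e\<^sub>2: "\<And>a. 0 < e\<^sub>2 a" "\<And>t. 0 < t \<Longrightarrow> e\<^sub>2 (lv t) \<le> \<epsilon>\<^sub>2 t"
    "\<And>I. finite I \<Longrightarrow> (\<Sum>a\<in>I. e\<^sub>2 a powr (- (1 / conj_exp p))) \<le> N\<^sub>2"
    using bump_function_levels[of "conj_exp p" \<epsilon>\<^sub>2] H p' by auto
  define c where "c = 6 powr (real CARD('n) - \<alpha>) * (2 ^ CARD('n))\<^sup>2"
  define D where "D = form_const (\<alpha> / CARD('n)) p q N\<^sub>1 N\<^sub>2"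
  have D: "0 \<le> D"
    unfolding D_def using e\<^sub>1(3)[of "{}"] e\<^sub>2(3)[of "{}"] assms pq by (intro form_const_nonneg) auto
  have c: "0 \<le> c" by (simp add: c_def)
  show "\<exists>C::real. 0 < C \<and>
         (\<forall>(\<sigma>::real^'n \<Rightarrow> real) (w::real^'n \<Rightarrow> real). weight \<sigma> \<and> weight w \<longrightarrow>
            frac_int_op_norm \<alpha> p q \<sigma> w
              \<le> ennreal (C * 1) *
                 ((entropy_bump \<alpha> p q \<epsilon>\<^sub>1 \<sigma> w) epowr (1 / q)
                  + (entropy_bump \<alpha> (conj_exp q) (conj_exp p) \<epsilon>\<^sub>2 w \<sigma>) epowr (1 / conj_exp p)))"
  proof (rule exI[of _ "c * D + 1"], intro conjI allI impI)
    \<comment> \<open>The summand 1 guarantees a positive constant even if c * D = 0. An infinite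
      entropy constant then makes the right-hand side infinite, whereas 0 times infinity would be
      0.\<close>
    show C: "0 < c * D + 1" using c D by (simp add: add_nonneg_pos)
    fix \<sigma> w :: "real^'n \<Rightarrow> real"
    assume "weight \<sigma> \<and> weight w"
    then have \<sigma>: "weight \<sigma>" and w: "weight w" by auto
    define E\<^sub>1 where "E\<^sub>1 = entropy_bump \<alpha> p q \<epsilon>\<^sub>1 \<sigma> w"
    define E\<^sub>2 where "E\<^sub>2 = entropy_bump \<alpha> (conj_exp q) (conj_exp p) \<epsilon>\<^sub>2 w \<sigma>"
    show "frac_int_op_norm \<alpha> p q \<sigma> w \<le> ennreal ((c * D + 1) * 1) *
                 ((entropy_bump \<alpha> p q \<epsilon>\<^sub>1 \<sigma> w) epowr (1 / q)
                  + (entropy_bump \<alpha> (conj_exp q) (conj_exp p) \<epsilon>\<^sub>2 w \<sigma>) epowr (1 / conj_exp p))"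
    proof (cases "E\<^sub>1 = \<infinity> \<or> E\<^sub>2 = \<infinity>")
      case True
      then show ?thesis using C unfolding E\<^sub>1_def E\<^sub>2_def by (auto simp: ennreal_mult_top)
    next
      case False
      then obtain K\<^sub>1 K\<^sub>2 where K: "0 \<le> K\<^sub>1" "E\<^sub>1 = ennreal K\<^sub>1" "0 \<le> K\<^sub>2" "E\<^sub>2 = ennreal K\<^sub>2"
        by (metis ennreal_cases infinity_ennreal_def)
      define k where "k = K\<^sub>1 powr (1 / q) + K\<^sub>2 powr (1 / conj_exp p)"
      have k: "0 \<le> k" by (simp add: k_def)
      have "frac_int_op_norm \<alpha> p q \<sigma> w \<le> ennreal (6 powr (real CARD('n) - \<alpha>) * (2 ^ CARD('n))\<^sup>2 * (D * k))"
      proof (rule frac_int_op_norm_le[OF assms pq(1) q \<sigma> w])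
        show "0 \<le> D * k" using D k by simp
        fix t and F :: "(real^'n) set set" and f g :: "real^'n \<Rightarrow> real" and \<Phi> \<Gamma> :: real
        assume *: "finite F" "F \<subseteq> grid t" "f \<in> borel_measurable lebesgue" "\<And>x. 0 \<le> f x" "0 \<le> \<Phi>"
          "Lp_mass p \<sigma> f \<le> ennreal \<Phi>"
          "g \<in> borel_measurable lebesgue" "\<And>x. 0 \<le> g x" "0 \<le> \<Gamma>"
          "Lp_mass (conj_exp q) w g \<le> ennreal \<Gamma>"
        show "dyadic_form \<alpha> \<sigma> w F f g \<le> D * k * \<Phi> powr (1 / p) * \<Gamma> powr (1 / conj_exp q)"
          unfolding D_def k_def
          by (rule weighted_form_bound[OF assms(1) pq \<sigma> w e\<^sub>1(1) e\<^sub>2(1) e\<^sub>1(2) e\<^sub>2(2) e\<^sub>1(3) e\<^sub>2(3)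
              eq_refl[OF K(2)[unfolded E\<^sub>1_def]] K(1) eq_refl[OF K(4)[unfolded E\<^sub>2_def]] K(3) *(1,2,3,4,7,8,6,5,10,9)])
      qed
      also have "\<dots> \<le> ennreal ((c * D + 1) * k)"
        using c D k by (intro ennreal_leI) (simp add: c_def distrib_right mult.assoc)
      also have "\<dots> = ennreal ((c * D + 1) * 1) * (E\<^sub>1 epowr (1 / q) + E\<^sub>2 epowr (1 / conj_exp p))"
        using K C by (simp add: k_def epowr_ennreal ennreal_mult ennreal_plus)
      finally show ?thesis by (simp add: E\<^sub>1_def E\<^sub>2_def)
    qed
  qed
qed simp

end
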